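(* Given as input a finite non-empty set $X$ and a family $C$ of subsets of $X$ with $|C|\ge 2$ (with $Z=X\times\{0,1\}$ and $c\models(x,b)$ if and only if ($b=1$ and $x\in c$) or ($b=0$ and $x\notin c$)), the following objects can be computed in time polynomial in $|C|$ and $|X|$: (i) the bipartite consistency graph $G(C)$ with vertex sets $C$ and $Z$ and edges $\{(c,z):c\models z\}$; (ii) the (identical) parameters $\mathrm{SMN}(G^+(C))$ and $\mathrm{MLE\text{-}TD}(C)$; (iii) a $C$-saturating matching $M$ in $G^+(C)$ of order $\mathrm{SMN}(G^+(C))$; (iv) parameters representing an MLE-learner $L$ for $C$ and a teacher $T$ for $L$ of order $\mathrm{MLE\text{-}TD}(C)$.
   Context: For $A\subseteq Z$, $c\models A$ means $c\models z$ for all $z\in A$. $G^+(C)$ is the bipartite graph with vertex classes $C$ and $2^Z\setminus\{\emptyset\}$ and edges $\{(c,A):c\models A\}$. A $C$-saturating matching in it is an injective map $M:C\to 2^Z\setminus\{\emptyset\}$ with $c\models M(c)$ for all $c\in C$; its order is $\max_{c\in C}|M(c)|$; $\mathrm{SMN}(G^+(C))$ is the smallest possible order of a $C$-saturating matching in $G^+(C)$. $\mathrm{MLE\text{-}TD}(C)$ here refers to unordered sampling without replacement and is defined as follows. For a probability vector $Q=(q(z))_{z\in Z}$ and a set $A=\{z_1,\dots,z_n\}\subseteq Z$ of size $n\le|\{z:q(z)>0\}|$, $P^{\overline{O},\overline{R}}(A|Q)=\sum_\sigma\prod_{i=1}^n \frac{q(z_{\sigma(i)})}{1-(q(z_{\sigma(1)})+\dots+q(z_{\sigma(i-1)}))}$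 over all permutations $\sigma$ of $\{1,\dots,n\}$ (equal to $1$ for $A=\emptyset$). An MLE-learner $L$ for $C$ is given by conditional likelihoods $P(z|c)\ge 0$ with $\sum_{z\in Z}P(z|c)=1$ for each $c\in C$, such that $c\not\models z$ implies $P(z|c)=0$. Let $N^+(C,L)=\min_{c\in C}|\{z\in Z:P(z|c)>0\}|$. A teacher for $L$ is a map $T:C\to 2^Z$ such that for every $c_0\in C$: $|T(c_0)|\le N^+(C,L)$ and $c_0$ is the unique maximizer over $c\in C$ of $P^{\overline{O},\overline{R}}(T(c_0)|P(\cdot|c))$. The order of $T$ is $\max_{c\in C}|T(c)|$. $\mathrm{MLE\text{-}TD}(C)$ is the smallest $d$ such that some MLE-learner for $C$ has a teacher of order $d$. *)

theory Defs
  imports "HOL-Combinatorics.Multiset_Permutations" "HOL-Computational_Algebra.Polynomial"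
begin

section \<open>Concept classes and consistency graphs\<close>

definition examples :: "'a set \<Rightarrow> ('a \<times> bool) set" where
  "examples X = X \<times> UNIV"

fun sat :: "'a set \<Rightarrow> 'a \<times> bool \<Rightarrow> bool" where
  "sat c (x, b) \<longleftrightarrow> b \<and> x \<in> c \<or> \<not> b \<and> x \<notin> c"

definition sat_all :: "'a set \<Rightarrow> ('a \<times> bool) set \<Rightarrow> bool" where
  "sat_all c A \<longleftrightarrow> (\<forall>z\<in>A. sat c z)"

text \<open>Bipartite graphs are given by their edge sets; the two vertex classes are
  \<open>C\<close> and \<open>examples X\<close>, respectively \<open>C\<close> and \<open>Pow (examples X) - {{}}\<close>.\<close>

definition graph_G :: "'a set \<Rightarrow> 'a set set \<Rightarrow> ('a set \<times> ('a \<times> bool)) set" where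
  "graph_G X C = {(c, z). c \<in> C \<and> z \<in> examples X \<and> sat c z}"

definition graph_Gplus :: "'a set \<Rightarrow> 'a set set \<Rightarrow> ('a set \<times> ('a \<times> bool) set) set" where
  "graph_Gplus X C = {(c, A). c \<in> C \<and> A \<in> Pow (examples X) - {{}} \<and> sat_all c A}"

definition saturating_matching :: "'c set \<Rightarrow> ('c \<times> 'z set) set \<Rightarrow> ('c \<Rightarrow> 'z set) \<Rightarrow> bool" where
  "saturating_matching C E M \<longleftrightarrow> inj_on M C \<and> (\<forall>c\<in>C. (c, M c) \<in> E)"

definition map_order :: "'c set \<Rightarrow> ('c \<Rightarrow> 'z set) \<Rightarrow> nat" where
  "map_order C M = Max ((\<lambda>c. card (M c)) ` C)"

definition SMN :: "'c set \<Rightarrow> ('c \<times> 'z set) set \<Rightarrow> nat" where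
  "SMN C E = (LEAST d. \<exists>M. saturating_matching C E M \<and> map_order C M = d)"


section \<open>MLE-learners, unordered sampling without replacement\<close>

text \<open>The probability of drawing the set \<open>A\<close>, summed over all orders in which its elements
  can be drawn. It is meaningful for \<open>card A \<le> card {z. q z > 0}\<close>, when no denominator
  vanishes; the definition of a teacher only uses it in that range.\<close>

definition draw_prob :: "('z \<Rightarrow> real) \<Rightarrow> 'z set \<Rightarrow> real" where
  "draw_prob q A = (\<Sum>zs\<in>permutations_of_set A.
     \<Prod>i<length zs. q (zs ! i) / (1 - (\<Sum>j<i. q (zs ! j))))"

text \<open>\<open>L c z\<close> is the conditional likelihood \<open>P(z | c)\<close>.\<close>

definition MLE_learner :: "'a set \<Rightarrow> 'a set set \<Rightarrow> ('a set \<Rightarrow> 'a \<times> bool \<Rightarrow> real) \<Rightarrow> bool" where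
  "MLE_learner X C L \<longleftrightarrow> (\<forall>c\<in>C.
     (\<forall>z\<in>examples X. L c z \<ge> 0) \<and> (\<Sum>z\<in>examples X. L c z) = 1 \<and>
     (\<forall>z\<in>examples X. \<not> sat c z \<longrightarrow> L c z = 0))"

definition Nplus :: "'a set \<Rightarrow> 'a set set \<Rightarrow> ('a set \<Rightarrow> 'a \<times> bool \<Rightarrow> real) \<Rightarrow> nat" where
  "Nplus X C L = Min ((\<lambda>c. card {z \<in> examples X. L c z > 0}) ` C)"

definition MLE_teacher ::
  "'a set \<Rightarrow> 'a set set \<Rightarrow> ('a set \<Rightarrow> 'a \<times> bool \<Rightarrow> real) \<Rightarrow> ('a set \<Rightarrow> ('a \<times> bool) set) \<Rightarrow> bool" where
  "MLE_teacher X C L T \<longleftrightarrow> (\<forall>c0\<in>C.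
     T c0 \<subseteq> examples X \<and> card (T c0) \<le> Nplus X C L \<and>
     (\<forall>c\<in>C. c \<noteq> c0 \<longrightarrow> draw_prob (L c) (T c0) < draw_prob (L c0) (T c0)))"

definition MLE_TD :: "'a set \<Rightarrow> 'a set set \<Rightarrow> nat" where
  "MLE_TD X C =
     (LEAST d. \<exists>L T. MLE_learner X C L \<and> MLE_teacher X C L T \<and> map_order C T = d)"


section \<open>Machine model: first-order Lisp with unit-cost steps\<close>

text \<open>
  Data are binary trees. A program is a list of function bodies, which may call one another
  recursively. Variables are de Bruijn indices into the current environment:
  \<open>Case e e0 e1\<close> tests whether the value of \<open>e\<close> is \<open>Atom\<close> (and continues with \<open>e0\<close>) or a
  pair (and continues with \<open>e1\<close> in the environment extended by the two components),
  \<open>Let e1 e2\<close> extends the environment for \<open>e2\<close> by the value of \<open>e1\<close>, and \<open>Call i es\<close>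
  evaluates the body of function \<open>i\<close> in the environment consisting of the arguments.

  Every evaluation step costs one unit. Since values can be shared and there is no
  primitive that inspects more than one cell, each step is a bounded number of pointer operations
  (with a bound depending only on the program), so that up to a polynomial this is the running
  time of a Turing machine.
\<close>

datatype val = Atom | Pair val val

datatype exp =
    Var nat
  | Nil_exp
  | Cons_exp exp exp
  | Case exp exp exp
  | Let exp exp
  | Call nat "exp list"

inductive eval :: "exp list \<Rightarrow> val list \<Rightarrow> exp \<Rightarrow> val \<Rightarrow> nat \<Rightarrow> bool"
  and evals :: "exp list \<Rightarrow> val list \<Rightarrow> exp list \<Rightarrow> val list \<Rightarrow> nat \<Rightarrow> bool"
  for prog :: "exp list" where
  Var: "i < length env \<Longrightarrow> eval prog env (Var i) (env ! i) 1"
| Nil_exp: "eval prog env Nil_exp Atom 1"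
| Cons_exp: "eval prog env e1 v1 t1 \<Longrightarrow> eval prog env e2 v2 t2 \<Longrightarrow>
    eval prog env (Cons_exp e1 e2) (Pair v1 v2) (1 + t1 + t2)"
| Case_Atom: "eval prog env e Atom t \<Longrightarrow> eval prog env e0 v t0 \<Longrightarrow>
    eval prog env (Case e e0 e1) v (1 + t + t0)"
| Case_Pair: "eval prog env e (Pair v1 v2) t \<Longrightarrow> eval prog (v1 # v2 # env) e1 v t1 \<Longrightarrow>
    eval prog env (Case e e0 e1) v (1 + t + t1)"
| Let: "eval prog env e1 v1 t1 \<Longrightarrow> eval prog (v1 # env) e2 v t2 \<Longrightarrow>
    eval prog env (Let e1 e2) v (1 + t1 + t2)"
| Call: "i < length prog \<Longrightarrow> evals prog env es vs t1 \<Longrightarrow> eval prog vs (prog ! i) v t2 \<Longrightarrow>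
    eval prog env (Call i es) v (1 + t1 + t2)"
| Nil: "evals prog env [] [] 0"
| Cons: "eval prog env e v t1 \<Longrightarrow> evals prog env es vs t2 \<Longrightarrow>
    evals prog env (e # es) (v # vs) (1 + t1 + t2)"

lemma eval_deterministic:
  "eval prog env e v t \<Longrightarrow> eval prog env e v' t' \<Longrightarrow> v' = v \<and> t' = t"
  "evals prog env es vs t \<Longrightarrow> evals prog env es vs' t' \<Longrightarrow> vs' = vs \<and> t' = t"
proof (induction arbitrary: v' t' and vs' t' rule: eval_evals.inducts)
  case Var then show ?case by (auto elim: eval.cases)
next
  case Nil_exp then show ?case by (auto elim: eval.cases)
next
  case Cons_exp show ?case using Cons_exp.prems by cases (use Cons_exp.IH in blast)
next
  case Case_Atom show ?case using Case_Atom.prems by cases (use Case_Atom.IH in blast)+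
next
  case Case_Pair show ?case using Case_Pair.prems by cases (use Case_Pair.IH in blast)+
next
  case Let show ?case using Let.prems by cases (use Let.IH in blast)
next
  case Call show ?case using Call.prems by cases (use Call.IH in blast)
next
  case Nil then show ?case by (auto elim: evals.cases)
next
  case Cons show ?case using Cons.prems by cases (use Cons.IH in blast)
qed

text \<open>Function \<open>0\<close> is the entry point. The size of the result (its number of pairs, as an
  unshared tree) is added to the number of evaluation steps, so the time includes
  writing out the result.\<close>

definition runs :: "exp list \<Rightarrow> val \<Rightarrow> val \<Rightarrow> nat \<Rightarrow> bool" where
  "runs prog inp v t \<longleftrightarrow> (\<exists>t'. eval prog [inp] (Call 0 [Var 0]) v t' \<and> t = t' + size v)"


section \<open>Encodings\<close>

fun enc_bool :: "bool \<Rightarrow> val" where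
  "enc_bool False = Atom"
| "enc_bool True = Pair Atom Atom"

fun enc_list :: "val list \<Rightarrow> val" where
  "enc_list [] = Atom"
| "enc_list (v # vs) = Pair v (enc_list vs)"

text \<open>Natural numbers are written in binary, least significant bit first.\<close>

fun bits :: "nat \<Rightarrow> bool list" where
  "bits n = (if n = 0 then [] else odd n # bits (n div 2))"

declare bits.simps [simp del]

definition enc_nat :: "nat \<Rightarrow> val" where
  "enc_nat n = enc_list (map enc_bool (bits n))"

text \<open>The input is the incidence matrix of \<open>C\<close>, with respect to an arbitrary listing \<open>xs\<close>
  of \<open>X\<close> and an arbitrary listing \<open>cs\<close> of \<open>C\<close>. In the output, a point \<open>x\<close> and a concept \<open>c\<close>
  are named by their positions in these listings.\<close>

definition enc_input :: "'a list \<Rightarrow> 'a set list \<Rightarrow> val" where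
  "enc_input xs cs = enc_list (map (\<lambda>c. enc_list (map (\<lambda>x. enc_bool (x \<in> c)) xs)) cs)"

definition position :: "'b list \<Rightarrow> 'b \<Rightarrow> nat" where
  "position ys y = length (takeWhile (\<lambda>y'. y' \<noteq> y) ys)"

definition enc_concept :: "'a set list \<Rightarrow> 'a set \<Rightarrow> val" where
  "enc_concept cs c = enc_nat (position cs c)"

fun enc_example :: "'a list \<Rightarrow> 'a \<times> bool \<Rightarrow> val" where
  "enc_example xs (x, b) = Pair (enc_nat (position xs x)) (enc_bool b)"

text \<open>A finite set is represented by any repetition-free list of its elements, a
  non-negative rational by any numerator/denominator pair, and a map on a listed
  domain by the list of its values.\<close>

definition repr_set :: "('b \<Rightarrow> val) \<Rightarrow> 'b set \<Rightarrow> val \<Rightarrow> bool" where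
  "repr_set enc A v \<longleftrightarrow> (\<exists>l. distinct l \<and> set l = A \<and> v = enc_list (map enc l))"

definition repr_rat :: "real \<Rightarrow> val \<Rightarrow> bool" where
  "repr_rat r v \<longleftrightarrow>
     (\<exists>a b. b > 0 \<and> r = real a / real b \<and> v = Pair (enc_nat a) (enc_nat b))"

definition repr_map :: "'b list \<Rightarrow> ('r \<Rightarrow> val \<Rightarrow> bool) \<Rightarrow> ('b \<Rightarrow> 'r) \<Rightarrow> val \<Rightarrow> bool" where
  "repr_map ds R f v \<longleftrightarrow> (\<exists>vs. v = enc_list vs \<and> list_all2 (\<lambda>d. R (f d)) ds vs)"

text \<open>The two vertex sets and the edge set of \<open>G(C)\<close>.\<close>

definition repr_graph_G ::
  "'a set \<Rightarrow> 'a set set \<Rightarrow> 'a list \<Rightarrow> 'a set list \<Rightarrow> val \<Rightarrow> bool" where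
  "repr_graph_G X C xs cs v \<longleftrightarrow> (\<exists>v1 v2 v3. v = enc_list [v1, v2, v3] \<and>
     repr_set (enc_concept cs) C v1 \<and>
     repr_set (enc_example xs) (examples X) v2 \<and>
     repr_set (\<lambda>(c, z). Pair (enc_concept cs c) (enc_example xs z)) (graph_G X C) v3)"

definition repr_set_map ::
  "'a list \<Rightarrow> 'a set list \<Rightarrow> ('a set \<Rightarrow> ('a \<times> bool) set) \<Rightarrow> val \<Rightarrow> bool" where
  "repr_set_map xs cs = repr_map cs (repr_set (enc_example xs))"

definition repr_learner ::
  "'a list \<Rightarrow> 'a set list \<Rightarrow> ('a set \<Rightarrow> 'a \<times> bool \<Rightarrow> real) \<Rightarrow> val \<Rightarrow> bool" where
  "repr_learner xs cs = repr_map cs (repr_map (List.product xs [False, True]) repr_rat)"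


section \<open>Polynomial-time computability\<close>

definition concept_class :: "'a set \<Rightarrow> 'a set set \<Rightarrow> bool" where
  "concept_class X C \<longleftrightarrow> finite X \<and> X \<noteq> {} \<and> C \<subseteq> Pow X \<and> card C \<ge> 2"

text \<open>\<open>out X C xs cs v\<close> says that \<open>v\<close> is a correct output. A polynomial in \<open>|C| + |X|\<close> is
  as good as one in \<open>|C|\<close> and \<open>|X|\<close>. HOL cannot quantify over types, so
  the program may depend on \<open>'a\<close>; the instance where \<open>'a\<close> is \<open>nat\<close> already covers all finite
  sets \<open>X\<close> (up to renaming of points) with a single program.\<close>

definition computable_in_polytime ::
  "('a set \<Rightarrow> 'a set set \<Rightarrow> 'a list \<Rightarrow> 'a set list \<Rightarrow> val \<Rightarrow> bool) \<Rightarrow> bool" where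
  "computable_in_polytime out \<longleftrightarrow> (\<exists>prog (p :: nat poly). \<forall>X C xs cs.
     concept_class X C \<and> distinct xs \<and> set xs = X \<and> distinct cs \<and> set cs = C \<longrightarrow>
     (\<exists>v t. runs prog (enc_input xs cs) v t \<and> t \<le> poly p (card C + card X) \<and> out X C xs cs v))"

end

theory Submission
  imports Defs
begin

text \<open>
  Every saturating matching \<open>M\<close> is a teacher, of the same order, for a learner under which \<open>c\<close>
  samples all examples consistent with \<open>c\<close>, those of \<open>M c\<close> with a huge weight: \<open>M c\<close> is then drawn
  with probability almost \<open>1\<close>, whereas under a different concept \<open>c'\<close> some other set of the same
  size, comparable with \<open>M c'\<close>, takes a share of at least \<open>|X|\<close> to the power \<open>-|X|\<close>. Conversely,
  a teacher is injective and only uses consistent examples, so that the two parameters agree.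

  The neighbourhoods in \<open>G\<^sup>+(C)\<close> are exponentially large, but a vertex with \<open>|C|\<close> neighbours can
  never occur in a violation of Hall's condition. It therefore suffices to list \<open>|C|\<close> neighbours
  of size at most \<open>d\<close> per concept, and to search for augmenting paths in the resulting graph. If the
  search fails, then there is no saturating matching of order \<open>d\<close>, and \<open>d\<close> is increased.
\<close>

section \<open>Deterministic evaluation with costs\<close>

text \<open>The two halves of the teaching argument meet at the threshold
  \<open>(1 / n) ^ k\<close>, where \<open>n = card X\<close> and \<open>k = card (M c0)\<close>.
  Under \<open>c0\<close> the set \<open>M c0\<close> is missed with probability at most
  \<open>k * (n - k) / h\<close> if \<open>h\<close> is the large weight, so
  \<open>h > k * (n - k) * n ^ k\<close> is what is required; \<open>2 ^ (n * (n + 2))\<close>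
  achieves this and still has polynomially many binary digits. Under a rival \<open>c\<close>, a set
  \<open>B\<close> of size \<open>k\<close> that is contained in \<open>M c\<close> or contains it
  consists of most likely examples, so a greedy order of drawing gives it probability at least
  \<open>(1 / n) ^ k\<close>. As long as \<open>B\<close> can be chosen different from
  \<open>M c0\<close>, the latter is left with at most \<open>1 - (1 / n) ^ k\<close>; here the
  injectivity of \<open>M\<close> is used.

  In the algorithm, Hall's condition holds for the truncated lists at every \<open>d\<close> that is
  at least the optimum. A failed search thus certifies that \<open>d\<close> is too small,
  \<open>d\<close> never passes the optimum, and the matching obtained is optimal without any
  comparison of orders. Increasing \<open>d\<close> invalidates no edge chosen before, so the
  matching is kept and each concept is inserted once.\<close>

definition halts :: "exp list \<Rightarrow> val list \<Rightarrow> exp \<Rightarrow> bool" where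
  "halts P env e \<longleftrightarrow> (\<exists>v t. eval P env e v t)"

text \<open>\<open>eval\<close> is deterministic, so value and cost are functions of program,
  environment and expression. With them the evaluation rules become rewrite rules, and running a
  function body on a symbolic environment is simplification.\<close>

definition res :: "exp list \<Rightarrow> val list \<Rightarrow> exp \<Rightarrow> val" where
  "res P env e = (THE v. \<exists>t. eval P env e v t)"

definition cost :: "exp list \<Rightarrow> val list \<Rightarrow> exp \<Rightarrow> nat" where
  "cost P env e = (THE t. \<exists>v. eval P env e v t)"

lemma eval_res_cost: "halts P env e \<Longrightarrow> eval P env e (res P env e) (cost P env e)"
proof -
  assume "halts P env e"
  then obtain v t where vt: "eval P env e v t" by (auto simp: halts_def)
  have "res P env e = v"
    unfolding res_def using vt eval_deterministic(1) by blast
  moreover have "cost P env e = t"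
    unfolding cost_def using vt eval_deterministic(1) by blast
  ultimately show ?thesis using vt by simp
qed

lemma evalD: "eval P env e v t \<Longrightarrow> halts P env e \<and> res P env e = v \<and> cost P env e = t"
  by (metis eval_deterministic(1) eval_res_cost halts_def)

lemma eval_iff: "eval P env e v t \<longleftrightarrow> halts P env e \<and> v = res P env e \<and> t = cost P env e"
  using evalD eval_res_cost by metis

lemma evals_iff:
  "evals P env es vs t \<longleftrightarrow> (\<forall>e\<in>set es. halts P env e) \<and> vs = map (res P env) es \<and>
     t = length es + sum_list (map (cost P env) es)"
proof (induction es arbitrary: vs t)
  case Nil
  then show ?case by (auto intro: eval_evals.intros elim: evals.cases)
next
  case (Cons e es)
  have "evals P env (e # es) vs t \<longleftrightarrow>
    (\<exists>v vs' t1 t2. vs = v # vs' \<and> t = 1 + t1 + t2 \<and> eval P env e v t1 \<and> evals P env es vs' t2)"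
    by (subst evals.simps) fastforce
  then show ?case unfolding Cons.IH eval_iff by auto
qed

lemma halts_Var [simp]: "halts P env (Var i) \<longleftrightarrow> i < length env"
  unfolding halts_def by (auto intro: eval_evals.intros elim: eval.cases)

lemma res_Var [simp]: "i < length env \<Longrightarrow> res P env (Var i) = env ! i"
  and cost_Var [simp]: "i < length env \<Longrightarrow> cost P env (Var i) = 1"
  using evalD[OF eval_evals.Var] by auto

lemma halts_Nil_exp [simp]: "halts P env Nil_exp"
  and res_Nil_exp [simp]: "res P env Nil_exp = Atom"
  and cost_Nil_exp [simp]: "cost P env Nil_exp = 1"
  using evalD[OF eval_evals.Nil_exp] by auto

lemma halts_Cons_exp [simp]: "halts P env (Cons_exp a b) \<longleftrightarrow> halts P env a \<and> halts P env b"
  unfolding halts_def by (blast intro: eval_evals.Cons_exp elim: eval.cases[where ?a2.0 =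
    "Cons_exp a b"])

lemma
  assumes "halts P env a" "halts P env b"
  shows res_Cons_exp [simp]: "res P env (Cons_exp a b) = Pair (res P env a) (res P env b)"
    and cost_Cons_exp [simp]: "cost P env (Cons_exp a b) = 1 + cost P env a + cost P env b"
  using evalD[OF eval_evals.Cons_exp] assms eval_res_cost by blast+

lemma halts_Let [simp]:
  "halts P env (Let a b) \<longleftrightarrow> halts P env a \<and> halts P (res P env a # env) b"
proof
  assume "halts P env (Let a b)"
  then obtain v t where "eval P env (Let a b) v t" by (auto simp: halts_def)
  then show "halts P env a \<and> halts P (res P env a # env) b"
    by cases (auto simp: eval_iff)
next
  assume "halts P env a \<and> halts P (res P env a # env) b"
  then show "halts P env (Let a b)"
    unfolding halts_def[of P env "Let a b"] by (blast intro: eval_evals.Let eval_res_cost)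
qed

lemma
  assumes "halts P env a" "halts P (res P env a # env) b"
  shows res_Let [simp]: "res P env (Let a b) = res P (res P env a # env) b"
    and cost_Let [simp]: "cost P env (Let a b) = 1 + cost P env a + cost P (res P env a # env) b"
  using evalD[OF eval_evals.Let] assms eval_res_cost by blast+

lemma eval_Case_iff:
  "eval P env (Case e a b) v t \<longleftrightarrow> halts P env e \<and>
     (case res P env e of
        Atom \<Rightarrow> halts P env a \<and> v = res P env a \<and> t = 1 + cost P env e + cost P env a
      | Pair x y \<Rightarrow> halts P (x # y # env) b \<and> v = res P (x # y # env) b
          \<and> t = 1 + cost P env e + cost P (x # y # env) b)"
proof -
  have "eval P env (Case e a b) v t \<longleftrightarrow>
      (\<exists>t1 t2. t = 1 + t1 + t2 \<and> (eval P env e Atom t1 \<and> eval P env a v t2 \<or>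
        (\<exists>x y. eval P env e (Pair x y) t1 \<and> eval P (x # y # env) b v t2)))"
    by (subst eval.simps) fastforce
  then show ?thesis unfolding eval_iff by (cases "res P env e") auto
qed

lemma halts_Case [simp]:
  "halts P env (Case e a b) \<longleftrightarrow> halts P env e \<and>
     (case res P env e of Atom \<Rightarrow> halts P env a | Pair x y \<Rightarrow> halts P (x # y # env) b)"
  unfolding halts_def[of P env "Case e a b"] eval_Case_iff by (auto split: val.splits)

lemma
  assumes "halts P env (Case e a b)"
  shows res_Case: "res P env (Case e a b) =
      (case res P env e of Atom \<Rightarrow> res P env a | Pair x y \<Rightarrow> res P (x # y # env) b)"
    and cost_Case: "cost P env (Case e a b) = 1 + cost P env e +
      (case res P env e of Atom \<Rightarrow> cost P env a | Pair x y \<Rightarrow> cost P (x # y # env) b)"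
  using eval_res_cost[OF assms] unfolding eval_Case_iff by (auto split: val.splits)

lemma
  assumes "halts P env e"
  shows res_Case_Atom [simp]: "res P env e = Atom \<Longrightarrow> halts P env a \<Longrightarrow>
      res P env (Case e a b) = res P env a"
    and cost_Case_Atom [simp]: "res P env e = Atom \<Longrightarrow> halts P env a \<Longrightarrow>
      cost P env (Case e a b) = 1 + cost P env e + cost P env a"
    and res_Case_Pair [simp]: "res P env e = Pair x y \<Longrightarrow> halts P (x # y # env) b \<Longrightarrow>
      res P env (Case e a b) = res P (x # y # env) b"
    and cost_Case_Pair [simp]: "res P env e = Pair x y \<Longrightarrow> halts P (x # y # env) b \<Longrightarrow>
      cost P env (Case e a b) = 1 + cost P env e + cost P (x # y # env) b"
  using assms by (simp_all add: res_Case cost_Case)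

lemma eval_Call_iff:
  "eval P env (Call i es) v t \<longleftrightarrow> i < length P \<and> (\<forall>e\<in>set es. halts P env e) \<and>
     halts P (map (res P env) es) (P ! i) \<and> v = res P (map (res P env) es) (P ! i) \<and>
     t = 1 + (length es + sum_list (map (cost P env) es)) + cost P (map (res P env) es) (P ! i)"
    (is "?l \<longleftrightarrow> ?r")
proof
  assume ?l
  then show ?r by cases (auto simp: eval_iff evals_iff)
next
  assume ?r
  then show ?l using eval_evals.Call[of i P env es] unfolding evals_iff eval_iff by blast
qed

lemma halts_Call [simp]:
  "halts P env (Call i es) \<longleftrightarrow> i < length P \<and> (\<forall>e\<in>set es. halts P env e) \<and>
     halts P (map (res P env) es) (P ! i)"
  unfolding halts_def[of P env "Call i es"] eval_Call_iff by auto

lemma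
  assumes "i < length P" "\<forall>e\<in>set es. halts P env e" "halts P (map (res P env) es) (P ! i)"
  shows res_Call [simp]: "res P env (Call i es) = res P (map (res P env) es) (P ! i)"
    and cost_Call [simp]: "cost P env (Call i es) =
      1 + (length es + sum_list (map (cost P env) es)) + cost P (map (res P env) es) (P ! i)"
  using assms eval_res_cost[of P env "Call i es"] unfolding eval_Call_iff by auto

text \<open>The value is exact but the time only an upper bound, so that in the inductions a
  recursive call contributes an inequality and the remaining steps are absorbed by generous
  constants.\<close>

definition computes :: "exp list \<Rightarrow> nat \<Rightarrow> val list \<Rightarrow> val \<Rightarrow> nat \<Rightarrow> bool" where
  "computes P i vs v t \<longleftrightarrow> halts P vs (P ! i) \<and> res P vs (P ! i) = v \<and> cost P vs (P ! i) \<le> t"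

lemma computesD:
  assumes "computes P i vs v t"
  shows "halts P vs (P ! i)" "res P vs (P ! i) = v" "cost P vs (P ! i) \<le> t"
  using assms by (auto simp: computes_def)

lemma computes_mono: "computes P i vs v t \<Longrightarrow> t \<le> t' \<Longrightarrow> computes P i vs v t'"
  by (auto simp: computes_def)

section \<open>The program\<close>

text \<open>The indices of the arguments of a function are shifted by each enclosing \<open>Case\<close> and \<open>Let\<close>.
  What a function computes is stated by the lemma whose name ends in \<open>_ok\<close>; the constants in the
  time bounds are generous.\<close>

abbreviation (input) "true_exp \<equiv> Cons_exp Nil_exp Nil_exp"

abbreviation (input) "eq_ix \<equiv> 1"
abbreviation (input) "mem_ix \<equiv> 2"
abbreviation (input) "steal_ix \<equiv> 3"
abbreviation (input) "take_ix \<equiv> 4"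
abbreviation (input) "less_ix \<equiv> 5"
abbreviation (input) "nones_ix \<equiv> 6"
abbreviation (input) "somes_ix \<equiv> 7"
abbreviation (input) "subs_ix \<equiv> 8"
abbreviation (input) "scan_ix \<equiv> 9"
abbreviation (input) "search_ix \<equiv> 10"
abbreviation (input) "grow_ix \<equiv> 11"
abbreviation (input) "solve_ix \<equiv> 12"
abbreviation (input) "lookup_ix \<equiv> 13"
abbreviation (input) "inc_ix \<equiv> 14"
abbreviation (input) "tobin_ix \<equiv> 15"
abbreviation (input) "exs_ix \<equiv> 16"
abbreviation (input) "outm_ix \<equiv> 17"
abbreviation (input) "nums_ix \<equiv> 18"
abbreviation (input) "allex_ix \<equiv> 19"
abbreviation (input) "edges1_ix \<equiv> 20"
abbreviation (input) "edges_ix \<equiv> 21"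
abbreviation (input) "cnts_ix \<equiv> 22"
abbreviation (input) "cntn_ix \<equiv> 23"
abbreviation (input) "shift_ix \<equiv> 24"
abbreviation (input) "times_ix \<equiv> 25"
abbreviation (input) "lrow_ix \<equiv> 26"
abbreviation (input) "likelihoods_ix \<equiv> 27"
abbreviation (input) "learner_ix \<equiv> 28"
abbreviation (input) "run_ix \<equiv> 29"

definition eq_exp :: exp where
  "eq_exp = Case (Var 0) (Case (Var 1) true_exp Nil_exp) (Case (Var 3) Nil_exp (Case (Call eq_ix
     [Var 2, Var 0]) Nil_exp (Call eq_ix [Var 5, Var 3])))"

definition mem_exp :: exp where
  "mem_exp = Case (Var 1) Nil_exp (Case (Call eq_ix [Var 2, Var 0]) (Call mem_ix [Var 2, Var 1])
     true_exp)"

definition steal_exp :: exp where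
  "steal_exp = Case (Var 1) Nil_exp (Case (Var 0) Nil_exp (Case (Call eq_ix [Var 4, Var 1])
     (Case (Call steal_ix [Var 4, Var 3]) Nil_exp (Cons_exp (Var 0) (Cons_exp (Var 4) (Var 1))))
     (Cons_exp (Var 2) (Var 5))))"

definition take_exp :: exp where
  "take_exp = Case (Var 0) Nil_exp (Case (Var 3) Nil_exp (Cons_exp (Var 0) (Call take_ix [Var 3,
     Var 1])))"

definition less_exp :: exp where
  "less_exp = Case (Var 1) Nil_exp (Case (Var 2) true_exp (Case (Var 0) (Call less_ix [Var 1,
     Var 5]) (Call less_ix [Var 3, Var 5])))"

definition nones_exp :: exp where
  "nones_exp = Case (Var 0) (Var 1) (Cons_exp (Cons_exp Nil_exp (Var 0)) (Call nones_ix [Var 1,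
     Var 3]))"

definition somes_exp :: exp where
  "somes_exp = Case (Var 0) Nil_exp (Case (Call less_ix [Var 0, Var 4]) (Call somes_ix [Var 1,
     Var 3, Var 4]) (Cons_exp (Cons_exp (Cons_exp (Var 5) Nil_exp) (Var 2)) (Call somes_ix [Var
     3, Var 5, Var 6])))"

definition subs_exp :: exp where
  "subs_exp = Case (Var 0) true_exp (Let (Call subs_ix [Var 1, Var 3, Var 4]) (Call take_ix [Var
     5, Call nones_ix [Var 0, Call somes_ix [Var 0, Var 1, Var 4]]]))"

definition scan_exp :: exp where
  "scan_exp = Case (Var 0) (Cons_exp Nil_exp (Cons_exp (Var 3) (Var 4))) (Case (Call steal_ix
     [Var 0, Var 4]) (Cons_exp true_exp (Cons_exp (Cons_exp (Var 3) (Var 0)) (Var 4))) (Case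
     (Call mem_ix [Var 0, Var 8]) (Call scan_ix [Var 3, Var 5, Var 6, Cons_exp (Cons_exp (Var 0)
     (Cons_exp (Cons_exp (Var 5) (Var 2)) (Var 1))) (Var 7), Cons_exp (Var 0) (Var 8)]) (Call
     scan_ix [Var 5, Var 7, Var 8, Var 9, Var 10])))"

definition search_exp :: exp where
  "search_exp = Case (Var 3) Nil_exp (Case (Var 2) Nil_exp (Case (Var 2) Nil_exp (Case (Call
     subs_ix [Var 0, Var 7, Var 8]) Nil_exp (Case (Call scan_ix [Var 1, Var 2, Var 3, Var 7, Var
     12]) Nil_exp (Case (Var 0) (Case (Var 1) Nil_exp (Call search_ix [Var 9, Var 13, Var 14,
     Var 0, Var 1])) (Cons_exp (Var 3) Nil_exp))))))"

definition grow_exp :: exp where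
  "grow_exp = Case (Call search_ix [Var 2, Var 1, Var 2, Cons_exp (Cons_exp (Var 3) (Var 4))
     Nil_exp, Cons_exp (Var 3) Nil_exp]) (Case (Var 0) (Cons_exp (Var 1) (Var 4)) (Call grow_ix
     [Var 1, Cons_exp Nil_exp (Var 3), Var 4, Var 5, Var 6])) (Cons_exp (Var 3) (Var 0))"

text \<open>The row \<open>Var 0\<close> is passed to \<open>grow_ix\<close> twice, as the concept
  to be matched and as the fuel: it has one cell per point, and the order need not be increased more
  than \<open>card X\<close> times.\<close>

definition solve_exp :: exp where
  "solve_exp = Case (Var 0) (Cons_exp (Var 1) (Var 3)) (Case (Call grow_ix [Var 0, Var 3, Var 4,
     Var 0, Var 5]) Nil_exp (Call solve_ix [Var 3, Var 0, Var 6, Var 1]))"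

definition lookup_exp :: exp where
  "lookup_exp = Case (Var 1) Nil_exp (Case (Var 0) Nil_exp (Case (Call eq_ix [Var 4, Var 0])
     (Call lookup_ix [Var 4, Var 3]) (Var 3)))"

definition inc_exp :: exp where
  "inc_exp = Case (Var 0) (Cons_exp true_exp Nil_exp) (Case (Var 0) (Cons_exp true_exp (Var 1))
     (Cons_exp Nil_exp (Call inc_ix [Var 3])))"

definition tobin_exp :: exp where
  "tobin_exp = Case (Var 0) Nil_exp (Call inc_ix [Call tobin_ix [Var 1]])"

definition exs_exp :: exp where
  "exs_exp = Case (Var 1) Nil_exp (Case (Var 0) (Call exs_ix [Call inc_ix [Var 2], Var 1])
     (Cons_exp (Cons_exp (Var 4) (Var 0)) (Call exs_ix [Call inc_ix [Var 4], Var 3])))"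

definition outm_exp :: exp where
  "outm_exp = Case (Var 0) Nil_exp (Cons_exp (Call exs_ix [Nil_exp, Call lookup_ix [Var 0, Var
     3]]) (Call outm_ix [Var 1, Var 3]))"

definition nums_exp :: exp where
  "nums_exp = Case (Var 1) Nil_exp (Cons_exp (Var 2) (Call nums_ix [Call inc_ix [Var 2], Var
     1]))"

definition allex_exp :: exp where
  "allex_exp = Case (Var 1) Nil_exp (Cons_exp (Cons_exp (Var 2) Nil_exp) (Cons_exp (Cons_exp
     (Var 2) true_exp) (Call allex_ix [Call inc_ix [Var 2], Var 1])))"

definition edges1_exp :: exp where
  "edges1_exp = Case (Var 2) (Var 3) (Cons_exp (Cons_exp (Var 2) (Cons_exp (Var 3) (Var 0)))
     (Call edges1_ix [Var 2, Call inc_ix [Var 3], Var 1, Var 5]))"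

definition edges_exp :: exp where
  "edges_exp = Case (Var 1) Nil_exp (Call edges1_ix [Var 2, Nil_exp, Var 0, Call edges_ix [Call
     inc_ix [Var 2], Var 1]])"

definition cnts_exp :: exp where
  "cnts_exp = Case (Var 0) Nil_exp (Case (Var 0) (Call cnts_ix [Var 1]) (Call inc_ix [Call
     cnts_ix [Var 3]]))"

definition cntn_exp :: exp where
  "cntn_exp = Case (Var 0) Nil_exp (Case (Var 0) (Call inc_ix [Call cntn_ix [Var 1]]) (Call
     cntn_ix [Var 3]))"

definition shift_exp :: exp where
  "shift_exp = Case (Var 0) (Var 2) (Case (Var 3) (Cons_exp Nil_exp (Call shift_ix [Var 1,
     Nil_exp, Var 4])) (Cons_exp (Var 0) (Call shift_ix [Var 3, Var 1, Var 6])))"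

definition times_exp :: exp where
  "times_exp = Case (Var 0) Nil_exp (Call nones_ix [Var 3, Call times_ix [Var 1, Var 3]])"

definition lrow_exp :: exp where
  "lrow_exp = Case (Var 0) Nil_exp (Case (Var 3) Nil_exp (Let (Case (Var 0) (Var 7) (Var 8))
     (Let (Cons_exp Nil_exp (Cons_exp true_exp Nil_exp)) (Let (Call lrow_ix [Var 5, Var 3, Var
     8, Var 9]) (Case (Var 5) (Cons_exp (Var 2) (Cons_exp (Var 1) (Var 0))) (Cons_exp (Var 3)
     (Cons_exp (Var 4) (Var 2))))))))"

definition likelihoods_exp :: exp where
  "likelihoods_exp = Let (Call shift_ix [Var 2, Call cntn_ix [Var 1], Call cnts_ix [Var 1]])
     (Call lrow_ix [Var 1, Var 2, Cons_exp (Call shift_ix [Var 3, Nil_exp, Cons_exp true_exp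
     Nil_exp]) (Var 0), Cons_exp (Cons_exp true_exp Nil_exp) (Var 0)])"

definition learner_exp :: exp where
  "learner_exp = Case (Var 0) Nil_exp (Cons_exp (Call likelihoods_ix [Var 0, Call lookup_ix [Var
     0, Var 3], Call times_ix [Var 0, Cons_exp Nil_exp (Cons_exp Nil_exp (Var 0))]]) (Call
     learner_ix [Var 1, Var 3]))"

text \<open>Numbers that only act as bounds are unary, so that a list can stand for its length. The
  order starts at \<open>true_exp\<close>, which is the unary 1, and the input with one extra cell
  is the budget \<open>card C + 1\<close>.\<close>

definition run_exp :: exp where
  "run_exp = Call solve_ix [Var 0, true_exp, Cons_exp Nil_exp (Var 0), Nil_exp]"

definition graph_main :: exp where
  "graph_main = Case (Var 0) Nil_exp (Cons_exp (Call nums_ix [Nil_exp, Var 2]) (Cons_exp (Call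
     allex_ix [Nil_exp, Var 0]) (Cons_exp (Call edges_ix [Nil_exp, Var 2]) Nil_exp)))"

definition smn_main :: exp where
  "smn_main = Case (Call run_ix [Var 0]) Nil_exp (Call tobin_ix [Var 0])"

definition match_main :: exp where
  "match_main = Case (Call run_ix [Var 0]) Nil_exp (Call outm_ix [Var 2, Var 1])"

definition learn_main :: exp where
  "learn_main = Case (Call run_ix [Var 0]) Nil_exp (Cons_exp (Call learner_ix [Var 2, Var 1])
     (Call outm_ix [Var 2, Var 1]))"

definition library :: "exp list" where
  "library = [eq_exp, mem_exp, steal_exp, take_exp, less_exp, nones_exp, somes_exp, subs_exp,
     scan_exp, search_exp, grow_exp, solve_exp, lookup_exp, inc_exp, tobin_exp, exs_exp,
     outm_exp, nums_exp, allex_exp, edges1_exp, edges_exp, cnts_exp, cntn_exp, shift_exp,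
     times_exp, lrow_exp, likelihoods_exp, learner_exp, run_exp]"

definition prog :: "exp \<Rightarrow> exp list" where
  "prog e = e # library"

lemma length_prog [simp]: "length (prog e) = 30"
  by (simp add: prog_def library_def)

lemma prog_nth:
  "prog e ! 0 = e"
  "prog e ! eq_ix = eq_exp"
  "prog e ! mem_ix = mem_exp"
  "prog e ! steal_ix = steal_exp"
  "prog e ! take_ix = take_exp"
  "prog e ! less_ix = less_exp"
  "prog e ! nones_ix = nones_exp"
  "prog e ! somes_ix = somes_exp"
  "prog e ! subs_ix = subs_exp"
  "prog e ! scan_ix = scan_exp"
  "prog e ! search_ix = search_exp"
  "prog e ! grow_ix = grow_exp"
  "prog e ! solve_ix = solve_exp"
  "prog e ! lookup_ix = lookup_exp"
  "prog e ! inc_ix = inc_exp"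
  "prog e ! tobin_ix = tobin_exp"
  "prog e ! exs_ix = exs_exp"
  "prog e ! outm_ix = outm_exp"
  "prog e ! nums_ix = nums_exp"
  "prog e ! allex_ix = allex_exp"
  "prog e ! edges1_ix = edges1_exp"
  "prog e ! edges_ix = edges_exp"
  "prog e ! cnts_ix = cnts_exp"
  "prog e ! cntn_ix = cntn_exp"
  "prog e ! shift_ix = shift_exp"
  "prog e ! times_ix = times_exp"
  "prog e ! lrow_ix = lrow_exp"
  "prog e ! likelihoods_ix = likelihoods_exp"
  "prog e ! learner_ix = learner_exp"
  "prog e ! run_ix = run_exp"
  by (simp_all add: prog_def library_def)

section \<open>Elementary list operations and the enumeration of small sets\<close>

lemma computesI:
  assumes "P ! i = e" "halts P vs e" "res P vs e = v" "cost P vs e \<le> t"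
  shows "computes P i vs v t"
  using assms by (simp add: computes_def)

text \<open>Every value is the encoding of exactly one list, since \<open>Atom\<close> and
  \<open>Pair\<close> play the roles of the empty list and of the list constructor. Hence rows and
  sets can be read back from values without any well-formedness condition.\<close>

fun dec_list :: "val \<Rightarrow> val list" where
  "dec_list Atom = []"
| "dec_list (Pair v w) = v # dec_list w"

lemma dec_enc_list [simp]: "dec_list (enc_list vs) = vs"
  by (induction vs) auto

lemma enc_dec_list [simp]: "enc_list (dec_list v) = v"
  by (induction v) auto

lemma size_enc_list: "size (enc_list vs) = length vs + sum_list (map size vs)"
  by (induction vs) auto

lemma length_dec_list: "length (dec_list v) \<le> size v"
  by (induction v) auto

text \<open>The recursion descends into both values in parallel and stops where the shapes differ,
  so the first argument alone pays. Searching a list for a key therefore requires no bound on the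
  sizes of the stored entries.\<close>

lemma eq_ok: "computes (prog E) eq_ix [v, w] (enc_bool (v = w)) (30 * size v + 10)"
proof (induction v arbitrary: w)
  case Atom
  show ?case
    by (cases w; rule computesI[OF prog_nth(2)]) (auto simp: eq_exp_def)
next
  case (Pair a b)
  show ?case
  proof (cases w)
    case Atom
    then show ?thesis by - (rule computesI[OF prog_nth(2)]; simp add: eq_exp_def)
  next
    case (Pair c d)
    show ?thesis
      using Pair computesD[OF Pair.IH(1)[of c]] computesD[OF Pair.IH(2)[of d]]
      by - (rule computesI[OF prog_nth(2)]; cases "a = c"; simp add: eq_exp_def)
  qed
qed

lemma mem_ok:
  "computes (prog E) mem_ix [x, enc_list l] (enc_bool (x \<in> set l)) ((length l + 1) * (30 * size x
    + 40))"
proof (induction l)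
  case Nil
  show ?case by (rule computesI[OF prog_nth(3)]) (auto simp: mem_exp_def)
next
  case (Cons y l)
  show ?case
    using computesD[OF Cons.IH] computesD[OF eq_ok[of E x y]]
    by - (rule computesI[OF prog_nth(3)]; cases "x = y"; simp add: mem_exp_def algebra_simps)
qed

definition enc_pairs :: "(val \<times> val) list \<Rightarrow> val" where
  "enc_pairs M = enc_list (map (\<lambda>(c, A). Pair c A) M)"

lemma enc_pairs_simps [simp]:
  "enc_pairs [] = Atom"
  "enc_pairs ((c, A) # M) = Pair (Pair c A) (enc_pairs M)"
  by (auto simp: enc_pairs_def)

fun steal :: "'s \<Rightarrow> ('c \<times> 's) list \<Rightarrow> ('c \<times> ('c \<times> 's) list) option" where
  "steal A [] = None"
| "steal A ((c, B) # M) = (if A = B then Some (c, M)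
     else (case steal A M of None \<Rightarrow> None | Some (x, M') \<Rightarrow> Some (x, (c, B) # M')))"

definition enc_steal :: "(val \<times> (val \<times> val) list) option \<Rightarrow> val" where
  "enc_steal r = (case r of None \<Rightarrow> Atom | Some (x, M) \<Rightarrow> Pair x (enc_pairs M))"

lemma steal_ok:
  "computes (prog E) steal_ix [A, enc_pairs M] (enc_steal (steal A M)) ((length M + 1) * (30 *
    size A + 50))"
proof (induction M)
  case Nil
  show ?case by (rule computesI[OF prog_nth(4)]) (auto simp: steal_exp_def enc_steal_def)
next
  case (Cons p M)
  obtain c B where p: "p = (c, B)" by fastforce
  show ?case
    using computesD[OF Cons.IH] computesD[OF eq_ok[of E A B]] p
    by - (rule computesI[OF prog_nth(4)]; cases "A = B"; cases "steal A M";
        simp add: steal_exp_def enc_steal_def algebra_simps split: prod.splits)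
qed

lemma take_ok:
  "computes (prog E) take_ix [enc_list ks, enc_list l] (enc_list (take (length ks) l)) (30 *
    (length ks + 1))"
proof (induction ks arbitrary: l)
  case Nil
  show ?case by (rule computesI[OF prog_nth(5)]) (auto simp: take_exp_def)
next
  case (Cons y ks)
  show ?case
    using computesD[OF Cons.IH[of "tl l"]]
    by - (rule computesI[OF prog_nth(5)]; cases l; simp add: take_exp_def)
qed

abbreviation nonatoms :: "val list \<Rightarrow> nat" where
  "nonatoms A \<equiv> length (filter (\<lambda>v. v \<noteq> Atom) A)"

lemma less_ok:
  "computes (prog E) less_ix [enc_list A, enc_list d] (enc_bool (nonatoms A < length d)) (30 *
    (length A + 1))"
proof (induction A arbitrary: d)
  case Nil
  show ?case by (cases d; rule computesI[OF prog_nth(6)]) (auto simp: less_exp_def)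
next
  case (Cons v A)
  show ?case
    using computesD[OF Cons.IH[of "tl d"]] computesD[OF Cons.IH[of d]]
    by - (rule computesI[OF prog_nth(6)]; cases d; cases v; simp add: less_exp_def)
qed

lemma nones_ok:
  "computes (prog E) nones_ix [enc_list S, enc_list T] (enc_list (map (Pair Atom) S @ T)) (30 *
    (length S + 1))"
proof (induction S)
  case Nil
  show ?case by (rule computesI[OF prog_nth(7)]) (auto simp: nones_exp_def)
next
  case (Cons A S)
  show ?case
    using computesD[OF Cons.IH]
    by - (rule computesI[OF prog_nth(7)]; simp add: nones_exp_def)
qed

lemma somes_ok:
  assumes "\<And>A. A \<in> set S \<Longrightarrow> length A \<le> L"
  shows "computes (prog E) somes_ix [enc_list (map enc_list S), b, enc_list d]
     (enc_list (map enc_list (map ((#) (Pair b Atom)) (filter (\<lambda>A. nonatoms A < length d) S))))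
     ((length S + 1) * (30 * L + 70))"
  using assms
proof (induction S)
  case Nil
  show ?case by (rule computesI[OF prog_nth(8)]) (auto simp: somes_exp_def)
next
  case (Cons A S)
  have IH: "computes (prog E) somes_ix [enc_list (map enc_list S), b, enc_list d]
     (enc_list (map enc_list (map ((#) (Pair b Atom)) (filter (\<lambda>A. nonatoms A < length d) S))))
     ((length S + 1) * (30 * L + 70))" and "length A \<le> L"
    using Cons by auto
  then show ?case
    using computesD[OF IH] computesD[OF less_ok[of E A d]]
    by - (rule computesI[OF prog_nth(8)]; cases "nonatoms A < length d";
        simp add: somes_exp_def algebra_simps)
qed

text \<open>A set of examples consistent with the row \<open>r\<close> is a list of the same length:
  \<open>Atom\<close> skips a point, \<open>Pair b Atom\<close> selects it with its label. Cutting
  to \<open>k\<close> entries at every level keeps the intermediate lists polynomial. For positive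
  \<open>k\<close> the empty selection comes first.\<close>

fun sub :: "val list \<Rightarrow> nat \<Rightarrow> nat \<Rightarrow> val list list" where
  "sub [] d k = [[]]"
| "sub (b # r) d k = take k (map ((#) Atom) (sub r d k) @
     map ((#) (Pair b Atom)) (filter (\<lambda>A. nonatoms A < d) (sub r d k)))"

lemma length_sub: "length (sub r d k) \<le> max 1 k"
  by (induction r) auto

lemma length_in_sub: "A \<in> set (sub r d k) \<Longrightarrow> length A = length r"
  by (induction r arbitrary: A) (auto dest!: in_set_takeD)

lemma subs_ok:
  assumes "length r \<le> L" "ks \<noteq> []"
  shows "computes (prog E) subs_ix [enc_list r, enc_list d, enc_list ks]
     (enc_list (map enc_list (sub r (length d) (length ks))))
     ((length r + 1) * ((length ks + 2) * (30 * L + 200)))"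
  using assms(1)
proof (induction r)
  case Nil
  show ?case by (rule computesI[OF prog_nth(9)]) (auto simp: subs_exp_def)
next
  case (Cons b r)
  let ?S = "sub r (length d) (length ks)"
  have IH: "computes (prog E) subs_ix [enc_list r, enc_list d, enc_list ks]
     (enc_list (map enc_list ?S)) ((length r + 1) * ((length ks + 2) * (30 * L + 200)))"
    using Cons by simp
  have L: "length A \<le> L" if "A \<in> set ?S" for A
    using that Cons.prems length_in_sub[of A r] by simp
  have S: "length ?S \<le> length ks"
    using length_sub[of r "length d" "length ks"] assms(2) by (cases ks) auto
  let ?F = "map ((#) (Pair b Atom)) (filter (\<lambda>A. nonatoms A < length d) ?S)"
  have eq: "map (Pair Atom) (map enc_list ?S) @ map enc_list ?F = map enc_list (map ((#) Atom) ?S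
    @ ?F)"
    by simp
  have "(length ?S + 1) * (30 * L + 70) \<le> (length ks + 1) * (30 * L + 70)"
    by (intro mult_le_mono1) (use S in simp)
  then show ?case
    using computesD[OF IH] computesD[OF somes_ok[of ?S L E b d, OF L]] S
      computesD[OF nones_ok[of E "map enc_list ?S" "map enc_list ?F"], unfolded eq]
      computesD[OF take_ok[of E ks "map enc_list (map ((#) Atom) ?S @ ?F)"], unfolded take_map]
    by - (rule computesI[OF prog_nth(9)]; simp add: subs_exp_def algebra_simps take_map)
qed

section \<open>Cost of the matching algorithm\<close>

text \<open>Selecting a point puts one more pair around its label, which is no more than the pair
  that the list cell itself costs; hence the factor 2.\<close>

lemma size_snd_sub: "A \<in> set (sub r d k) \<Longrightarrow> size (enc_list A) \<le> 2 * size (enc_list r)"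
proof (induction r arbitrary: A)
  case Nil
  then show ?case by simp
next
  case (Cons b r)
  then obtain B where "B \<in> set (sub r d k)" "A = Atom # B \<or> A = Pair b Atom # B"
    by (auto dest!: in_set_takeD)
  then show ?case using Cons.IH[of B] by auto
qed

lemma steal_SomeD:
  assumes "steal A M = Some (x, M')"
  shows "length M = Suc (length M')" "set M = insert (x, A) (set M')"
  using assms by (induction M arbitrary: M') (auto split: if_splits option.splits)

text \<open>A work list consists of pairs \<open>(x, M)\<close>, where \<open>M\<close> is a matching of all vertices in question
  but \<open>x\<close>. To match \<open>x\<close>, an element is taken from another vertex, which becomes free. No augmenting
  path has to be recorded.\<close>

fun scan ::
  "'s list \<Rightarrow> 'c \<Rightarrow> ('c \<times> 's) list \<Rightarrow> ('c \<times> ('c \<times> 's) list) list \<Rightarrow> 'c list \<Rightarrow>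
   ('c \<times> 's) list + (('c \<times> ('c \<times> 's) list) list \<times> 'c list)" where
  "scan [] c M W V = Inr (W, V)"
| "scan (A # N) c M W V = (case steal A M of None \<Rightarrow> Inl ((c, A) # M)
     | Some (x, M') \<Rightarrow>
         if x \<in> set V then scan N c M W V else scan N c M ((x, (c, A) # M') # W) (x # V))"

text \<open>A vertex enters the work list at most once, so the fuel need only count vertices. The
  equation for zero fuel and pending work returns a dummy value; the fuel condition of
  \<open>search_correct\<close> excludes it.\<close>

fun search ::
  "('c \<Rightarrow> 's list) \<Rightarrow> nat \<Rightarrow> ('c \<times> ('c \<times> 's) list) list \<Rightarrow> 'c list \<Rightarrow> ('c \<times> 's) list option" where
  "search N f [] V = None"
| "search N 0 (w # W) V = None"
| "search N (Suc f) ((c, M) # W) V = (case scan (N c) c M W V of Inl M' \<Rightarrow> Some M'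
     | Inr (W', V') \<Rightarrow> search N f W' V')"

text \<open>Without fuel, a failed search leaves \<open>c\<close> unmatched; this case is impossible
  once \<open>d\<close> has reached the optimum.\<close>

fun grow ::
  "(nat \<Rightarrow> 'c \<Rightarrow> 's list) \<Rightarrow> nat \<Rightarrow> nat \<Rightarrow> nat \<Rightarrow> 'c \<Rightarrow> ('c \<times> 's) list \<Rightarrow> nat \<times> ('c \<times> 's) list" where
  "grow N k 0 d c M = (case search (N d) k [(c, M)] [c] of None \<Rightarrow> (d, M) | Some M' \<Rightarrow> (d, M'))"
| "grow N k (Suc f) d c M = (case search (N d) k [(c, M)] [c] of None \<Rightarrow> grow N k f (Suc d) c M
     | Some M' \<Rightarrow> (d, M'))"

fun solve ::
  "(nat \<Rightarrow> 'c \<Rightarrow> 's list) \<Rightarrow> nat \<Rightarrow> nat \<Rightarrow> 'c list \<Rightarrow> nat \<Rightarrow> ('c \<times> 's) list \<Rightarrow> nat \<times> ('c \<times> 's) list" where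
  "solve N k f [] d M = (d, M)"
| "solve N k f (c # cs) d M = (case grow N k f d c M of (d', M') \<Rightarrow> solve N k f cs d' M')"

text \<open>A vertex released by \<open>steal\<close> is looked up in the visited list and becomes
  the next key, and comparisons are charged to the key. So it is the first components of a matching
  whose sizes must be controlled along the run.\<close>

definition bounded :: "nat \<Rightarrow> nat \<Rightarrow> (val \<times> val) list \<Rightarrow> bool" where
  "bounded q l M \<longleftrightarrow> length M \<le> l \<and> (\<forall>p\<in>set M. size (fst p) \<le> q)"

lemma bounded_Cons: "bounded q l M \<Longrightarrow> size c \<le> q \<Longrightarrow> bounded q (Suc l) ((c, A) # M)"
  by (auto simp: bounded_def)

lemma bounded_steal:
  "steal A M = Some (x, M') \<Longrightarrow> bounded q l M \<Longrightarrow> size c \<le> q \<Longrightarrow>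
     size x \<le> q \<and> bounded q l ((c, A) # M')"
  using steal_SomeD[of A M x M'] by (auto simp: bounded_def)

lemma scan_bounded:
  assumes "bounded q l M" "size c \<le> q" "\<forall>(c, M)\<in>set W. size c \<le> q \<and> bounded q l M"
  shows "case scan N c M W V of Inl M' \<Rightarrow> bounded q (Suc l) M'
    | Inr (W', V') \<Rightarrow> (\<forall>(c, M)\<in>set W'. size c \<le> q \<and> bounded q l M) \<and> length V' \<le> length V + length N"
  using assms(3)
proof (induction N arbitrary: W V)
  case Nil
  then show ?case by auto
next
  case (Cons A N)
  show ?case
  proof (cases "steal A M")
    case None
    then show ?thesis using bounded_Cons assms by auto
  next
    case (Some p)
    obtain x M' where p: "p = (x, M')" by fastforce
    have "case scan N c M ((x, (c, A) # M') # W) (x # V) of Inl M' \<Rightarrow> bounded q (Suc l) M'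
      | Inr (W', V') \<Rightarrow> (\<forall>(c, M)\<in>set W'. size c \<le> q \<and> bounded q l M) \<and>
          length V' \<le> length (x # V) + length N"
      using bounded_steal[OF _ assms(1,2)] Some p Cons.prems by (intro Cons.IH) auto
    then show ?thesis
      using Some p Cons.IH[OF Cons.prems, of V] by (auto split: sum.splits)
  qed
qed

definition enc_work :: "(val \<times> (val \<times> val) list) list \<Rightarrow> val" where
  "enc_work W = enc_list (map (\<lambda>(c, M). Pair c (enc_pairs M)) W)"

lemma enc_work_simps [simp]:
  "enc_work [] = Atom"
  "enc_work ((c, M) # W) = Pair (Pair c (enc_pairs M)) (enc_work W)"
  by (auto simp: enc_work_def)

definition enc_scan ::
  "(val \<times> val) list + ((val \<times> (val \<times> val) list) list \<times> val list) \<Rightarrow> val" where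
  "enc_scan r = (case r of Inl M \<Rightarrow> Pair (enc_bool True) (enc_pairs M)
     | Inr (W, V) \<Rightarrow> Pair Atom (Pair (enc_work W) (enc_list V)))"

text \<open>Each listed set costs one \<open>steal\<close> and at most one membership test. Visiting
  a vertex lengthens \<open>V\<close> by one while \<open>N\<close> gets shorter, so
  \<open>u\<close> bounds the visited list throughout.\<close>

lemma scan_ok:
  assumes "\<And>A. A \<in> set N \<Longrightarrow> size A \<le> 2 * q" "bounded q l M" "length V + length N \<le> u"
  shows "computes (prog E) scan_ix [enc_list N, c, enc_pairs M, enc_work W, enc_list V]
    (enc_scan (scan N c M W V)) ((length N + 1) * ((l + 1) * (60 * q + 50) + (u + 1) * (30 * q +
      40) + 100))"
  using assms(1,3)
proof (induction N arbitrary: W V)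
  case Nil
  show ?case by (rule computesI[OF prog_nth(10)]) (auto simp: scan_exp_def enc_scan_def)
next
  case (Cons A N)
  have "(length M + 1) * (30 * size A + 50) \<le> (l + 1) * (60 * q + 50)"
    using Cons.prems assms(2) by (intro mult_le_mono) (auto simp: bounded_def)
  then have st: "computes (prog E) steal_ix [A, enc_pairs M] (enc_steal (steal A M)) ((l + 1) *
    (60 * q + 50))"
    using computes_mono[OF steal_ok] by blast
  show ?case
  proof (cases "steal A M")
    case None
    then show ?thesis using computesD[OF st]
      by - (rule computesI[OF prog_nth(10)]; simp add: scan_exp_def enc_scan_def enc_steal_def)
  next
    case (Some p)
    obtain x M' where p: "p = (x, M')" by fastforce
    have "size x \<le> q"
      using steal_SomeD(2)[of A M x M'] Some p assms(2) by (auto simp: bounded_def)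
    then have "(length V + 1) * (30 * size x + 40) \<le> (u + 1) * (30 * q + 40)"
      using Cons.prems(2) by (intro mult_le_mono) auto
    then have mem: "computes (prog E) mem_ix [x, enc_list V] (enc_bool (x \<in> set V)) ((u + 1) * (30
      * q + 40))"
      using computes_mono[OF mem_ok] by blast
    let ?B = "(l + 1) * (60 * q + 50) + (u + 1) * (30 * q + 40) + 100"
    have IH: "computes (prog E) scan_ix [enc_list N, c, enc_pairs M, enc_work W', enc_list V']
        (enc_scan (scan N c M W' V')) ((length N + 1) * ?B)"
      if "length V' \<le> length V + 1" for W' V'
      using Cons that by auto
    have B: "(length (A # N) + 1) * ?B = ?B + (length N + 1) * ?B" by simp
    show ?thesis
    proof (cases "x \<in> set V")
      case True
      then show ?thesis
        using Some p computesD[OF st] computesD[OF mem] computesD[OF IH[of V W]] unfolding B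
        by - (rule computesI[OF prog_nth(10)]; simp add: scan_exp_def enc_steal_def)
    next
      case False
      then show ?thesis
        using Some p computesD[OF st] computesD[OF mem]
          computesD[OF IH[of "x # V" "(x, (c, A) # M') # W"]] unfolding B
        by - (rule computesI[OF prog_nth(10)]; simp add: scan_exp_def enc_steal_def)
    qed
  qed
qed

text \<open>\<open>tl\<close> removes the empty set, which is the first entry of \<open>sub\<close>
  and is not a vertex of the graph.\<close>

definition candidates :: "nat \<Rightarrow> nat \<Rightarrow> val \<Rightarrow> val list" where
  "candidates k d c = tl (map enc_list (sub (dec_list c) d k))"

lemma length_candidates: "k \<ge> 1 \<Longrightarrow> length (candidates k d c) < k"
  using length_sub[of "dec_list c" d k] by (auto simp: candidates_def)

lemma size_candidates: "A \<in> set (candidates k d c) \<Longrightarrow> size A \<le> 2 * size c"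
  using size_snd_sub[of _ "dec_list c" d k]
  by (cases "sub (dec_list c) d k") (auto simp: candidates_def)

lemma sub_nonempty: "k \<ge> 1 \<Longrightarrow> sub r d k \<noteq> []"
  by (induction r) auto

definition scan_time :: "nat \<Rightarrow> nat \<Rightarrow> nat \<Rightarrow> nat \<Rightarrow> nat" where
  "scan_time k q l u = k * ((l + 1) * (60 * q + 50) + (u + 1) * (30 * q + 40) + 100)"

definition subs_time :: "nat \<Rightarrow> nat \<Rightarrow> nat" where
  "subs_time k q = (q + 1) * ((k + 2) * (30 * q + 200))"

definition enc_option :: "(val \<times> val) list option \<Rightarrow> val" where
  "enc_option r = (case r of None \<Rightarrow> Atom | Some M \<Rightarrow> Pair (enc_pairs M) Atom)"

lemma search_ok:
  assumes "ks \<noteq> []" "k = length ks"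
    "\<forall>(c, M)\<in>set W. size c \<le> q \<and> bounded q l M" "length V + length fs * k \<le> u"
  shows "computes (prog E) search_ix [enc_list fs, enc_list d, enc_list ks, enc_work W, enc_list V]
      (enc_option (search (candidates k (length d)) (length fs) W V))
      ((length fs + 1) * (subs_time k q + scan_time k q l u + 100)) \<and>
    (case search (candidates k (length d)) (length fs) W V of None \<Rightarrow> True
     | Some M \<Rightarrow> bounded q (Suc l) M)"
  using assms(3,4)
proof (induction fs arbitrary: W V)
  case Nil
  show ?case
    by (cases W; rule conjI; (rule computesI[OF prog_nth(11)])?)
      (auto simp: search_exp_def enc_option_def)
next
  case (Cons y fs)
  let ?C = "candidates k (length d)"
  show ?case
  proof (cases W)
    case Nil
    then show ?thesis
      by - (rule conjI; (rule computesI[OF prog_nth(11)])?;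
          simp add: search_exp_def enc_option_def)
  next
    case (Cons w W')
    obtain c M where w: "w = (c, M)" by fastforce
    have c: "size c \<le> q" "bounded q l M" "\<forall>(c, M)\<in>set W'. size c \<le> q \<and> bounded q l M"
      using Cons.prems Cons w by auto
    have k: "k \<ge> 1" using assms by (cases ks) auto
    have len: "length (?C c) < k" using length_candidates k by blast
    have lc: "length (dec_list c) \<le> q" using length_dec_list[of c] c by linarith
    have "computes (prog E) subs_ix [c, enc_list d, enc_list ks]
       (enc_list (map enc_list (sub (dec_list c) (length d) k)))
       ((length (dec_list c) + 1) * ((length ks + 2) * (30 * q + 200)))"
      using subs_ok[OF lc assms(1), of E d] assms(2) by simp
    moreover obtain A0 where "map enc_list (sub (dec_list c) (length d) k) = A0 # ?C c"
      using sub_nonempty[OF k, of "dec_list c" "length d"]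
      by (cases "sub (dec_list c) (length d) k") (auto simp: candidates_def)
    ultimately have sb: "computes (prog E) subs_ix [c, enc_list d, enc_list ks]
       (Pair A0 (enc_list (?C c))) (subs_time k q)"
      using lc assms(2) unfolding subs_time_def
      by (auto elim!: computes_mono intro!: mult_le_mono1)
    have u: "length V + length (?C c) + length fs * k \<le> u"
      using Cons.prems len by simp
    have "(length (?C c) + 1) * ((l + 1) * (60 * q + 50) + (u + 1) * (30 * q + 40) + 100) \<le>
      scan_time k q l u"
      unfolding scan_time_def using len by (intro mult_le_mono1) simp
    then have sc: "computes (prog E) scan_ix [enc_list (?C c), c, enc_pairs M, enc_work W',
      enc_list V]
        (enc_scan (scan (?C c) c M W' V)) (scan_time k q l u)"
      using c u by (intro computes_mono[OF scan_ok[of _ q l]]) (auto dest!: size_candidates)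
    note sbnd = scan_bounded[OF c(2,1,3), where N = "?C c" and V = V]
    show ?thesis
    proof (cases "scan (?C c) c M W' V")
      case (Inl M')
      then show ?thesis
        using Cons w computesD[OF sb] computesD[OF sc] sbnd
        by - (rule conjI; (rule computesI[OF prog_nth(11)])?;
          simp add: search_exp_def enc_option_def enc_scan_def)
    next
      case (Inr r)
      obtain W1 V1 where r: "r = (W1, V1)" by fastforce
      have V1: "length V1 + length fs * k \<le> u" "\<forall>(c, M)\<in>set W1. size c \<le> q \<and> bounded q l M"
        using sbnd Inr r u by auto
      note IH = Cons.IH[OF V1(2,1)]
      show ?thesis
        using Inr r Cons w computesD[OF sb] computesD[OF sc] computesD[OF conjunct1[OF IH]]
          conjunct2[OF IH]
        by - (rule conjI; (rule computesI[OF prog_nth(11)])?;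
          simp add: search_exp_def enc_scan_def)
    qed
  qed
qed

text \<open>\<open>1 + k * k\<close> bounds the visited list: it starts with one vertex, and each of
  at most \<open>k\<close> rounds scans fewer than \<open>k\<close> candidates, each adding at most
  one vertex.\<close>

definition search_time :: "nat \<Rightarrow> nat \<Rightarrow> nat \<Rightarrow> nat" where
  "search_time k q l = (k + 1) * (subs_time k q + scan_time k q l (1 + k * k) + 100)"

abbreviation unary :: "nat \<Rightarrow> val" where
  "unary d \<equiv> enc_list (replicate d Atom)"

lemma grow_ok:
  assumes "ks \<noteq> []" "k = length ks" "size c \<le> q" "bounded q l M"
  shows "computes (prog E) grow_ix [enc_list fs, unary d, enc_list ks, c, enc_pairs M]
      (case grow (candidates k) k (length fs) d c M of (d', M') \<Rightarrow> Pair (unary d') (enc_pairs M'))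
      ((length fs + 1) * (search_time k q l + 100)) \<and>
    bounded q (Suc l) (snd (grow (candidates k) k (length fs) d c M))"
proof (induction fs arbitrary: d)
  case Nil
  note s = search_ok[OF assms(1,2), of "[(c, M)]" q l "[c]" ks "1 + k * k" E "replicate d Atom",
    folded search_time_def]
  have b: "bounded q (Suc l) M" using assms(4) by (auto simp: bounded_def)
  show ?case
    using s b assms computesD[OF conjunct1[OF s]]
    by - (rule conjI; (rule computesI[OF prog_nth(12)])?;
      cases "search (candidates k d) k [(c, M)] [c]"; simp add: grow_exp_def enc_option_def
        search_time_def)
next
  case (Cons y fs)
  note s = search_ok[OF assms(1,2), of "[(c, M)]" q l "[c]" ks "1 + k * k" E "replicate d Atom",
    folded search_time_def]
  have r: "unary (Suc d) = Pair Atom (unary d)" by simp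
  show ?case
    using s assms computesD[OF conjunct1[OF s]] computesD[OF conjunct1[OF Cons.IH[of "Suc d"],
      unfolded r]]
      conjunct2[OF Cons.IH[of "Suc d"]]
    by - (rule conjI; (rule computesI[OF prog_nth(12)])?;
      cases "search (candidates k d) k [(c, M)] [c]"; simp add: grow_exp_def enc_option_def
        search_time_def split: prod.splits)
qed

definition grow_time :: "nat \<Rightarrow> nat \<Rightarrow> nat \<Rightarrow> nat" where
  "grow_time k q l = (q + 1) * (search_time k q l + 100)"

lemma solve_ok:
  assumes "ks \<noteq> []" "k = length ks" "f \<le> q"
    "\<forall>c\<in>set cs. size c \<le> q \<and> length (dec_list c) = f" "bounded q l M" "l + length cs \<le> L"
  shows "computes (prog E) solve_ix [enc_list cs, unary d, enc_list ks, enc_pairs M]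
      (case solve (candidates k) k f cs d M of (d', M') \<Rightarrow> Pair (unary d') (enc_pairs M'))
      ((length cs + 1) * (grow_time k q L + 100)) \<and>
    bounded q L (snd (solve (candidates k) k f cs d M))"
  using assms(4-6)
proof (induction cs arbitrary: d M l)
  case Nil
  then have "bounded q L M" by (auto simp: bounded_def)
  then show ?case
    by - (rule conjI; (rule computesI[OF prog_nth(13)])?; simp add: solve_exp_def)
next
  case (Cons c cs)
  then have c: "size c \<le> q" "length (dec_list c) = f" and bL: "bounded q L M"
    by (auto simp: bounded_def)
  obtain d1 M1 where g: "grow (candidates k) k f d c M = (d1, M1)" by fastforce
  have "(f + 1) * (search_time k q L + 100) \<le> grow_time k q L"
    unfolding grow_time_def using assms(3) by (intro mult_le_mono1) simp
  then have gr: "computes (prog E) grow_ix [c, unary d, enc_list ks, c, enc_pairs M]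
      (Pair (unary d1) (enc_pairs M1)) (grow_time k q L)"
    using conjunct1[OF grow_ok[OF assms(1,2) c(1) bL, of E "dec_list c" d]] c g
    by (auto elim: computes_mono)
  have "bounded q (Suc l) M1"
    using conjunct2[OF grow_ok[OF assms(1,2) c(1) Cons.prems(2), of E "dec_list c" d]] c g by simp
  then have IH: "computes (prog E) solve_ix [enc_list cs, unary d1, enc_list ks, enc_pairs M1]
      (case solve (candidates k) k f cs d1 M1 of (d', M') \<Rightarrow> Pair (unary d') (enc_pairs M'))
      ((length cs + 1) * (grow_time k q L + 100)) \<and>
    bounded q L (snd (solve (candidates k) k f cs d1 M1))"
    using Cons.prems by (intro Cons.IH) auto
  show ?case
    using g computesD[OF gr] computesD[OF conjunct1[OF IH]] conjunct2[OF IH]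
    by - (rule conjI; (rule computesI[OF prog_nth(13)])?; simp add: solve_exp_def)
qed

text \<open>One slot of the budget is taken by the empty set, so \<open>Suc (length cs)\<close>
  entries leave up to \<open>length cs\<close> neighbours, which is what Hall's condition asks for.
  The order starts at 1 because no vertex is matched to the empty set.\<close>

definition run_solve :: "nat \<Rightarrow> val list \<Rightarrow> nat \<times> (val \<times> val) list" where
  "run_solve f cs = solve (candidates (Suc (length cs))) (Suc (length cs)) f cs 1 []"

definition solve_time :: "nat \<Rightarrow> nat \<Rightarrow> nat" where
  "solve_time m q = (m + 1) * (grow_time (m + 1) q m + 100) + 30"

lemma run_ok:
  assumes "f \<le> q" "\<forall>c\<in>set cs. size c \<le> q \<and> length (dec_list c) = f" "run_solve f cs = (d, M)"
  shows "computes (prog E) run_ix [enc_list cs] (Pair (unary d) (enc_pairs M)) (solve_time (length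
    cs) q)"
    and "bounded q (length cs) M"
proof -
  have "bounded q 0 []" by (simp add: bounded_def)
  note s = solve_ok[OF _ refl assms(1,2) this, of "Atom # cs" "length cs" E 1, simplified]
  show "computes (prog E) run_ix [enc_list cs] (Pair (unary d) (enc_pairs M)) (solve_time (length
    cs) q)"
    using computesD[OF conjunct1[OF s]] assms(3)
    by - (rule computesI[OF prog_nth(30)]; simp add: run_exp_def run_solve_def solve_time_def)
  show "bounded q (length cs) M"
    using s assms(3) by (simp add: run_solve_def)
qed

section \<open>Binary numbers and output\<close>

lemma lookup_ok:
  "computes (prog E) lookup_ix [c, enc_pairs M] (case map_of M c of None \<Rightarrow> Atom | Some A \<Rightarrow> A)
     ((length M + 1) * (30 * size c + 50))"
proof (induction M)
  case Nil
  show ?case by (rule computesI[OF prog_nth(14)]) (auto simp: lookup_exp_def)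
next
  case (Cons p M)
  obtain x A where p: "p = (x, A)" by fastforce
  show ?case
    using computesD[OF Cons.IH] computesD[OF eq_ok[of E c x]] p
    by - (rule computesI[OF prog_nth(14)]; cases "c = x"; simp add: lookup_exp_def algebra_simps)
qed

lemma enc_nat_0 [simp]: "enc_nat 0 = Atom"
  by (simp add: enc_nat_def bits.simps)

lemma enc_nat_pos: "n > 0 \<Longrightarrow> enc_nat n = Pair (enc_bool (odd n)) (enc_nat (n div 2))"
  by (subst enc_nat_def, subst bits.simps) (simp add: enc_nat_def)

text \<open>Only odd numbers propagate a carry, and then to \<open>n div 2\<close>. The linear bound
  is crude, but the incremented numbers are positions and counters of size at most
  \<open>card C\<close> or \<open>card X\<close>.\<close>

lemma inc_ok: "computes (prog E) inc_ix [enc_nat n] (enc_nat (Suc n)) (30 * (n + 1))"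
proof (induction n rule: less_induct)
  case (less n)
  show ?case
  proof (cases "n = 0")
    case True
    then show ?thesis
      by - (rule computesI[OF prog_nth(15)]; simp add: inc_exp_def enc_nat_pos)
  next
    case False
    then have IH: "computes (prog E) inc_ix [enc_nat (n div 2)] (enc_nat (Suc (n div 2))) (30 * (n
      div 2 + 1))"
      by (intro less.IH) simp
    have "n div 2 + 1 \<le> n" if "odd n" using that by presburger
    then show ?thesis
      using False computesD[OF IH]
      by - (rule computesI[OF prog_nth(15)]; cases "even n"; simp add: inc_exp_def enc_nat_pos)
  qed
qed

lemma tobin_ok: "computes (prog E) tobin_ix [enc_list l] (enc_nat (length l)) ((length l + 1) *
  (30 * length l + 60))"
proof (induction l)
  case Nil
  show ?case by (rule computesI[OF prog_nth(16)]) (auto simp: tobin_exp_def)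
next
  case (Cons y l)
  show ?case
    using computesD[OF Cons.IH] computesD[OF inc_ok[of E "length l"]]
    by - (rule computesI[OF prog_nth(16)]; simp add: tobin_exp_def algebra_simps)
qed

fun exs :: "nat \<Rightarrow> val list \<Rightarrow> val list" where
  "exs i [] = []"
| "exs i (Atom # A) = exs (Suc i) A"
| "exs i (Pair b v # A) = Pair (enc_nat i) b # exs (Suc i) A"

lemma exs_ok:
  assumes "i + length A \<le> m"
  shows "computes (prog E) exs_ix [enc_nat i, enc_list A] (enc_list (exs i A)) ((length A + 1) *
    (30 * m + 80))"
  using assms
proof (induction A arbitrary: i)
  case Nil
  show ?case by (rule computesI[OF prog_nth(17)]) (auto simp: exs_exp_def)
next
  case (Cons v A)
  then have IH: "computes (prog E) exs_ix [enc_nat (Suc i), enc_list A] (enc_list (exs (Suc i) A))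
    ((length A + 1) * (30 * m + 80))"
    by (intro Cons.IH) simp
  have "i \<le> m" using Cons.prems by simp
  then show ?case
    using computesD[OF IH] computesD[OF inc_ok[of E i]]
    by - (rule computesI[OF prog_nth(17)]; cases v; simp add: exs_exp_def algebra_simps)
qed

definition out_sets :: "val list \<Rightarrow> (val \<times> val) list \<Rightarrow> val list" where
  "out_sets cs M = map (\<lambda>c. enc_list (exs 0 (dec_list (the (map_of M c))))) cs"

definition outm_time :: "nat \<Rightarrow> nat \<Rightarrow> nat" where
  "outm_time m q = (m + 1) * ((m + 1) * (30 * q + 50) + (q + 1) * (30 * q + 80) + 50)"

lemma outm_ok:
  assumes "bounded q m M" "length cs \<le> m"
    "\<forall>c\<in>set cs. size c \<le> q \<and> (\<exists>A. map_of M c = Some (enc_list A) \<and> length A \<le> q)"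
  shows "computes (prog E) outm_ix [enc_list cs, enc_pairs M] (enc_list (out_sets cs M))
     (outm_time m q)"
proof -
  let ?B = "(m + 1) * (30 * q + 50) + (q + 1) * (30 * q + 80) + 50"
  have "computes (prog E) outm_ix [enc_list cs, enc_pairs M] (enc_list (out_sets cs M)) ((length
    cs + 1) * ?B)"
    using assms(3)
  proof (induction cs)
    case Nil
    show ?case by (rule computesI[OF prog_nth(18)]) (auto simp: outm_exp_def out_sets_def)
  next
    case (Cons c cs)
    then obtain A where A: "map_of M c = Some (enc_list A)" "length A \<le> q" and "size c \<le> q" by auto
    then have "(length M + 1) * (30 * size c + 50) \<le> (m + 1) * (30 * q + 50)"
      using assms(1) by (intro mult_le_mono) (auto simp: bounded_def)
    then have l: "computes (prog E) lookup_ix [c, enc_pairs M] (enc_list A) ((m + 1) * (30 * q +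
      50))"
      using computes_mono[OF lookup_ok[of E c M]] A by simp
    have "(length A + 1) * (30 * q + 80) \<le> (q + 1) * (30 * q + 80)"
      using A by (intro mult_le_mono1) simp
    then have e: "computes (prog E) exs_ix [Atom, enc_list A] (enc_list (exs 0 A)) ((q + 1) * (30
      * q + 80))"
      using computes_mono[OF exs_ok[of 0 A q E]] A by simp
    have IH: "computes (prog E) outm_ix [enc_list cs, enc_pairs M] (enc_list (out_sets cs M))
      ((length cs + 1) * ?B)"
      using Cons by simp
    have B: "(length (c # cs) + 1) * ?B = ?B + (length cs + 1) * ?B" by simp
    show ?case
      using computesD[OF IH] computesD[OF l] computesD[OF e] A(1) unfolding B
      by - (rule computesI[OF prog_nth(18)]; simp add: outm_exp_def out_sets_def)
  qed
  moreover have "(length cs + 1) * ?B \<le> outm_time m q"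
    unfolding outm_time_def using assms(2) by (intro mult_le_mono1) simp
  ultimately show ?thesis by (rule computes_mono)
qed

section \<open>Lists of vertices and edges of the consistency graph\<close>

lemma upt_add_Suc: "[i..<i + Suc n] = i # [Suc i..<Suc i + n]"
  by (simp add: upt_conv_Cons del: upt_Suc)

lemma nums_ok:
  assumes "i + length l \<le> m"
  shows "computes (prog E) nums_ix [enc_nat i, enc_list l] (enc_list (map enc_nat [i..<i + length
    l]))
     ((length l + 1) * (30 * m + 80))"
  using assms
proof (induction l arbitrary: i)
  case Nil
  show ?case by (rule computesI[OF prog_nth(19)]) (auto simp: nums_exp_def)
next
  case (Cons y l)
  then have IH: "computes (prog E) nums_ix [enc_nat (Suc i), enc_list l] (enc_list (map enc_nat
    [Suc i..<Suc i + length l]))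
     ((length l + 1) * (30 * m + 80))"
    by (intro Cons.IH) simp
  have "i \<le> m" using Cons.prems by simp
  then show ?case
    unfolding length_Cons upt_add_Suc
    using computesD[OF IH] computesD[OF inc_ok[of E i]]
    by - (rule computesI[OF prog_nth(19)]; simp add: nums_exp_def algebra_simps del: upt_Suc)
qed

lemma allex_ok:
  assumes "i + length l \<le> m"
  shows "computes (prog E) allex_ix [enc_nat i, enc_list l]
     (enc_list (concat (map (\<lambda>j. [Pair (enc_nat j) (enc_bool False), Pair (enc_nat j) (enc_bool
       True)]) [i..<i + length l])))
     ((length l + 1) * (30 * m + 80))"
  using assms
proof (induction l arbitrary: i)
  case Nil
  show ?case by (rule computesI[OF prog_nth(20)]) (auto simp: allex_exp_def)
next
  case (Cons y l)
  then have IH: "computes (prog E) allex_ix [enc_nat (Suc i), enc_list l]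
     (enc_list (concat (map (\<lambda>j. [Pair (enc_nat j) (enc_bool False), Pair (enc_nat j) (enc_bool
       True)]) [Suc i..<Suc i + length l])))
     ((length l + 1) * (30 * m + 80))"
    by (intro Cons.IH) simp
  have "i \<le> m" using Cons.prems by simp
  then show ?case
    unfolding length_Cons upt_add_Suc
    using computesD[OF IH] computesD[OF inc_ok[of E i]]
    by - (rule computesI[OF prog_nth(20)]; simp add: allex_exp_def algebra_simps del: upt_Suc)
qed

lemma edges1_ok:
  assumes "i + length r \<le> m"
  shows "computes (prog E) edges1_ix [v, enc_nat i, enc_list r, enc_list acc]
     (enc_list (map (\<lambda>(i, b). Pair v (Pair (enc_nat i) b)) (List.enumerate i r) @ acc))
     ((length r + 1) * (30 * m + 80))"
  using assms
proof (induction r arbitrary: i)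
  case Nil
  show ?case by (rule computesI[OF prog_nth(21)]) (auto simp: edges1_exp_def)
next
  case (Cons b r)
  then have IH: "computes (prog E) edges1_ix [v, enc_nat (Suc i), enc_list r, enc_list acc]
     (enc_list (map (\<lambda>(i, b). Pair v (Pair (enc_nat i) b)) (List.enumerate (Suc i) r) @ acc))
     ((length r + 1) * (30 * m + 80))"
    by (intro Cons.IH) simp
  have "i \<le> m" using Cons.prems by simp
  then show ?case
    using computesD[OF IH] computesD[OF inc_ok[of E i]]
    by - (rule computesI[OF prog_nth(21)]; simp add: edges1_exp_def algebra_simps)
qed

lemma edges_ok:
  assumes "j + length rs \<le> m" "\<forall>r\<in>set rs. length r \<le> n"
  shows "computes (prog E) edges_ix [enc_nat j, enc_list (map enc_list rs)]
     (enc_list (concat (map (\<lambda>(j, r). map (\<lambda>(i, b). Pair (enc_nat j) (Pair (enc_nat i) b))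
       (List.enumerate 0 r)) (List.enumerate j rs))))
     ((length rs + 1) * (30 * m + (n + 1) * (30 * n + 80) + 80))"
  using assms
proof (induction rs arbitrary: j)
  case Nil
  show ?case by (rule computesI[OF prog_nth(22)]) (auto simp: edges_exp_def)
next
  case (Cons r rs)
  let ?acc = "concat (map (\<lambda>(j, r). map (\<lambda>(i, b). Pair (enc_nat j) (Pair (enc_nat i) b))
    (List.enumerate 0 r)) (List.enumerate (Suc j) rs))"
  have IH: "computes (prog E) edges_ix [enc_nat (Suc j), enc_list (map enc_list rs)] (enc_list ?acc)
     ((length rs + 1) * (30 * m + (n + 1) * (30 * n + 80) + 80))"
    using Cons by (intro Cons.IH) auto
  have "(length r + 1) * (30 * n + 80) \<le> (n + 1) * (30 * n + 80)"
    using Cons.prems by (intro mult_le_mono1) simp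
  then have e: "computes (prog E) edges1_ix [enc_nat j, Atom, enc_list r, enc_list ?acc]
     (enc_list (map (\<lambda>(i, b). Pair (enc_nat j) (Pair (enc_nat i) b)) (List.enumerate 0 r) @ ?acc))
     ((n + 1) * (30 * n + 80))"
    using computes_mono[OF edges1_ok[of 0 r n E "enc_nat j" ?acc]] Cons.prems by simp
  have "j \<le> m" using Cons.prems by simp
  moreover have B: "(length (r # rs) + 1) * (30 * m + (n + 1) * (30 * n + 80) + 80) =
     (30 * m + (n + 1) * (30 * n + 80) + 80) + (length rs + 1) * (30 * m + (n + 1) * (30 * n + 80)
       + 80)" by simp
  ultimately show ?case
    using computesD[OF IH] computesD[OF e] computesD[OF inc_ok[of E j]] unfolding B
    by - (rule computesI[OF prog_nth(22)]; simp add: edges_exp_def)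
qed

section \<open>Likelihoods as quotients of binary numbers\<close>

lemma cnts_ok:
  "computes (prog E) cnts_ix [enc_list A] (enc_nat (nonatoms A)) ((length A + 1) * (30 * length A
    + 60))"
proof (induction A)
  case Nil
  show ?case by (rule computesI[OF prog_nth(23)]) (auto simp: cnts_exp_def)
next
  case (Cons v A)
  have inc: "computes (prog E) inc_ix [enc_nat (nonatoms A)] (enc_nat (Suc (nonatoms A))) (30 *
    (length A + 1))"
    by (rule computes_mono[OF inc_ok]) simp
  show ?case
    using computesD[OF Cons.IH] computesD[OF inc]
    by - (rule computesI[OF prog_nth(23)]; cases v; simp add: cnts_exp_def algebra_simps)
qed

abbreviation atoms :: "val list \<Rightarrow> nat" where
  "atoms A \<equiv> length (filter (\<lambda>v. v = Atom) A)"

lemma cntn_ok: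
  "computes (prog E) cntn_ix [enc_list A] (enc_nat (atoms A)) ((length A + 1) * (30 * length A +
    60))"
proof (induction A)
  case Nil
  show ?case by (rule computesI[OF prog_nth(24)]) (auto simp: cntn_exp_def)
next
  case (Cons v A)
  have inc: "computes (prog E) inc_ix [enc_nat (atoms A)] (enc_nat (Suc (atoms A))) (30 * (length
    A + 1))"
    by (rule computes_mono[OF inc_ok]) simp
  show ?case
    using computesD[OF Cons.IH] computesD[OF inc]
    by - (rule computesI[OF prog_nth(24)]; cases v; simp add: cntn_exp_def algebra_simps)
qed

lemma shift_ok:
  assumes "a < 2 ^ length p" "b > 0"
  shows "computes (prog E) shift_ix [enc_list p, enc_nat a, enc_nat b] (enc_nat (a + 2 ^ length p
    * b))
    (30 * (length p + 1))"
  using assms(1)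
proof (induction p arbitrary: a)
  case Nil
  then show ?case by - (rule computesI[OF prog_nth(25)]; simp add: shift_exp_def)
next
  case (Cons y p)
  then have IH: "computes (prog E) shift_ix [enc_list p, enc_nat (a div 2), enc_nat b]
      (enc_nat (a div 2 + 2 ^ length p * b)) (30 * (length p + 1))"
    by (intro Cons.IH) auto
  have s: "a + 2 ^ length (y # p) * b = a + 2 * (2 ^ length p * b)" by simp
  have pos: "2 ^ length p * b > 0" using assms(2) by simp
  have eq: "enc_nat (a + 2 ^ length (y # p) * b) =
     Pair (enc_bool (odd a)) (enc_nat (a div 2 + 2 ^ length p * b))"
    unfolding s using pos by (subst enc_nat_pos) (auto simp: add.commute)
  show ?case
    unfolding eq using computesD[OF IH]
    by - (rule computesI[OF prog_nth(25)]; cases "a = 0"; simp add: shift_exp_def enc_nat_pos)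
qed

text \<open>Only the length matters: it is the product of two lengths in unary, used as the exponent
  in the weight \<open>2 ^ (n * (n + 2))\<close>.\<close>

fun times_list :: "val list \<Rightarrow> val list \<Rightarrow> val list" where
  "times_list [] q = []"
| "times_list (x # r) q = map (Pair Atom) q @ times_list r q"

lemma length_times_list [simp]: "length (times_list r q) = length r * length q"
  by (induction r) auto

lemma times_ok:
  "computes (prog E) times_ix [enc_list r, enc_list q] (enc_list (times_list r q))
    ((length r + 1) * (30 * length q + 60))"
proof (induction r)
  case Nil
  show ?case by (rule computesI[OF prog_nth(26)]) (auto simp: times_exp_def)
next
  case (Cons v r)
  show ?case
    using computesD[OF Cons.IH] computesD[OF nones_ok[of E q "times_list r q"]]
    by - (rule computesI[OF prog_nth(26)]; simp add: times_exp_def algebra_simps)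
qed

text \<open>The two entries per point follow the order of
  \<open>List.product xs [False, True]\<close>: a point outside the concept has its consistent
  example first. The inconsistent example gets the fraction \<open>0 / 1\<close>.\<close>

fun lrow :: "val list \<Rightarrow> val list \<Rightarrow> val \<Rightarrow> val \<Rightarrow> val list" where
  "lrow (b # r) (v # A) w1 w0 =
    (let w = (if v = Atom then w0 else w1); z = Pair (enc_nat 0) (enc_nat (Suc 0))
     in (if b = Atom then [w, z] else [z, w]) @ lrow r A w1 w0)"
| "lrow _ _ w1 w0 = []"

lemma enc_nat_1: "enc_nat (Suc 0) = Pair (Pair Atom Atom) Atom"
  by (simp add: enc_nat_pos)

lemma lrow_ok:
  "computes (prog E) lrow_ix [enc_list r, enc_list A, w1, w0] (enc_list (lrow r A w1 w0)) (60 *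
    (length r + 1))"
proof (induction r arbitrary: A)
  case Nil
  show ?case by (rule computesI[OF prog_nth(27)]) (auto simp: lrow_exp_def)
next
  case IH: (Cons b r)
  show ?case
  proof (cases A)
    case Nil
    then show ?thesis by - (rule computesI[OF prog_nth(27)]; simp add: lrow_exp_def)
  next
    case (Cons v A')
    then show ?thesis
      using computesD[OF IH.IH[of A']]
      by - (rule computesI[OF prog_nth(27)]; cases v; cases b; simp add: lrow_exp_def Let_def
        enc_nat_1)
  qed
qed

text \<open>The fractions are not reduced. All consistent examples share the denominator, the sum of
  the weights: 1 for each unselected point, \<open>2 ^ e\<close> for each selected one.\<close>

definition weights :: "nat \<Rightarrow> val list \<Rightarrow> val list \<Rightarrow> val list" where
  "weights e r A = (let s = enc_nat (atoms A + 2 ^ e * nonatoms A)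
     in lrow r A (Pair (enc_nat (2 ^ e)) s) (Pair (enc_nat (Suc 0)) s))"

lemma likelihoods_ok:
  assumes "nonatoms A > 0" "length A = length r" "length r < 2 ^ length p"
  shows "computes (prog E) likelihoods_ix [enc_list r, enc_list A, enc_list p] (enc_list (weights
    (length p) r A))
     (2 * ((length r + 1) * (30 * length r + 60)) + 60 * (length p + 1) + 60 * (length r + 1) +
       100)"
proof -
  have "atoms A \<le> length A" by simp
  \<comment> \<open>This is the side condition of \<open>shift_ok\<close>: the low-order summand
    fits into the shifted digits.\<close>
  then have "atoms A < 2 ^ length p" using assms by linarith
  then show ?thesis
    using computesD[OF cnts_ok[of E A]] computesD[OF cntn_ok[of E A]] assms(2)
      computesD[OF shift_ok[of "atoms A" p "nonatoms A" E, OF _ assms(1)]]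
      computesD[OF shift_ok[of 0 p 1 E, simplified, unfolded enc_nat_1]]
      computesD[OF lrow_ok[of E r A
          "Pair (enc_nat (2 ^ length p)) (enc_nat (atoms A + 2 ^ length p * nonatoms A))"
          "Pair (enc_nat (Suc 0)) (enc_nat (atoms A + 2 ^ length p * nonatoms A))"]]
    by - (rule computesI[OF prog_nth(28)];
        simp add: likelihoods_exp_def weights_def Let_def enc_nat_1)
qed

definition learner_time :: "nat \<Rightarrow> nat \<Rightarrow> nat" where
  "learner_time m q = (m + 1) * ((m + 1) * (30 * q + 50) + (q + 1) * (30 * (q + 2) + 60) +
     2 * ((q + 1) * (30 * q + 60)) + 60 * (q * (q + 2) + 1) + 60 * (q + 1) + 200)"

definition out_learner :: "val list \<Rightarrow> (val \<times> val) list \<Rightarrow> val list" where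
  "out_learner cs M = map (\<lambda>c. enc_list (weights (length (dec_list c) * (length (dec_list c) + 2))
      (dec_list c) (dec_list (the (map_of M c))))) cs"

lemma learner_ok:
  assumes "bounded q m M" "length cs \<le> m"
    "\<forall>c\<in>set cs. size c \<le> q \<and> c \<noteq> Atom \<and> (\<exists>A. map_of M c = Some (enc_list A) \<and>
        length A = length (dec_list c) \<and> nonatoms A > 0)"
  shows "computes (prog E) learner_ix [enc_list cs, enc_pairs M] (enc_list (out_learner cs M))
     (learner_time m q)"
proof -
  let ?B = "(m + 1) * (30 * q + 50) + (q + 1) * (30 * (q + 2) + 60) +
     2 * ((q + 1) * (30 * q + 60)) + 60 * (q * (q + 2) + 1) + 60 * (q + 1) + 200"
  have "computes (prog E) learner_ix [enc_list cs, enc_pairs M] (enc_list (out_learner cs M))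
    ((length cs + 1) * ?B)"
    using assms(3)
  proof (induction cs)
    case Nil
    show ?case by (rule computesI[OF prog_nth(29)]) (auto simp: learner_exp_def out_learner_def)
  next
    case (Cons c cs)
    define r where "r = dec_list c"
    have c: "c = enc_list r" by (simp add: r_def)
    obtain A where A: "map_of M c = Some (enc_list A)" "length A = length r" "nonatoms A > 0"
      and "size c \<le> q" and "r \<noteq> []"
      using Cons.prems unfolding r_def by (cases c) auto
    then have "(length M + 1) * (30 * size c + 50) \<le> (m + 1) * (30 * q + 50)"
      using assms(1) by (intro mult_le_mono) (auto simp: bounded_def)
    then have l: "computes (prog E) lookup_ix [c, enc_pairs M] (enc_list A) ((m + 1) * (30 * q +
      50))"
      using computes_mono[OF lookup_ok[of E c M]] A by simp
    have n: "length r \<le> q" using length_dec_list[of c] \<open>size c \<le> q\<close> by (simp add: r_def)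
    \<comment> \<open>The two additional cells turn \<open>n * n\<close> into the exponent
      \<open>n * (n + 2)\<close> of \<open>heavy\<close>.\<close>
    have t: "computes (prog E) times_ix [c, Pair Atom (Pair Atom c)]
        (enc_list (times_list r (Atom # Atom # r))) ((q + 1) * (30 * (q + 2) + 60))"
      using computes_mono[OF times_ok[of E r "Atom # Atom # r"]] n
      by (simp add: c add_mono mult_le_mono)
    let ?p = "times_list r (Atom # Atom # r)"
    have "length r < 2 ^ length r" by (rule less_exp)
    also have "(2::nat) ^ length r \<le> 2 ^ length ?p" by (intro power_increasing) auto
    finally have k: "computes (prog E) likelihoods_ix [c, enc_list A, enc_list ?p] (enc_list
      (weights (length ?p) r A))
     (2 * ((length r + 1) * (30 * length r + 60)) + 60 * (length ?p + 1) + 60 * (length r + 1) +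
       100)"
      unfolding c by (intro likelihoods_ok A)
    have k: "computes (prog E) likelihoods_ix [c, enc_list A, enc_list ?p]
        (enc_list (weights (length r * (length r + 2)) r A))
        (2 * ((q + 1) * (30 * q + 60)) + 60 * (q * (q + 2) + 1) + 60 * (q + 1) + 100)"
    proof -
      have p: "length ?p = length r * (length r + 2)" by simp
      show ?thesis
        unfolding p[symmetric]
        by (rule computes_mono[OF k], unfold p, intro add_mono mult_le_mono order_refl) (use n in
          auto)
    qed
    have IH: "computes (prog E) learner_ix [enc_list cs, enc_pairs M] (enc_list (out_learner cs
      M)) ((length cs + 1) * ?B)"
      using Cons by simp
    have B: "(length (c # cs) + 1) * ?B = ?B + (length cs + 1) * ?B" by simp
    show ?case
      using computesD[OF IH] computesD[OF l] computesD[OF t] computesD[OF k] A(1) unfolding B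
      by - (rule computesI[OF prog_nth(29)]; simp add: learner_exp_def out_learner_def r_def)
  qed
  moreover have "(length cs + 1) * ?B \<le> learner_time m q"
    unfolding learner_time_def using assms(2) by (intro mult_le_mono1) simp
  ultimately show ?thesis by (rule computes_mono)
qed

text \<open>The 3 is the entry call: one unit each for the call, the argument list and the
  variable.\<close>

lemma runs_if_computes:
  assumes "computes (prog e) 0 [inp] v t"
  shows "runs (prog e) inp v (cost (prog e) [inp] (Call 0 [Var 0]) + size v) \<and>
    cost (prog e) [inp] (Call 0 [Var 0]) + size v \<le> t + 3 + size v"
  using assms unfolding runs_def by (auto simp: eval_iff computes_def)

section \<open>Correctness of the matching algorithm\<close>

lemma steal_None_iff: "steal A M = None \<longleftrightarrow> A \<notin> snd ` set M"
  by (induction A M rule: steal.induct) (auto split: option.splits)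

lemma steal_distinct:
  assumes "steal A M = Some (x, M')" "distinct (map fst M)" "distinct (map snd M)"
  shows "(x, A) \<in> set M" "set M' = set M - {(x, A)}"
    "distinct (map fst M')" "distinct (map snd M')"
    "fst ` set M' = fst ` set M - {x}" "snd ` set M' = snd ` set M - {A}"
proof -
  have "set M = insert (x, A) (set M') \<and> distinct (map fst M') \<and> distinct (map snd M') \<and>
      x \<notin> fst ` set M' \<and> A \<notin> snd ` set M'"
    using assms
  proof (induction M arbitrary: M')
    case Nil
    then show ?case by simp
  next
    case (Cons p M)
    obtain c B where p: "p = (c, B)" by fastforce
    show ?case
    proof (cases "A = B")
      case True
      then show ?thesis using Cons.prems p by auto
    next
      case False
      then obtain M'' where M'': "steal A M = Some (x, M'')" "M' = (c, B) # M''"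
        using Cons.prems p by (auto split: option.splits)
      note IH = Cons.IH[OF M''(1)]
      have "set M = insert (x, A) (set M'') \<and> distinct (map fst M'') \<and> distinct (map snd M'') \<and>
        x \<notin> fst ` set M'' \<and> A \<notin> snd ` set M''"
        using IH Cons.prems by simp
      then show ?thesis using Cons.prems(2,3) False p M''(2) by auto
    qed
  qed
  then have h: "set M = insert (x, A) (set M')" "distinct (map fst M')" "distinct (map snd M')"
    "x \<notin> fst ` set M'" "A \<notin> snd ` set M'"
    by auto
  show "(x, A) \<in> set M" "distinct (map fst M')" "distinct (map snd M')"
    using h by auto
  show "set M' = set M - {(x, A)}" using h by force
  show "fst ` set M' = fst ` set M - {x}" "snd ` set M' = snd ` set M - {A}"
    using h by auto
qed

locale augmentation =
  fixes N :: "'c \<Rightarrow> 's list" and M :: "('c \<times> 's) list" and c :: 'c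
  assumes distinct_fst: "distinct (map fst M)" and distinct_snd: "distinct (map snd M)"
    and free: "c \<notin> fst ` set M"
begin

definition U :: "'c set" where
  "U = insert c (fst ` set M)"

lemma finite_U [simp]: "finite U"
  by (simp add: U_def)

definition near :: "('c \<times> 's) list \<Rightarrow> bool" where
  "near M' \<longleftrightarrow> distinct (map fst M') \<and> distinct (map snd M') \<and>
     set M' \<subseteq> set M \<union> {(x, A). A \<in> set (N x)}"

text \<open>A state \<open>(x, M')\<close> is a matching in which exactly \<open>x\<close> is free. All states use the same
  elements, and they agree with \<open>M\<close> outside the set \<open>V\<close> of the visited vertices; this is why the
  visited vertices violate Hall's condition if the search fails.\<close>

definition state :: "'c set \<Rightarrow> 'c \<Rightarrow> ('c \<times> 's) list \<Rightarrow> bool" where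
  "state V x M' \<longleftrightarrow> near M' \<and> x \<in> V \<and> fst ` set M' = U - {x} \<and> snd ` set M' = snd ` set M \<and>
     (\<forall>y A. (y, A) \<in> set M \<longrightarrow> y \<notin> V \<longrightarrow> (y, A) \<in> set M')"

lemma state_mono: "state V x M' \<Longrightarrow> V \<subseteq> V' \<Longrightarrow> state V' x M'"
  unfolding state_def by blast

definition covered :: "'c set \<Rightarrow> 's \<Rightarrow> bool" where
  "covered V A \<longleftrightarrow> (\<exists>y\<in>V. (y, A) \<in> set M)"

lemma covered_mono: "covered V A \<Longrightarrow> V \<subseteq> V' \<Longrightarrow> covered V' A"
  by (auto simp: covered_def)

definition full :: "('c \<times> 's) list \<Rightarrow> bool" where
  "full M' \<longleftrightarrow> near M' \<and> fst ` set M' = U"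

lemma scan_correct:
  assumes "state (set V) x M'" "set V \<subseteq> U" "\<forall>(y, M'')\<in>set W. state (set V) y M''"
    "set As \<subseteq> set (N x)"
  shows "case scan As x M' W V of Inl M'' \<Rightarrow> full M''
    | Inr (W', V') \<Rightarrow> set V \<subseteq> set V' \<and> set V' \<subseteq> U \<and> (\<forall>(y, M'')\<in>set W'. state (set V') y M'') \<and>
        set W \<subseteq> set W' \<and> set V' \<subseteq> set V \<union> fst ` set W' \<and> (\<forall>A\<in>set As. covered (set V') A) \<and>
        card (U - set V') + length W' \<le> card (U - set V) + length W"
  using assms
proof (induction As arbitrary: V W)
  case Nil
  then show ?case by auto
next
  case (Cons A As)
  have st: "near M'" "x \<in> set V" "fst ` set M' = U - {x}" "snd ` set M' = snd ` set M"
    using Cons.prems(1) by (auto simp: state_def)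
  show ?case
  proof (cases "steal A M'")
    case None
    then have "A \<notin> snd ` set M'" by (simp add: steal_None_iff)
    moreover have "x \<in> U" "x \<notin> fst ` set M'" using st Cons.prems(2) by auto
    ultimately have "full ((x, A) # M')"
      using st Cons.prems(4) by (auto simp: full_def near_def)
    then show ?thesis using None by simp
  next
    case (Some p)
    obtain y M1 where p: "p = (y, M1)" by fastforce
    note s = steal_distinct[OF Some[unfolded p]]
    have dist: "distinct (map fst M')" "distinct (map snd M')"
      using st(1) by (auto simp: near_def)
    note s = s[OF dist]
    have yx: "y \<in> U" "y \<noteq> x" using s(1) st(3) by force+
    \<comment> \<open>Every state uses the elements of \<open>M\<close>, so \<open>A\<close> has an
      owner \<open>z\<close> in \<open>M\<close>. An unvisited \<open>z\<close> still owns
      \<open>A\<close> in \<open>M'\<close>, hence equals the vertex \<open>y\<close> from which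
      \<open>A\<close> was taken.\<close>
    have cov: "covered (insert y (set V)) A"
    proof -
      have "A \<in> snd ` set M" using s(1) st(4) by force
      then obtain z where z: "(z, A) \<in> set M" by auto
      have "z = y" if "z \<notin> set V"
      proof -
        have "(z, A) \<in> set M'" using Cons.prems(1) z that by (auto simp: state_def)
        then show "z = y"
          using s(1) inj_onD[of snd "set M'" "(z, A)" "(y, A)"] dist(2) by (simp add: distinct_map)
      qed
      then show ?thesis using z by (auto simp: covered_def)
    qed
    show ?thesis
    proof (cases "y \<in> set V")
      case True
      then have A: "covered (set V) A" using cov by (simp add: insert_absorb)
      have sc: "scan (A # As) x M' W V = scan As x M' W V" using Some p True by simp
      have "set As \<subseteq> set (N x)" using Cons.prems(4) by simp
      note IH = Cons.IH[OF Cons.prems(1-3) this]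
      show ?thesis
      proof (cases "scan As x M' W V")
        case (Inl M'')
        then show ?thesis using IH sc by simp
      next
        case (Inr r)
        obtain W1 V1 where r: "r = (W1, V1)" by fastforce
        have "covered (set V1) A" using A covered_mono IH Inr r by simp
        then show ?thesis using IH unfolding sc Inr r by simp
      qed
    next
      case False
      let ?V = "y # V" and ?W = "(y, (x, A) # M1) # W"
      have xM: "x \<notin> fst ` set M1" "A \<notin> snd ` set M1" using s st by auto
      have "near ((x, A) # M1)"
        using st(1) s xM Cons.prems(4) by (auto simp: near_def)
      moreover have "fst ` set ((x, A) # M1) = U - {y}"
        using s(5) st(3) yx Cons.prems(2) st(2) by auto
      moreover have "snd ` set ((x, A) # M1) = snd ` set M"
        using s(1,6) st(4) by force
      ultimately have new: "state (set ?V) y ((x, A) # M1)"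
        using Cons.prems(1) s(2) by (auto simp: state_def)
      have W: "\<forall>(z, M'')\<in>set ?W. state (set ?V) z M''"
        using new Cons.prems(3) state_mono[of "set V" _ _ "set ?V"] by fastforce
      have "card (U - set V) = Suc (card (U - set ?V))"
      proof -
        have "U - set ?V = (U - set V) - {y}" by auto
        then show ?thesis using False yx by (simp add: card_Suc_Diff1 del: card_Diff_insert)
      qed
      moreover have "state (set ?V) x M'"
        using Cons.prems(1) state_mono by (metis set_subset_Cons)
      moreover have "covered (set ?V) A" using cov by simp
      moreover have "case scan As x M' ?W ?V of Inl M'' \<Rightarrow> full M''
        | Inr (W', V') \<Rightarrow> set ?V \<subseteq> set V' \<and> set V' \<subseteq> U \<and> (\<forall>(y, M'')\<in>set W'. state (set V') y M'') \<and>
            set ?W \<subseteq> set W' \<and> set V' \<subseteq> set ?V \<union> fst ` set W' \<and> (\<forall>A\<in>set As. covered (set V') A) \<and>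
            card (U - set V') + length W' \<le> card (U - set ?V) + length ?W"
        using calculation(2) W Cons.prems(2,4) yx by (intro Cons.IH) auto
      ultimately have IH: "case scan As x M' ?W ?V of Inl M'' \<Rightarrow> full M''
        | Inr (W', V') \<Rightarrow> set ?V \<subseteq> set V' \<and> set V' \<subseteq> U \<and> (\<forall>(y, M'')\<in>set W'. state (set V') y M'') \<and>
            set ?W \<subseteq> set W' \<and> set V' \<subseteq> set ?V \<union> fst ` set W' \<and> (\<forall>A\<in>set As. covered (set V') A) \<and>
            card (U - set V') + length W' \<le> card (U - set ?V) + length ?W"
        and A: "covered (set ?V) A" and cd: "card (U - set V) = Suc (card (U - set ?V))"
        by blast+
      have sc: "scan (A # As) x M' W V = scan As x M' ?W ?V" using Some p False by simp
      show ?thesis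
      proof (cases "scan As x M' ?W ?V")
        case (Inl M'')
        then show ?thesis using IH sc by simp
      next
        case (Inr r)
        obtain W1 V1 where r: "r = (W1, V1)" by fastforce
        have IH: "set ?V \<subseteq> set V1" "set V1 \<subseteq> U" "\<forall>(y, M'')\<in>set W1. state (set V1) y M''"
            "set ?W \<subseteq> set W1" "set V1 \<subseteq> set ?V \<union> fst ` set W1" "\<forall>A\<in>set As. covered (set V1) A"
            "card (U - set V1) + length W1 \<le> card (U - set ?V) + length ?W"
          using IH unfolding Inr r by simp_all
        have "covered (set V1) A" using A covered_mono IH(1) by blast
        moreover have "y \<in> fst ` set W1" using IH(4) by force
        ultimately show ?thesis using IH cd unfolding sc Inr r by auto
      qed
    qed
  qed
qed

text \<open>A visited vertex that is no longer pending has been scanned, so its listed sets are all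
  owned by visited vertices. When nothing is pending, this holds for the whole of
  \<open>V\<close>.\<close>

lemma search_correct:
  assumes "c \<in> set V" "set V \<subseteq> U" "\<forall>(y, M'')\<in>set W. state (set V) y M''"
    "\<forall>x\<in>set V - fst ` set W. \<forall>A\<in>set (N x). covered (set V) A"
    "card (U - set V) + length W \<le> f"
  shows "case search N f W V of Some M' \<Rightarrow> full M'
    | None \<Rightarrow> (\<exists>V'\<subseteq>U. c \<in> V' \<and> (\<forall>x\<in>V'. \<forall>A\<in>set (N x). covered V' A))"
  using assms
proof (induction f arbitrary: V W)
  case 0
  then have "W = []" by simp
  then show ?case using 0 by (auto intro!: exI[of _ "set V"])
next
  case (Suc f)
  show ?case
  proof (cases W)
    case Nil
    then show ?thesis using Suc.prems by (auto intro!: exI[of _ "set V"])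
  next
    case (Cons w W')
    obtain x M' where w: "w = (x, M')" by fastforce
    have "case scan (N x) x M' W' V of Inl M'' \<Rightarrow> full M''
    | Inr (W1, V1) \<Rightarrow> set V \<subseteq> set V1 \<and> set V1 \<subseteq> U \<and> (\<forall>(y, M'')\<in>set W1. state (set V1) y M'') \<and>
        set W' \<subseteq> set W1 \<and> set V1 \<subseteq> set V \<union> fst ` set W1 \<and> (\<forall>A\<in>set (N x). covered (set V1) A) \<and>
        card (U - set V1) + length W1 \<le> card (U - set V) + length W'"
      using Suc.prems(2,3) Cons w by (intro scan_correct) auto
    note sc = this
    show ?thesis
    proof (cases "scan (N x) x M' W' V")
      case (Inl M'')
      then show ?thesis using sc Cons w by simp
    next
      case (Inr r)
      obtain W1 V1 where r: "r = (W1, V1)" by fastforce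
      have sc: "set V \<subseteq> set V1" "set V1 \<subseteq> U" "\<forall>(y, M'')\<in>set W1. state (set V1) y M''"
        "set W' \<subseteq> set W1" "set V1 \<subseteq> set V \<union> fst ` set W1" "\<forall>A\<in>set (N x). covered (set V1) A"
        "card (U - set V1) + length W1 \<le> card (U - set V) + length W'"
        using sc unfolding Inr r by simp_all
      have "\<forall>z\<in>set V1 - fst ` set W1. \<forall>A\<in>set (N z). covered (set V1) A"
      proof (intro ballI)
        fix z A assume z: "z \<in> set V1 - fst ` set W1" "A \<in> set (N z)"
        show "covered (set V1) A"
        proof (cases "z = x")
          case True
          then show ?thesis using sc z by auto
        next
          case False
          have "z \<notin> fst ` set W'" using z(1) sc(4) by blast
          then have "z \<in> set V - fst ` set W" using z(1) sc(5) False Cons w by auto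
          then show ?thesis using Suc.prems(4) z(2) covered_mono sc(1) by blast
        qed
      qed
      then have "case search N f W1 V1 of Some M' \<Rightarrow> full M'
        | None \<Rightarrow> (\<exists>V'\<subseteq>U. c \<in> V' \<and> (\<forall>x\<in>V'. \<forall>A\<in>set (N x). covered V' A))"
        using sc(1-3,7) Suc.prems(1,5) Cons by (intro Suc.IH) auto
      then show ?thesis using Cons w Inr r by simp
    qed
  qed
qed


text \<open>If all sets listed for \<open>V\<close> are owned in \<open>M\<close> by members of
  \<open>V\<close>, then \<open>c\<close>, which lies in \<open>V\<close> and owns nothing, makes
  them fewer than \<open>card V\<close>.\<close>

lemma augment:
  assumes "card U \<le> f"
  shows "case search N f [(c, M)] [c] of Some M' \<Rightarrow> full M'
    | None \<Rightarrow> (\<exists>V\<subseteq>U. V \<noteq> {} \<and> card (\<Union>x\<in>V. set (N x)) < card V)"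
proof -
  have cU: "c \<in> U" by (simp add: U_def)
  have UD: "U - {c} = fst ` set M" using free by (auto simp: U_def)
  have "card (U - {c}) + 1 = card U"
    using cU card.remove[OF finite_U cU] by simp
  then have "card (U - set [c]) + length [(c, M)] \<le> f" using assms by simp
  moreover have "near M" using distinct_fst distinct_snd by (auto simp: near_def)
  then have "state (set [c]) c M" by (simp add: state_def UD)
  ultimately have s: "case search N f [(c, M)] [c] of Some M' \<Rightarrow> full M'
    | None \<Rightarrow> (\<exists>V'\<subseteq>U. c \<in> V' \<and> (\<forall>x\<in>V'. \<forall>A\<in>set (N x). covered V' A))"
    using cU by (intro search_correct) simp_all
  show ?thesis
  proof (cases "search N f [(c, M)] [c]")
    case None
    then obtain V where V: "V \<subseteq> U" "c \<in> V" "\<forall>x\<in>V. \<forall>A\<in>set (N x). covered V A"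
      using s by auto
    have fin: "finite V" using V(1) finite_U finite_subset by blast
    let ?I = "{p \<in> set M. fst p \<in> V}"
    have I: "finite ?I" by simp
    have "inj_on fst ?I" using distinct_fst by (auto simp: distinct_map intro: inj_on_subset)
    then have "card ?I = card (fst ` ?I)" by (simp add: card_image)
    also have "\<dots> \<le> card (V - {c})"
      by (rule card_mono) (use fin free in force)+
    also have "\<dots> < card V" using fin V(2) by (intro psubset_card_mono) auto
    finally have "card ?I < card V" .
    moreover have "(\<Union>x\<in>V. set (N x)) \<subseteq> snd ` ?I"
    proof
      fix A assume "A \<in> (\<Union>x\<in>V. set (N x))"
      then have "covered V A" using V(3) by blast
      then obtain y where "y \<in> V" "(y, A) \<in> set M" by (auto simp: covered_def)
      then show "A \<in> snd ` ?I" by (intro image_eqI[of _ _ "(y, A)"]) auto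
    qed
    then have "card (\<Union>x\<in>V. set (N x)) \<le> card ?I"
      by (rule order_trans[OF card_mono[OF finite_imageI[OF I]] card_image_le[OF I]])
    ultimately have "card (\<Union>x\<in>V. set (N x)) < card V" by linarith
    then show ?thesis using None V(1,2) by auto
  next
    case (Some M')
    then show ?thesis using s by simp
  qed
qed

end

section \<open>Matchings of least order by successive augmentation\<close>

definition partial_matching :: "(nat \<Rightarrow> 'c \<Rightarrow> 's \<Rightarrow> bool) \<Rightarrow> nat \<Rightarrow> 'c set \<Rightarrow> ('c \<times> 's) list \<Rightarrow> bool" where
  "partial_matching Q d D M \<longleftrightarrow> distinct (map fst M) \<and> distinct (map snd M) \<and> fst ` set M = D \<and>
     (\<forall>(c, A)\<in>set M. Q d c A)"

text \<open>\<open>N d\<close> lists some of the neighbours in the graph with edge relation \<open>Q d\<close>. The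
  matching found so far need not consist of neighbours listed in \<open>N (Suc d)\<close>, so that only \<open>Q d\<close> is
  an invariant.\<close>

locale solving =
  fixes N :: "nat \<Rightarrow> 'c \<Rightarrow> 's list" and Q :: "nat \<Rightarrow> 'c \<Rightarrow> 's \<Rightarrow> bool" and C :: "'c set"
    and k opt :: nat
  assumes card_C: "finite C" "card C \<le> k"
    and edge: "c \<in> C \<Longrightarrow> A \<in> set (N d c) \<Longrightarrow> Q d c A"
    and mono: "Q d c A \<Longrightarrow> Q (Suc d) c A"
    and hall: "d \<ge> opt \<Longrightarrow> V \<subseteq> C \<Longrightarrow> V \<noteq> {} \<Longrightarrow> card V \<le> card (\<Union>x\<in>V. set (N d x))"
begin

lemma partial_matching_full:
  assumes "partial_matching Q d D M" "c \<notin> D" "insert c D \<subseteq> C" "augmentation.full (N d) M c M'"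
  shows "partial_matching Q d (insert c D) M'"
proof -
  interpret augmentation "N d" M c
    using assms(1,2) by unfold_locales (auto simp: partial_matching_def)
  have U: "U = insert c D" using assms(1) by (auto simp: U_def partial_matching_def)
  have M': "near M'" "fst ` set M' = U" using assms(4) by (auto simp: full_def)
  have "Q d x A" if "(x, A) \<in> set M'" for x A
  proof -
    have "(x, A) \<in> set M \<or> A \<in> set (N d x)" using M'(1) that by (auto simp: near_def)
    moreover have "x \<in> C" using that M'(2) U assms(3) by force
    ultimately show ?thesis using assms(1) edge by (auto simp: partial_matching_def)
  qed
  then show ?thesis using M' U by (auto simp: partial_matching_def near_def)
qed

text \<open>A failed search exhibits a violation of Hall's condition, which \<open>hall\<close>
  excludes for \<open>d \<ge> opt\<close>. So the order is raised only below \<open>opt\<close>, and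
  by \<open>mono\<close> the matching survives the step.\<close>

lemma grow_correct:
  assumes "partial_matching Q d D M" "D \<subseteq> C" "c \<in> C" "c \<notin> D" "d \<le> opt" "opt \<le> d + f"
    and "grow N k f d c M = (d', M')"
  shows "d \<le> d' \<and> d' \<le> opt \<and> partial_matching Q d' (insert c D) M'"
  using assms(1,5-7)
proof (induction f arbitrary: d)
  case aug: 0
  interpret augmentation "N d" M c
    using aug assms(4) by unfold_locales (auto simp: partial_matching_def)
  have U: "U = insert c D" using aug by (auto simp: U_def partial_matching_def)
  then have "U \<subseteq> C" using assms by simp
  then have "card U \<le> k" using card_C card_mono order_trans by blast
  note a = augment[OF this]
  \<comment> \<open>Exhausted fuel means that the order has reached the optimum, where the search
    cannot fail.\<close>
  have "d = opt" using aug by simp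
  moreover have "search (N d) k [(c, M)] [c] \<noteq> None"
  proof
    assume "search (N d) k [(c, M)] [c] = None"
    then obtain V where "V \<subseteq> U" "V \<noteq> {}" "card (\<Union>x\<in>V. set (N d x)) < card V" using a by auto
    then show False using hall[of d V] \<open>U \<subseteq> C\<close> \<open>d = opt\<close> by auto
  qed
  ultimately obtain M'' where M'': "search (N d) k [(c, M)] [c] = Some M''" "full M''"
    using a by (auto split: option.splits)
  then have "partial_matching Q d (insert c D) M''"
    using partial_matching_full[OF aug(1) assms(4)] \<open>U \<subseteq> C\<close> U by simp
  then show ?case using aug M'' by simp
next
  case aug: (Suc f)
  interpret augmentation "N d" M c
    using aug assms(4) by unfold_locales (auto simp: partial_matching_def)
  have U: "U = insert c D" using aug by (auto simp: U_def partial_matching_def)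
  then have "U \<subseteq> C" using assms by simp
  then have "card U \<le> k" using card_C card_mono order_trans by blast
  note a = augment[OF this]
  show ?case
  proof (cases "search (N d) k [(c, M)] [c]")
    case None
    then obtain V where "V \<subseteq> U" "V \<noteq> {}" "card (\<Union>x\<in>V. set (N d x)) < card V" using a by auto
    then have "d \<noteq> opt" using hall[of d V] \<open>U \<subseteq> C\<close> by auto
    moreover have "partial_matching Q (Suc d) D M"
      using aug.prems(1) mono unfolding partial_matching_def by blast
    ultimately have "Suc d \<le> d' \<and> d' \<le> opt \<and> partial_matching Q d' (insert c D) M'"
      using aug.prems None by (intro aug.IH) auto
    then show ?thesis by simp
  next
    case (Some M'')
    then have "full M''" using a by simp
    then have "partial_matching Q d (insert c D) M''"
      using partial_matching_full[OF aug.prems(1) assms(4)] \<open>U \<subseteq> C\<close> U by simp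
    then show ?thesis using aug.prems Some by simp
  qed
qed

lemma solve_correct:
  assumes "partial_matching Q d D M" "D \<union> set cs = C" "distinct cs" "D \<inter> set cs = {}"
    "d \<le> opt" "opt \<le> d + f" "solve N k f cs d M = (d', M')"
  shows "d' \<le> opt \<and> partial_matching Q d' C M'"
  using assms
proof (induction cs arbitrary: d D M)
  case Nil
  then show ?case by simp
next
  case (Cons c cs)
  obtain d1 M1 where g: "grow N k f d c M = (d1, M1)" by fastforce
  have g1: "d \<le> d1 \<and> d1 \<le> opt \<and> partial_matching Q d1 (insert c D) M1"
    by (rule grow_correct[OF Cons.prems(1) _ _ _ Cons.prems(5,6) g]) (use Cons.prems in auto)
  then show ?case
    by (intro Cons.IH[of d1 "insert c D" M1]) (use Cons.prems g in auto)
qed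

end

section \<open>Saturating matchings are teachers\<close>

definition draw_weight :: "('z \<Rightarrow> real) \<Rightarrow> 'z list \<Rightarrow> real" where
  "draw_weight q zs = (\<Prod>i<length zs. q (zs ! i) / (1 - (\<Sum>j<i. q (zs ! j))))"

lemma draw_prob_eq: "draw_prob q A = (\<Sum>zs\<in>permutations_of_set A. draw_weight q zs)"
  by (simp add: draw_prob_def draw_weight_def)

lemma sum_nth_distinct:
  assumes "distinct zs" "i \<le> length zs"
  shows "(\<Sum>j<i. q (zs ! j)) = sum q (set (take i zs))"
proof -
  have "inj_on ((!) zs) {..<i}" using assms by (auto simp: inj_on_def nth_eq_iff_index_eq)
  moreover have "(!) zs ` {..<i} = set (take i zs)"
    using assms(2) nth_image[of i zs] by (simp add: lessThan_atLeast0)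
  ultimately show ?thesis using sum.reindex[of "(!) zs" "{..<i}" q] by simp
qed

lemma draw_weight_snoc:
  assumes "distinct zs"
  shows "draw_weight q (zs @ [z]) = draw_weight q zs * (q z / (1 - sum q (set zs)))"
proof -
  have "(\<Sum>j<i. q ((zs @ [z]) ! j)) = (\<Sum>j<i. q (zs ! j))" if "i \<le> length zs" for i
    using that by (intro sum.cong) (auto simp: nth_append)
  then show ?thesis
    using sum_nth_distinct[OF assms, of "length zs" q]
    by (simp add: draw_weight_def nth_append lessThan_Suc)
qed

lemma draw_weight_nonneg:
  assumes "finite Z" "\<forall>z\<in>Z. q z \<ge> 0" "sum q Z \<le> 1" "distinct zs" "set zs \<subseteq> Z"
  shows "draw_weight q zs \<ge> 0"
  unfolding draw_weight_def
proof (rule prod_nonneg)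
  fix i assume i: "i \<in> {..<length zs}"
  then have "(\<Sum>j<i. q (zs ! j)) = sum q (set (take i zs))"
    using sum_nth_distinct[of zs i q] assms(4) by simp
  also have "\<dots> \<le> sum q Z"
    using assms set_take_subset[of i zs] by (intro sum_mono2) auto
  finally have "(\<Sum>j<i. q (zs ! j)) \<le> 1" using assms(3) by simp
  moreover have "q (zs ! i) \<ge> 0" using assms i by (auto simp: subset_iff)
  \<comment> \<open>The denominator may be 0; the quotient is then 0.\<close>
  ultimately show "0 \<le> q (zs ! i) / (1 - (\<Sum>j<i. q (zs ! j)))" by simp
qed

abbreviation draws :: "'z set \<Rightarrow> nat \<Rightarrow> 'z list set" where
  "draws Z k \<equiv> {zs. distinct zs \<and> set zs \<subseteq> Z \<and> length zs = k}"

lemma finite_draws: "finite Z \<Longrightarrow> finite (draws Z k)"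
  by (rule finite_subset[OF _ finite_lists_length_eq[of Z k]]) auto

text \<open>Given the first draws \<open>zs\<close> of mass \<open>s\<close>, the shares of the next
  draw add up to \<open>(sum q Z - s) / (1 - s)\<close>, which is at most 1. In general only an
  inequality holds, for instance because the shares are 0 once the mass is exhausted.\<close>

lemma sum_draw_weight_le:
  assumes Z: "finite Z" "\<forall>z\<in>Z. q z \<ge> 0" "sum q Z \<le> 1"
  shows "(\<Sum>zs\<in>draws Z k. draw_weight q zs) \<le> 1"
proof (induction k)
  case 0
  have "draws Z 0 = {[]}" by auto
  then show ?case by (simp add: draw_weight_def)
next
  case (Suc k)
  let ?P = "SIGMA zs:draws Z k. Z - set zs"
  have inj: "inj_on (\<lambda>(zs, z). zs @ [z]) ?P" by (auto simp: inj_on_def)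
  have "draws Z (Suc k) = (\<lambda>(zs, z). zs @ [z]) ` ?P"
  proof (intro set_eqI iffI)
    fix xs assume xs: "xs \<in> draws Z (Suc k)"
    then obtain zs z where "xs = zs @ [z]" by (cases xs rule: rev_cases) auto
    then show "xs \<in> (\<lambda>(zs, z). zs @ [z]) ` ?P"
      using xs by (intro image_eqI[of _ _ "(zs, z)"]) auto
  qed auto
  then have "(\<Sum>zs\<in>draws Z (Suc k). draw_weight q zs) =
      (\<Sum>(zs, z)\<in>?P. draw_weight q (zs @ [z]))"
    using sum.reindex[OF inj, of "draw_weight q"] by (simp add: case_prod_unfold)
  also have "\<dots> = (\<Sum>zs\<in>draws Z k. \<Sum>z\<in>Z - set zs. draw_weight q (zs @ [z]))"
    using Z finite_draws by (intro sum.Sigma[symmetric]) auto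
  also have "\<dots> \<le> (\<Sum>zs\<in>draws Z k. draw_weight q zs)"
  proof (rule sum_mono)
    fix zs assume zs: "zs \<in> draws Z k"
    let ?s = "sum q (set zs)"
    have s: "sum q (Z - set zs) = sum q Z - ?s" using zs Z by (simp add: sum_diff)
    have s1: "?s \<le> sum q Z" using zs Z by (intro sum_mono2) auto
    have "(\<Sum>z\<in>Z - set zs. draw_weight q (zs @ [z])) = draw_weight q zs * (sum q (Z - set zs) / (1
      - ?s))"
      using zs by (simp add: draw_weight_snoc sum_distrib_left sum_divide_distrib)
    also have "\<dots> \<le> draw_weight q zs * 1"
      using draw_weight_nonneg[OF Z] zs s s1 Z(3)
      by (intro mult_left_mono) (auto simp: divide_le_eq_1)
    finally show "(\<Sum>z\<in>Z - set zs. draw_weight q (zs @ [z])) \<le> draw_weight q zs" by simp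
  qed
  also note Suc.IH
  finally show ?case .
qed

lemma draw_prob_nonneg:
  assumes "finite Z" "\<forall>z\<in>Z. q z \<ge> 0" "sum q Z \<le> 1" "A \<subseteq> Z"
  shows "draw_prob q A \<ge> 0"
  unfolding draw_prob_eq
  using draw_weight_nonneg[OF assms(1-3)] assms(4)
  by (intro sum_nonneg) (auto simp: permutations_of_set_def)

text \<open>Drawing \<open>A\<close> and drawing \<open>B\<close> are disjoint events among the
  draws of length \<open>card A\<close>.\<close>

lemma draw_prob_add_le_1:
  assumes Z: "finite Z" "\<forall>z\<in>Z. q z \<ge> 0" "sum q Z \<le> 1"
    and "A \<subseteq> Z" "B \<subseteq> Z" "card A = card B" "A \<noteq> B"
  shows "draw_prob q A + draw_prob q B \<le> 1"
proof -
  have fin: "finite A" "finite B" using assms(4,5) finite_subset[OF _ Z(1)] by blast+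
  have "draw_prob q A + draw_prob q B =
      (\<Sum>zs\<in>permutations_of_set A \<union> permutations_of_set B. draw_weight q zs)"
    unfolding draw_prob_eq
    by (rule sum.union_disjoint[symmetric, OF finite_permutations_of_set
      finite_permutations_of_set])
      (use assms(7) in \<open>auto simp: permutations_of_set_def\<close>)
  also have "\<dots> \<le> (\<Sum>zs\<in>draws Z (card A). draw_weight q zs)"
    using draw_weight_nonneg[OF Z] assms finite_draws[OF Z(1)]
    by (intro sum_mono2) (auto simp: permutations_of_set_def distinct_card)
  also have "\<dots> \<le> 1" by (rule sum_draw_weight_le[OF Z])
  finally show ?thesis .
qed

lemma draw_prob_eq_0:
  assumes "z \<in> A" "q z = 0"
  shows "draw_prob q A = 0"
  unfolding draw_prob_eq
proof (rule sum.neutral, rule ballI)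
  fix zs assume "zs \<in> permutations_of_set A"
  then obtain i where "i < length zs" "zs ! i = z"
    using assms(1) by (auto simp: permutations_of_set_def in_set_conv_nth)
  then show "draw_weight q zs = 0"
    unfolding draw_weight_def using assms(2) by (intro prod_zero) auto
qed

text \<open>In decreasing order of likelihood, each draw takes a most likely one among at most
  \<open>card Y\<close> remaining elements.\<close>

lemma draw_prob_ge_greedy:
  assumes Y: "finite Y" "\<forall>y\<in>Y. q y > 0" "sum q Y = 1" and "B \<subseteq> Y"
    and top: "\<forall>b\<in>B. \<forall>y\<in>Y - B. q y \<le> q b"
  shows "draw_prob q B \<ge> (1 / card Y) ^ card B"
proof -
  have fin: "finite B" using Y(1) assms(4) finite_subset by blast
  obtain l where l: "set l = B" "distinct l" using finite_distinct_list[OF fin] by blast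
  define zs where "zs = sort_key (\<lambda>z. - q z) l"
  have zs: "set zs = B" "distinct zs" using l by (simp_all add: zs_def)
  then have len: "length zs = card B" using distinct_card[of zs] by simp
  have sorted: "sorted (map (\<lambda>z. - q z) zs)" by (simp add: zs_def)
  have "1 / card Y \<le> q (zs ! i) / (1 - (\<Sum>j<i. q (zs ! j)))" if i: "i < length zs" for i
  proof -
    let ?T = "set (take i zs)"
    have T: "?T \<subseteq> Y" using zs assms(4) set_take_subset by fast
    have T': "?T = (!) zs ` {..<i}" using nth_image[of i zs] i by (simp add: lessThan_atLeast0)
    have "zs ! i \<in> B" using i zs(1) nth_mem by blast
    moreover have "zs ! i \<notin> ?T" using i zs(2) by (auto simp: T' nth_eq_iff_index_eq)
    ultimately have zi: "zs ! i \<in> Y - ?T" using assms(4) by blast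
    have eq: "1 - (\<Sum>j<i. q (zs ! j)) = sum q (Y - ?T)"
      using sum_nth_distinct[OF zs(2), of i q] i T Y by (simp add: sum_diff)
    have "q y \<le> q (zs ! i)" if y: "y \<in> Y - ?T" for y
    proof (cases "y \<in> B")
      case True
      then obtain j where j: "j < length zs" "y = zs ! j" using zs by (auto simp: in_set_conv_nth)
      then have "\<not> j < i" using y by (auto simp: T')
      then show ?thesis using sorted_nth_mono[OF sorted, of i j] i j by simp
    next
      case False
      then show ?thesis using top y \<open>zs ! i \<in> B\<close> by blast
    qed
    then have "sum q (Y - ?T) \<le> card (Y - ?T) * q (zs ! i)"
      by (rule sum_bounded_above)
    also have "\<dots> \<le> card Y * q (zs ! i)"
      using Y(1) less_imp_le[OF bspec[OF Y(2), of "zs ! i"]] zi card_mono[OF Y(1), of "Y - ?T"]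
      by (intro mult_right_mono) auto
    finally have le: "sum q (Y - ?T) \<le> card Y * q (zs ! i)" .
    have "sum q (Y - ?T) > 0" using zi Y by (intro sum_pos) auto
    moreover have "card Y > 0" using zi Y by (auto simp: card_gt_0_iff)
    ultimately show ?thesis unfolding eq using le by (simp add: field_simps)
  qed
  then have "(\<Prod>i<length zs. 1 / card Y) \<le> draw_weight q zs"
    unfolding draw_weight_def by (intro prod_mono) auto
  \<comment> \<open>One order of drawing suffices, since the others contribute non-negative
    terms.\<close>
  also have "\<dots> \<le> draw_prob q B"
    unfolding draw_prob_eq
    using Y zs assms(4)
    by (intro member_le_sum draw_weight_nonneg[of Y] finite_permutations_of_set)
      (auto simp: permutations_of_set_def less_imp_le)
  finally show ?thesis using len by simp
qed

text \<open>With \<open>\<beta> = 1 - card A * a\<close> standing for the mass outside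
  \<open>A\<close>, a draw with \<open>m\<close> elements of \<open>A\<close> remaining stays in
  \<open>A\<close> with probability \<open>m * a / (m * a + \<beta>)\<close>, and
  \<open>m = 1\<close> is the worst case. Bernoulli's inequality turns the power
  \<open>(a / (a + \<beta>)) ^ card A\<close> into a linear bound.\<close>

lemma draw_prob_uniform_ge:
  fixes a :: real
  assumes "finite A" "\<forall>z\<in>A. q z = a" "a > 0" "card A * a \<le> 1"
  shows "draw_prob q A \<ge> 1 - card A * ((1 - card A * a) / a)"
proof -
  define k where "k = card A"
  define \<beta> where "\<beta> = 1 - k * a"
  have \<beta>: "\<beta> \<ge> 0" using assms(4) by (simp add: \<beta>_def k_def)
  have w: "draw_weight q zs = (\<Prod>i<k. a / (1 - i * a))" if "zs \<in> permutations_of_set A" for zs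
  proof -
    have zs: "set zs = A" "distinct zs" "length zs = k"
      using that distinct_card[of zs] by (auto simp: permutations_of_set_def k_def)
    then have "q (zs ! i) = a" if "i < k" for i using that assms(2) by auto
    then show ?thesis
      unfolding draw_weight_def zs(3) by (intro prod.cong) auto
  qed
  \<comment> \<open>All orders have the same weight; the factors of \<open>fact k\<close> are then
    distributed so that the \<open>i\<close>-th factor is the probability of staying in
    \<open>A\<close> at step \<open>i\<close>.\<close>
  have "draw_prob q A = fact k * (\<Prod>i<k. a / (1 - i * a))"
    unfolding draw_prob_eq using w assms(1) by (simp add: k_def)
  also have "fact k = (\<Prod>i<k. real (k - i))"
  proof -
    have "(\<Prod>i<k. k - i) = \<Prod>{1..k}"
      by (rule prod.reindex_bij_witness[of _ "\<lambda>i. k - i" "\<lambda>i. k - i"]) auto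
    then have "fact k = real (\<Prod>i<k. k - i)" by (simp add: fact_prod)
    then show ?thesis by (simp only: of_nat_prod)
  qed
  also have "(\<Prod>i<k. real (k - i)) * (\<Prod>i<k. a / (1 - i * a)) = (\<Prod>i<k. real (k - i) * (a / (1 - i *
    a)))"
    by (rule prod.distrib[symmetric])
  finally have eq: "draw_prob q A = (\<Prod>i<k. real (k - i) * (a / (1 - i * a)))" .
  have "a / (a + \<beta>) \<le> real (k - i) * (a / (1 - i * a))" if "i < k" for i
  proof -
    define m where "m = real (k - i)"
    have m: "m \<ge> 1" using that by (simp add: m_def)
    have "1 - i * a = m * a + \<beta>" using that by (simp add: m_def \<beta>_def of_nat_diff algebra_simps)
    moreover have "a / (a + \<beta>) \<le> m * (a / (m * a + \<beta>))"
    proof -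
      have "a + \<beta> > 0" "m * a + \<beta> > 0" using assms(3) \<beta> m by (auto intro: add_pos_nonneg)
      moreover have "a * \<beta> * 1 \<le> a * \<beta> * m" using m \<beta> assms(3) by (intro mult_left_mono) auto
      ultimately show ?thesis by (simp add: field_simps)
    qed
    ultimately show ?thesis by (simp add: m_def)
  qed
  then have "(\<Prod>i<k. a / (a + \<beta>)) \<le> draw_prob q A"
    unfolding eq using assms(3) \<beta> by (intro prod_mono) auto
  moreover have "1 + k * (a / (a + \<beta>) - 1) \<le> (1 + (a / (a + \<beta>) - 1)) ^ k"
    using assms(3) \<beta> by (intro Bernoulli_inequality) auto
  moreover have "a / (a + \<beta>) - 1 \<ge> - (\<beta> / a)"
  proof -
    have "a + \<beta> > 0" using assms(3) \<beta> by simp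
    then have "a / (a + \<beta>) - 1 = - (\<beta> / (a + \<beta>))" by (simp add: field_simps)
    moreover have "\<beta> / (a + \<beta>) \<le> \<beta> / a" using assms(3) \<beta> by (intro divide_left_mono) auto
    ultimately show ?thesis by simp
  qed
  then have "k * (a / (a + \<beta>) - 1) \<ge> k * - (\<beta> / a)"
    by (intro mult_left_mono) auto
  ultimately show ?thesis by (simp add: \<beta>_def k_def)
qed


section \<open>The learner belonging to a saturating matching\<close>

definition consistent :: "'a set \<Rightarrow> 'a set \<Rightarrow> ('a \<times> bool) set" where
  "consistent X c = {z \<in> examples X. sat c z}"

lemma consistent_eq: "consistent X c = (\<lambda>x. (x, x \<in> c)) ` X"
  by (auto simp: consistent_def examples_def)

lemma card_consistent: "card (consistent X c) = card X"
  unfolding consistent_eq by (intro card_image) (auto simp: inj_on_def)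

lemma consistent_inj: "c \<subseteq> X \<Longrightarrow> c' \<subseteq> X \<Longrightarrow> consistent X c = consistent X c' \<Longrightarrow> c = c'"
  by (auto simp: consistent_eq image_iff set_eq_iff subset_iff)

lemma graph_Gplus_iff: "(c, A) \<in> graph_Gplus X C \<longleftrightarrow> c \<in> C \<and> A \<subseteq> consistent X c \<and> A \<noteq> {}"
  by (auto simp: graph_Gplus_def sat_all_def consistent_def)

text \<open>A power of two, so that the weights can be written down by shifting. The exponent is the
  one in \<open>n ^ (n + 2) < (2 ^ n) ^ (n + 2)\<close>, where \<open>n ^ (n + 2)\<close> bounds
  \<open>k * (n - k) * n ^ k\<close>.\<close>

definition heavy :: "nat \<Rightarrow> nat" where
  "heavy n = 2 ^ (n * (n + 2))"

definition mass :: "'a set \<Rightarrow> ('a set \<Rightarrow> ('a \<times> bool) set) \<Rightarrow> 'a set \<Rightarrow> nat" where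
  "mass X M c = card X - card (M c) + heavy (card X) * card (M c)"

definition learner_of :: "'a set \<Rightarrow> ('a set \<Rightarrow> ('a \<times> bool) set) \<Rightarrow> 'a set \<Rightarrow> 'a \<times> bool \<Rightarrow> real" where
  "learner_of X M c z = (if z \<in> consistent X c then
       real (if z \<in> M c then heavy (card X) else 1) / real (mass X M c) else 0)"

lemma heavy_pos [simp]: "heavy n > 0"
  by (simp add: heavy_def)

lemma less_heavy:
  assumes "k \<le> n" "n > 0"
  shows "k * (n - k) * n ^ k < heavy n"
proof -
  have "k * (n - k) * n ^ k \<le> n * n * n ^ n"
    using assms by (intro mult_le_mono power_increasing) auto
  also have "\<dots> = n ^ (n + 2)" by (simp add: power_add power2_eq_square)
  also have "\<dots> < (2 ^ n) ^ (n + 2)"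
    by (intro power_strict_mono less_exp) (use assms in auto)
  finally show ?thesis by (simp only: heavy_def power_mult)
qed

lemma finite_class:
  assumes "concept_class X C"
  shows "finite X" "finite C" "C \<noteq> {}" "card X > 0"
  using assms finite_subset[of C "Pow X"] by (auto simp: concept_class_def card_gt_0_iff)

lemma finite_consistent:
  assumes "concept_class X C"
  shows "finite (consistent X c)" "finite (examples X)"
  using finite_class(1)[OF assms] by (auto simp: consistent_eq examples_def)

context
  fixes X :: "'a set" and C :: "'a set set" and M :: "'a set \<Rightarrow> ('a \<times> bool) set"
  assumes cls: "concept_class X C" and M: "saturating_matching C (graph_Gplus X C) M"
begin

lemmas fin_class = finite_class[OF cls]
lemmas fin_consistent = finite_consistent[OF cls]

lemma M_props:
  assumes "c \<in> C"
  shows "M c \<subseteq> consistent X c" "M c \<noteq> {}" "finite (M c)" "card (M c) > 0" "card (M c) \<le> card X"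
proof -
  show 1: "M c \<subseteq> consistent X c" "M c \<noteq> {}"
    using M assms by (auto simp: saturating_matching_def graph_Gplus_iff)
  then show 2: "finite (M c)" using fin_consistent finite_subset by blast
  show "card (M c) > 0" using 1 2 by (simp add: card_gt_0_iff)
  show "card (M c) \<le> card X"
    using card_mono[OF fin_consistent(1) 1(1)] by (simp add: card_consistent)
qed

lemma mass_pos: "c \<in> C \<Longrightarrow> mass X M c > 0"
  using M_props(4)[of c] by (simp add: mass_def)

lemma learner_of_pos: "c \<in> C \<Longrightarrow> z \<in> consistent X c \<Longrightarrow> learner_of X M c z > 0"
  using mass_pos[of c] by (auto simp: learner_of_def)

lemma sum_learner_of:
  assumes "c \<in> C"
  shows "sum (learner_of X M c) (consistent X c) = 1"
proof -
  have "sum (learner_of X M c) (consistent X c) =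
      (\<Sum>z\<in>M c. real (heavy (card X)) / mass X M c) + (\<Sum>z\<in>consistent X c - M c. 1 / real (mass X M
        c))"
    unfolding sum.subset_diff[OF M_props(1)[OF assms] fin_consistent(1)] add.commute[of "sum _
      (consistent X c - M c)"]
    using M_props(1)[OF assms] by (intro arg_cong2[of _ _ _ _ "(+)"] sum.cong) (auto simp:
      learner_of_def)
  also have "\<dots> = (real (heavy (card X)) * card (M c) + real (card X - card (M c))) / mass X M c"
    using M_props[OF assms] fin_consistent
    by (simp add: card_Diff_subset card_consistent add_divide_distrib mult.commute)
  also have "\<dots> = 1"
  proof -
    have "real (heavy (card X)) * card (M c) + real (card X - card (M c)) = mass X M c"
      by (simp add: mass_def)
    then show ?thesis using mass_pos[OF assms] by simp
  qed
  finally show ?thesis .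
qed

lemma learner_of_learner: "MLE_learner X C (learner_of X M)"
  unfolding MLE_learner_def
proof (intro ballI conjI impI)
  fix c assume c: "c \<in> C"
  show "learner_of X M c z \<ge> 0" for z by (simp add: learner_of_def)
  show "learner_of X M c z = 0" if "\<not> sat c z" for z using that by (simp add: learner_of_def
    consistent_def)
  have "sum (learner_of X M c) (examples X) = sum (learner_of X M c) (consistent X c)"
    by (rule sum.mono_neutral_right) (auto simp: fin_consistent learner_of_def consistent_def)
  then show "sum (learner_of X M c) (examples X) = 1" using sum_learner_of[OF c] by simp
qed

text \<open>Every consistent example has positive likelihood, so the size limit on teaching sets is
  \<open>card X\<close>, which no set of consistent examples exceeds. This is one reason why the
  light examples get weight 1 and not 0.\<close>

lemma Nplus_learner_of: "Nplus X C (learner_of X M) = card X"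
proof -
  have "{z \<in> examples X. learner_of X M c z > 0} = consistent X c" if "c \<in> C" for c
    using learner_of_pos[OF that] by (auto simp: learner_of_def consistent_def split: if_splits)
  then have "(\<lambda>c. card {z \<in> examples X. learner_of X M c z > 0}) ` C = {card X}"
    using fin_class by (auto simp: card_consistent)
  then show ?thesis by (simp add: Nplus_def)
qed

text \<open>In \<open>draw_prob_uniform_ge\<close> the ratio of the outside mass to a single
  likelihood is \<open>(n - k) / heavy n\<close>, so the loss is
  \<open>k * (n - k) / heavy n\<close>; \<open>less_heavy\<close> is made for this.\<close>

lemma draw_prob_own:
  assumes "c \<in> C"
  shows "draw_prob (learner_of X M c) (M c) > 1 - (1 / card X) ^ card (M c)"
proof -
  define n k where "n = card X" and "k = card (M c)"
  note m = M_props[OF assms]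
  define a where "a = real (heavy n) / mass X M c"
  have tot: "real (mass X M c) > 0" using mass_pos[OF assms] by simp
  have a: "a > 0" using tot by (simp add: a_def)
  have "\<forall>z\<in>M c. learner_of X M c z = a" using m(1) by (auto simp: learner_of_def a_def n_def)
  moreover have ka: "1 - k * a = real (n - k) / mass X M c"
  proof -
    have "real (mass X M c) = real (n - k) + heavy n * k" by (simp add: mass_def n_def k_def)
    then show ?thesis using tot unfolding a_def by (simp add: field_simps)
  qed
  then have "k * a \<le> 1" using tot by (smt (verit) divide_nonneg_pos of_nat_0_le_iff)
  ultimately have "draw_prob (learner_of X M c) (M c) \<ge> 1 - k * ((1 - k * a) / a)"
    using draw_prob_uniform_ge[OF m(3) _ a] unfolding k_def by blast
  also have "(1 - k * a) / a = real (n - k) / heavy n"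
    unfolding ka unfolding a_def using tot by (simp add: divide_divide_eq_left)
  finally have le: "1 - real (k * (n - k)) / heavy n \<le> draw_prob (learner_of X M c) (M c)" by simp
  have n: "n > 0" "k \<le> n" using fin_class m by (auto simp: n_def k_def)
  have "real (k * (n - k)) * real (n ^ k) < heavy n"
    using less_heavy[OF n(2,1)] by (metis of_nat_less_iff of_nat_mult)
  then have "real (k * (n - k)) / heavy n < (1 / n) ^ k"
    using n by (simp add: field_simps power_one_over)
  then show ?thesis using le by (simp add: n_def k_def)
qed

lemma draw_prob_other:
  assumes c: "c \<in> C" "c0 \<in> C" "c \<noteq> c0"
  shows "draw_prob (learner_of X M c) (M c0) < draw_prob (learner_of X M c0) (M c0)"
proof -
  let ?q = "learner_of X M c" and ?Y = "consistent X c" and ?A = "M c0"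
  let ?k = "card (M c0)"
  note m = M_props[OF c(1)] and m0 = M_props[OF c(2)]
  have own: "draw_prob (learner_of X M c0) (M c0) > 1 - (1 / card X) ^ ?k"
    by (rule draw_prob_own[OF c(2)])
  have "(1 / real (card X)) ^ ?k \<le> 1" using fin_class by (intro power_le_one) auto
  show ?thesis
  proof (cases "?A \<subseteq> ?Y")
    case False
    then obtain z where "z \<in> ?A" "z \<notin> ?Y" by blast
    then have "z \<in> ?A" "?q z = 0" by (auto simp: learner_of_def)
    then have "draw_prob ?q ?A = 0" by (rule draw_prob_eq_0)
    then show ?thesis using own \<open>_ \<le> 1\<close> by linarith
  next
    case True
    have neq: "M c \<noteq> ?A" using M c by (auto simp: saturating_matching_def inj_on_def)
    \<comment> \<open>If \<open>M c0\<close> is not comparable with \<open>M c\<close>, any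
      comparable set of its size will do. Otherwise one element is exchanged: some \<open>x\<close>
      against a \<open>y\<close> from \<open>M c\<close> if \<open>M c0\<close> lies inside
      \<open>M c\<close>, and an \<open>x\<close> outside \<open>M c\<close> against a new
      \<open>y\<close> if \<open>M c0\<close> contains \<open>M c\<close>.\<close>
    have "\<exists>B\<subseteq>?Y. card B = ?k \<and> B \<noteq> ?A \<and> (B \<subseteq> M c \<or> M c \<subseteq> B)"
    proof (cases "?k \<le> card (M c)")
      case le: True
      show ?thesis
      proof (cases "?A \<subseteq> M c")
        case True
        then obtain y where y: "y \<in> M c" "y \<notin> ?A" using neq by blast
        obtain x where x: "x \<in> ?A" using m0 by blast
        have "card (insert y (?A - {x})) = ?k"
          using x y m0(3,4) by simp
        then show ?thesis
          using True m(1) y x by (intro exI[of _ "insert y (?A - {x})"]) auto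
      next
        case False
        obtain B where "B \<subseteq> M c" "card B = ?k" using obtain_subset_with_card_n[OF le] by blast
        then show ?thesis using False m(1) by (intro exI[of _ B]) auto
      qed
    next
      case gt: False
      show ?thesis
      proof (cases "M c \<subseteq> ?A")
        case sub: True
        then obtain x where x: "x \<in> ?A" "x \<notin> M c" using neq by blast
        \<comment> \<open>The exchange needs a spare consistent example. If there were none, then
          \<open>M c0\<close> would consist of all \<open>card X\<close> examples consistent with
          \<open>c\<close>, hence of all those consistent with \<open>c0\<close>, and the concepts
          would coincide.\<close>
        have "?A \<noteq> ?Y"
        proof
          assume "?A = ?Y"
          then have "consistent X c0 = ?Y"
            using m0(1) card_subset_eq[OF fin_consistent(1), of ?Y c0] by (simp add:
              card_consistent)
          moreover have "c \<subseteq> X" "c0 \<subseteq> X" using cls c by (auto simp: concept_class_def)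
          ultimately show False using consistent_inj c(3) by blast
        qed
        then obtain y where y: "y \<in> ?Y" "y \<notin> ?A" using True by blast
        have "card (insert y (?A - {x})) = ?k"
          using x y m0(3,4) by simp
        then show ?thesis
          using True sub y x by (intro exI[of _ "insert y (?A - {x})"]) auto
      next
        case False
        obtain B where "M c \<subseteq> B" "B \<subseteq> ?Y" "card B = ?k"
          using exists_subset_between[of "M c" ?k ?Y] gt m m0 fin_consistent
          by (auto simp: card_consistent)
        then show ?thesis using False by (intro exI[of _ B]) auto
      qed
    qed
    then obtain B where B: "B \<subseteq> ?Y" "card B = ?k" "B \<noteq> ?A" "B \<subseteq> M c \<or> M c \<subseteq> B" by blast
    have pos: "\<forall>y\<in>?Y. ?q y > 0" using learner_of_pos c(1) by blast
    have "\<forall>b\<in>B. \<forall>y\<in>?Y - B. ?q y \<le> ?q b"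
    proof (intro ballI)
      fix b y assume b: "b \<in> B" and y: "y \<in> ?Y - B"
      \<comment> \<open>Comparability of \<open>B\<close> with \<open>M c\<close> is what rules out
        a light \<open>b\<close> inside \<open>B\<close> next to a heavy \<open>y\<close>
        outside.\<close>
      have "b \<in> M c \<or> y \<notin> M c" using B(4) b y by blast
      moreover have "real (heavy (card X)) \<ge> 1" using heavy_pos[of "card X"] by linarith
      ultimately show "?q y \<le> ?q b"
        using b y B(1) by (auto simp: learner_of_def intro!: divide_right_mono)
    qed
    then have "draw_prob ?q B \<ge> (1 / card ?Y) ^ card B"
      using sum_learner_of[OF c(1)] pos B(1)
      by (intro draw_prob_ge_greedy) (auto simp: fin_consistent)
    moreover have "draw_prob ?q ?A + draw_prob ?q B \<le> 1"
      using True B pos sum_learner_of[OF c(1)]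
      by (intro draw_prob_add_le_1[of ?Y]) (auto simp: fin_consistent intro: less_imp_le)
    ultimately show ?thesis using own B(2) by (simp add: card_consistent)
  qed
qed

lemma learner_of_teacher: "MLE_teacher X C (learner_of X M) M"
  unfolding MLE_teacher_def Nplus_learner_of
  using M_props draw_prob_other by (auto simp: consistent_def)

end

text \<open>A set shared by two concepts would have to be strictly more likely under each than under
  the other. Strict superiority over a second concept makes the probability of \<open>T c0\<close>
  positive, hence all its elements consistent; the empty set has probability 1 under all concepts
  and cannot win.\<close>

lemma teacher_matching:
  assumes "concept_class X C" "MLE_learner X C L" "MLE_teacher X C L T"
  shows "saturating_matching C (graph_Gplus X C) T"
proof -
  have better: "draw_prob (L c) (T c0) < draw_prob (L c0) (T c0)" and T: "T c0 \<subseteq> examples X"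
    if "c0 \<in> C" "c \<in> C" "c \<noteq> c0" for c c0
    using assms(3) that by (auto simp: MLE_teacher_def)
  have fin: "finite (examples X)"
    using assms(1) by (auto simp: concept_class_def examples_def)
  have "inj_on T C"
  proof (rule inj_onI, rule ccontr)
    fix c c0 assume "c \<in> C" "c0 \<in> C" "T c = T c0" "c \<noteq> c0"
    then show False using better[of c c0] better[of c0 c] by auto
  qed
  moreover have "(c0, T c0) \<in> graph_Gplus X C" if c0: "c0 \<in> C" for c0
  proof -
    have "C \<noteq> {c0}" using assms(1) by (auto simp: concept_class_def)
    then obtain c where c: "c \<in> C" "c \<noteq> c0" using c0 by blast
    have sub: "T c0 \<subseteq> examples X" using T c c0 by blast
    have "draw_prob (L c) (T c0) \<ge> 0"
      using assms(2) c(1) sub fin by (intro draw_prob_nonneg[of "examples X"]) (auto simp: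
        MLE_learner_def)
    then have pos: "draw_prob (L c0) (T c0) > 0" using better[OF c0 c] by simp
    have "sat c0 z" if "z \<in> T c0" for z
      using draw_prob_eq_0[OF that, of "L c0"] assms(2) c0 that sub pos
      by (auto simp: MLE_learner_def)
    moreover have "T c0 \<noteq> {}"
      using better[OF c0 c] by (auto simp: draw_prob_def)
    ultimately show ?thesis using c0 sub by (auto simp: graph_Gplus_iff consistent_def)
  qed
  ultimately show ?thesis by (auto simp: saturating_matching_def)
qed

text \<open>The attainable orders agree, not just their minima: the same maps serve as matchings
  and, with suitable learners, as teachers.\<close>

lemma SMN_eq_MLE_TD:
  assumes "concept_class X C"
  shows "SMN C (graph_Gplus X C) = MLE_TD X C"
proof -
  have "(\<exists>M. saturating_matching C (graph_Gplus X C) M \<and> map_order C M = d) \<longleftrightarrow>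
      (\<exists>L T. MLE_learner X C L \<and> MLE_teacher X C L T \<and> map_order C T = d)" for d
    using learner_of_learner[OF assms] learner_of_teacher[OF assms] teacher_matching[OF assms] by
      blast
  then show ?thesis by (simp add: SMN_def MLE_TD_def)
qed

section \<open>Concepts and examples as values\<close>

definition selection :: "val list \<Rightarrow> val list \<Rightarrow> bool" where
  "selection r A \<longleftrightarrow> list_all2 (\<lambda>b v. v = Atom \<or> v = Pair b Atom) r A"

lemma sub_sound: "A \<in> set (sub r d k) \<Longrightarrow> selection r A \<and> nonatoms A \<le> d"
proof (induction r arbitrary: A)
  case Nil
  then show ?case by (simp add: selection_def)
next
  case (Cons b r)
  then obtain B where B: "B \<in> set (sub r d k)" "A = Atom # B \<or> A = Pair b Atom # B \<and> nonatoms B < d"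
    by (auto dest!: in_set_takeD)
  then show ?case using Cons.IH[OF B(1)] by (auto simp: selection_def)
qed

text \<open>A final list of fewer than \<open>k\<close> entries was not cut, and it is at least as
  long as the list of the previous level, so no level was cut and every small selection is
  present.\<close>

lemma sub_complete:
  assumes "length (sub r d k) < k" "selection r A" "nonatoms A \<le> d"
  shows "A \<in> set (sub r d k)"
  using assms
proof (induction r arbitrary: A)
  case Nil
  then show ?case by (simp add: selection_def)
next
  case (Cons b r)
  obtain v B where A: "A = v # B" "v = Atom \<or> v = Pair b Atom" "selection r B"
    using Cons.prems(2) by (auto simp: selection_def list_all2_Cons1)
  let ?l = "map ((#) Atom) (sub r d k) @
     map ((#) (Pair b Atom)) (filter (\<lambda>A. nonatoms A < d) (sub r d k))"
  have l: "length ?l < k" using Cons.prems(1) by (simp only: sub.simps length_take)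
  then have "length (sub r d k) < k" by simp
  then have "B \<in> set (sub r d k)" using Cons.IH A Cons.prems(3) by (auto split: if_splits)
  then have "A \<in> set ?l" using A Cons.prems(3) by auto
  moreover have "sub (b # r) d k = ?l" using l by (simp only: sub.simps take_all less_imp_le)
  ultimately show ?case by metis
qed

lemma distinct_sub: "distinct (sub r d k)"
proof (induction r)
  case Nil
  show ?case by simp
next
  case (Cons b r)
  then show ?case unfolding sub.simps by (intro distinct_take) (auto simp: distinct_map)
qed

lemma hd_sub: "k \<ge> 1 \<Longrightarrow> hd (sub r d k) = replicate (length r) Atom"
proof (induction r)
  case (Cons b r)
  then show ?case using sub_nonempty[of k r d]
    by (cases "sub r d k"; cases k) auto
qed simp

lemma inj_enc_list: "inj_on enc_list S"
  by (metis dec_enc_list inj_onI)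

lemma candidates_sound:
  assumes "k \<ge> 1" "A \<in> set (candidates k d (enc_list r))"
  obtains B where "A = enc_list B" "selection r B" "0 < nonatoms B" "nonatoms B \<le> d"
proof -
  obtain B0 l where l: "sub r d k = B0 # l" using sub_nonempty[OF assms(1)] by (cases "sub r d k")
    auto
  then obtain B where B: "A = enc_list B" "B \<in> set l" using assms(2) by (auto simp: candidates_def)
  have s: "selection r B" "nonatoms B \<le> d" using sub_sound[of B r d k] B l by auto
  have "B \<noteq> B0" using distinct_sub[of r d k] B l by auto
  moreover have "B0 = replicate (length r) Atom" using hd_sub[OF assms(1), of r d] l by simp
  moreover have "length B = length r" using s by (simp add: selection_def list_all2_lengthD)
  ultimately have "filter (\<lambda>v. v \<noteq> Atom) B \<noteq> []"
    using replicate_eqI[of B "length r" Atom] by (auto simp: filter_empty_conv)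
  then show ?thesis using that B(1) s by blast
qed

lemma candidates_complete:
  assumes "length (candidates (Suc k) d (enc_list r)) < k" "selection r B" "0 < nonatoms B"
    "nonatoms B \<le> d"
  shows "enc_list B \<in> set (candidates (Suc k) d (enc_list r))"
proof -
  obtain B0 l where l: "sub r d (Suc k) = B0 # l"
    using sub_nonempty[of "Suc k"] by (cases "sub r d (Suc k)") auto
  then have "B \<in> set (sub r d (Suc k))"
    using assms by (intro sub_complete) (auto simp: candidates_def)
  moreover have "B0 = replicate (length r) Atom" using hd_sub[of "Suc k" r d] l by simp
  then have "B \<noteq> B0" using assms(3) by auto
  ultimately show ?thesis using l by (auto simp: candidates_def)
qed

lemma distinct_candidates: "distinct (candidates k d c)"
  unfolding candidates_def using distinct_sub inj_enc_list by (intro distinct_tl) (auto simp: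
    distinct_map)

section \<open>Sets of consistent examples as lists of cells\<close>

definition row :: "'a list \<Rightarrow> 'a set \<Rightarrow> val list" where
  "row xs c = map (\<lambda>x. enc_bool (x \<in> c)) xs"

definition entry :: "('a \<times> bool) set \<Rightarrow> 'a \<Rightarrow> val" where
  "entry A x = (if (x, True) \<in> A then Pair (enc_bool True) Atom
     else if (x, False) \<in> A then Pair (enc_bool False) Atom else Atom)"

definition entries :: "'a list \<Rightarrow> ('a \<times> bool) set \<Rightarrow> val list" where
  "entries xs A = map (entry A) xs"

lemma enc_bool_inject [simp]: "enc_bool a = enc_bool b \<longleftrightarrow> a = b"
  by (cases a; cases b) auto

lemma entry_consistent:
  assumes "A \<subseteq> consistent X c"
  shows "entry A x = (if (x, x \<in> c) \<in> A then Pair (enc_bool (x \<in> c)) Atom else Atom)"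
  using assms by (cases "x \<in> c") (auto simp: entry_def consistent_eq)

text \<open>A cell stores the label and not just a mark, so the set can be read off without the
  concept. Equality of values thus means equality of sets also across concepts, as the injectivity
  of a matching demands.\<close>

lemma inj_entries:
  assumes "A \<subseteq> consistent (set xs) c" "B \<subseteq> consistent (set xs) c'" "entries xs A = entries xs B"
  shows "A = B"
proof -
  have e: "(x, b) \<in> S \<longleftrightarrow> entry S x = Pair (enc_bool b) Atom"
    if "S \<subseteq> consistent (set xs) c" for S c x b
    using that by (cases b; cases "x \<in> c") (auto simp: entry_def consistent_eq)
  have eq: "entry A x = entry B x" if "x \<in> set xs" for x
    using assms(3) that by (simp add: entries_def)
  show ?thesis
  proof (intro set_eqI iffI)
    fix z assume "z \<in> A"
    moreover obtain x b where "z = (x, b)" by fastforce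
    moreover have "x \<in> set xs" using calculation assms(1) by (auto simp: consistent_eq)
    ultimately show "z \<in> B" using e[OF assms(1)] e[OF assms(2)] eq by simp
  next
    fix z assume "z \<in> B"
    moreover obtain x b where "z = (x, b)" by fastforce
    moreover have "x \<in> set xs" using calculation assms(2) by (auto simp: consistent_eq)
    ultimately show "z \<in> A" using e[OF assms(1)] e[OF assms(2)] eq by simp
  qed
qed

text \<open>A consistent set contains at most one example per point, so its examples correspond to
  the occupied cells.\<close>

lemma nonatoms_entries:
  assumes "distinct xs" "A \<subseteq> consistent (set xs) c"
  shows "nonatoms (entries xs A) = card A"
proof -
  have "nonatoms (entries xs A) = length (filter (\<lambda>x. (x, x \<in> c) \<in> A) xs)"
    by (simp add: entries_def filter_map o_def entry_consistent[OF assms(2)] cong: if_cong)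
  also have "\<dots> = card ({x. (x, x \<in> c) \<in> A} \<inter> set xs)"
    using assms(1) by (rule distinct_length_filter)
  also have "\<dots> = card ((\<lambda>x. (x, x \<in> c)) ` ({x. (x, x \<in> c) \<in> A} \<inter> set xs))"
    by (rule card_image[symmetric]) (auto simp: inj_on_def)
  also have "(\<lambda>x. (x, x \<in> c)) ` ({x. (x, x \<in> c) \<in> A} \<inter> set xs) = A"
    using assms(2) by (auto simp: consistent_eq)
  finally show ?thesis .
qed

lemma atoms_entries:
  assumes "distinct xs" "A \<subseteq> consistent (set xs) c"
  shows "atoms (entries xs A) = card (set xs) - card A"
proof -
  have "atoms (entries xs A) + nonatoms (entries xs A) = length (entries xs A)"
    by (rule sum_length_filter_compl)
  then show ?thesis
    using nonatoms_entries[OF assms] distinct_card[OF assms(1)] by (simp add: entries_def)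
qed

lemma selection_rowE:
  assumes "distinct xs" "selection (row xs c) B"
  obtains A where "A \<subseteq> consistent (set xs) c" "B = entries xs A"
proof -
  have len: "length B = length xs" using assms(2) by (auto simp: selection_def row_def dest:
    list_all2_lengthD)
  define A where "A = {(x, b). \<exists>i<length xs. x = xs ! i \<and> b = (x \<in> c) \<and> B ! i \<noteq> Atom}"
  have sub: "A \<subseteq> consistent (set xs) c" by (auto simp: A_def consistent_eq)
  have "B ! i = entry A (xs ! i)" if i: "i < length xs" for i
  proof -
    have "B ! i = Atom \<or> B ! i = Pair (enc_bool (xs ! i \<in> c)) Atom"
      using assms(2) i unfolding selection_def row_def list_all2_conv_all_nth by simp
    moreover have "(xs ! i, xs ! i \<in> c) \<in> A \<longleftrightarrow> B ! i \<noteq> Atom"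
    proof -
      have "j = i" if "j < length xs" "xs ! i = xs ! j" for j
        using that i assms(1) nth_eq_iff_index_eq by metis
      then show ?thesis unfolding A_def using i by blast
    qed
    ultimately show ?thesis unfolding entry_consistent[OF sub] by metis
  qed
  then have "B = entries xs A" by (intro nth_equalityI) (simp_all add: entries_def len)
  then show ?thesis using that sub by blast
qed

lemma selection_entries:
  assumes "A \<subseteq> consistent (set xs) c"
  shows "selection (row xs c) (entries xs A)"
  unfolding selection_def row_def entries_def list_all2_conv_all_nth
  by (simp add: entry_consistent[OF assms])

lemma position_append: "y \<notin> set zs \<Longrightarrow> position (zs @ y # ys) y = length zs"
  unfolding position_def by (subst takeWhile_append2) auto

lemma map_position: "distinct xs \<Longrightarrow> map (position xs) xs = [0..<length xs]"
proof (rule nth_equalityI)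
  fix i assume d: "distinct xs" and "i < length (map (position xs) xs)"
  then have i: "i < length xs" by simp
  have xs: "xs = take i xs @ xs ! i # drop (Suc i) xs" using i by (rule id_take_nth_drop)
  have "distinct (take i xs @ xs ! i # drop (Suc i) xs)" using d xs by metis
  then have "xs ! i \<notin> set (take i xs)" by simp
  then have "position (take i xs @ xs ! i # drop (Suc i) xs) (xs ! i) = i"
    using position_append[of "xs ! i" "take i xs"] i by simp
  then have "position xs (xs ! i) = i" using xs by metis
  then show "map (position xs) xs ! i = [0..<length xs] ! i" using i by simp
qed simp

lemma enumerate_map:
  assumes "distinct xs"
  shows "List.enumerate 0 (map f xs) = map (\<lambda>x. (position xs x, f x)) xs"
proof -
  have "zip (map g xs) (map f xs) = map (\<lambda>x. (g x, f x)) xs" for g :: "'a \<Rightarrow> nat"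
    by (induction xs) auto
  from this[of "position xs"] show ?thesis
    unfolding map_position[OF assms] by (simp add: enumerate_eq_zip)
qed

lemma length_row_entries: "length (row xs c) = length xs" "length (entries xs A) = length xs"
  by (simp_all add: row_def entries_def)

lemma inj_row:
  assumes "c \<subseteq> set xs" "c' \<subseteq> set xs" "row xs c = row xs c'"
  shows "c = c'"
proof -
  have "\<forall>x\<in>set xs. x \<in> c \<longleftrightarrow> x \<in> c'" using assms(3) by (simp add: row_def)
  then show ?thesis using assms(1,2) by blast
qed

lemma enc_input_eq: "enc_input xs cs = enc_list (map (\<lambda>c. enc_list (row xs c)) cs)"
  by (simp add: enc_input_def row_def)

lemma size_row: "size (enc_list (row xs c)) \<le> 2 * length xs"
proof -
  have "size (enc_bool b) \<le> 1" for b by (cases b) auto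
  then have "(\<Sum>x\<leftarrow>xs. size (enc_bool (x \<in> c))) \<le> (\<Sum>x\<leftarrow>xs. 1)" by (intro sum_list_mono) simp
  then show ?thesis by (simp add: size_enc_list row_def o_def sum_list_triv)
qed

section \<open>The algorithm applied to a listed concept class\<close>

locale listing =
  fixes X :: "'a set" and C :: "'a set set" and xs :: "'a list" and cs :: "'a set list"
  assumes cls: "concept_class X C" and xs: "distinct xs" "set xs = X" and cs: "distinct cs" "set
    cs = C"
begin

lemma length_xs: "length xs = card X" and length_cs: "length cs = card C"
  using distinct_card[OF xs(1)] distinct_card[OF cs(1)] xs(2) cs(2) by simp_all

lemmas fin = finite_class[OF cls]

lemma subset_X: "c \<in> C \<Longrightarrow> c \<subseteq> X"
  using cls unfolding concept_class_def by blast

definition code :: "'a set \<Rightarrow> val" where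
  "code c = enc_list (row xs c)"

lemma inj_code: "inj_on code C"
proof (rule inj_onI)
  fix c c' assume c: "c \<in> C" "c' \<in> C" and eq: "code c = code c'"
  have "row xs c = row xs c'" using arg_cong[OF eq, of dec_list] by (simp add: code_def)
  then show "c = c'"
    by (intro inj_row[of c xs c']) (simp_all add: subset_X c xs(2))
qed

definition code_set :: "('a \<times> bool) set \<Rightarrow> val" where
  "code_set A = enc_list (entries xs A)"

definition admissible :: "nat \<Rightarrow> 'a set \<Rightarrow> ('a \<times> bool) set \<Rightarrow> bool" where
  "admissible d c A \<longleftrightarrow> A \<subseteq> consistent X c \<and> A \<noteq> {} \<and> card A \<le> d"

lemma nonatoms_code:
  assumes "A \<subseteq> consistent X c"
  shows "nonatoms (entries xs A) = card A" "nonatoms (entries xs A) > 0 \<longleftrightarrow> A \<noteq> {}"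
proof -
  show "nonatoms (entries xs A) = card A"
    using nonatoms_entries[of xs A c] xs assms by simp
  moreover have "finite A" by (rule finite_subset[OF assms finite_consistent(1)[OF cls]])
  ultimately show "nonatoms (entries xs A) > 0 \<longleftrightarrow> A \<noteq> {}" by (simp add: card_gt_0_iff)
qed

text \<open>\<open>solve\<close> works on values, so the edge relation is transported along
  \<open>code\<close> and \<open>code_set\<close>.\<close>

definition edge :: "nat \<Rightarrow> val \<Rightarrow> val \<Rightarrow> bool" where
  "edge d v w \<longleftrightarrow> (\<exists>c\<in>C. \<exists>A. v = code c \<and> w = code_set A \<and> admissible d c A)"

abbreviation neighbours :: "nat \<Rightarrow> val \<Rightarrow> val list" where
  "neighbours \<equiv> candidates (Suc (card C))"

lemma neighbours_sound:
  assumes "c \<in> C" "w \<in> set (neighbours d (code c))"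
  shows "edge d (code c) w"
proof -
  obtain B where B: "w = enc_list B" "selection (row xs c) B" "0 < nonatoms B" "nonatoms B \<le> d"
    by (rule candidates_sound[of "Suc (card C)" w d "row xs c"]) (use assms(2) in \<open>auto simp:
      code_def\<close>)
  obtain A where A: "A \<subseteq> consistent X c" "B = entries xs A"
    by (rule selection_rowE[OF xs(1) B(2)]) (simp add: xs(2))
  then have "admissible d c A" using B nonatoms_code[OF A(1)] by (simp add: admissible_def)
  moreover have "w = code_set A" using A(2) B(1) by (simp add: code_set_def)
  ultimately show ?thesis unfolding edge_def using assms(1) by blast
qed

lemma neighbours_complete:
  assumes "length (neighbours d (code c)) < card C" "admissible d c A"
  shows "code_set A \<in> set (neighbours d (code c))"
proof -
  have "A \<subseteq> consistent (set xs) c" using assms(2) xs by (simp add: admissible_def)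
  then have "selection (row xs c) (entries xs A)" by (rule selection_entries)
  moreover have "0 < nonatoms (entries xs A)" "nonatoms (entries xs A) \<le> d"
    using assms(2) nonatoms_code[of A c] by (simp_all add: admissible_def)
  ultimately show ?thesis
    using candidates_complete[of "card C" d "row xs c"] assms(1) by (simp add: code_def
      code_set_def)
qed

lemma map_order_le_iff: "map_order C M \<le> d \<longleftrightarrow> (\<forall>c\<in>C. card (M c) \<le> d)"
  using fin by (simp add: map_order_def)

text \<open>Taking all consistent examples shows that \<open>opt\<close> is attained and is at most
  \<open>card X\<close>, which makes a row sufficient fuel for \<open>grow\<close>.\<close>

lemma full_matching:
  "saturating_matching C (graph_Gplus X C) (consistent X)" "map_order C (consistent X) \<le> card X"
proof -
  have "consistent X c \<noteq> {}" for c
    using card_consistent[of X c] fin(4) by auto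
  moreover have "inj_on (consistent X) C"
    by (intro inj_onI consistent_inj[of _ X]) (simp_all add: subset_X)
  ultimately show "saturating_matching C (graph_Gplus X C) (consistent X)"
    by (auto simp: saturating_matching_def graph_Gplus_iff)
  show "map_order C (consistent X) \<le> card X" by (simp add: map_order_le_iff card_consistent)
qed

abbreviation "opt \<equiv> SMN C (graph_Gplus X C)"

lemma opt_le:
  assumes "saturating_matching C (graph_Gplus X C) M"
  shows "opt \<le> map_order C M"
  unfolding SMN_def using assms by (intro Least_le) auto

lemma opt_attained: "\<exists>M. saturating_matching C (graph_Gplus X C) M \<and> map_order C M = opt"
  unfolding SMN_def by (rule LeastI_ex) (use full_matching in blast)

lemma opt_bounds: "1 \<le> opt" "opt \<le> card X"
proof -
  obtain M where M: "saturating_matching C (graph_Gplus X C) M" "map_order C M = opt"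
    using opt_attained by blast
  obtain c where c: "c \<in> C" using fin by blast
  then have "card (M c) \<le> opt" using M(2) map_order_le_iff[of M opt] by simp
  then show "1 \<le> opt" using M_props(4)[OF cls M(1) c] by simp
  show "opt \<le> card X" using opt_le[OF full_matching(1)] full_matching(2) by simp
qed

text \<open>A single list of at least \<open>card C\<close> neighbours already supplies enough
  elements for \<open>V\<close>. If all lists for \<open>V\<close> are shorter, nothing was cut from
  them, and an optimal matching maps \<open>V\<close> injectively into their union.\<close>

lemma hall:
  assumes "d \<ge> opt" "V \<subseteq> code ` C" "V \<noteq> {}"
  shows "card V \<le> card (\<Union>v\<in>V. set (neighbours d v))"
proof (cases "\<exists>v\<in>V. length (neighbours d v) \<ge> card C")
  case True
  then obtain v where v: "v \<in> V" "length (neighbours d v) \<ge> card C" by blast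
  have V: "finite V" using assms(2) fin(2) finite_surj by blast
  have "card V \<le> card (code ` C)" using assms(2) fin by (intro card_mono) auto
  also have "\<dots> \<le> card C" using fin by (intro card_image_le)
  also have "\<dots> \<le> card (set (neighbours d v))"
    using v(2) distinct_candidates by (simp add: distinct_card)
  also have "\<dots> \<le> card (\<Union>v\<in>V. set (neighbours d v))"
    using V v(1) by (intro card_mono) auto
  finally show ?thesis .
next
  case False
  obtain M where M: "saturating_matching C (graph_Gplus X C) M" "map_order C M = opt"
    using opt_attained by blast
  obtain D where D: "D \<subseteq> C" "V = code ` D" using assms(2) subset_image_iff[of V code C] by blast
  have adm: "admissible d c (M c)" if "c \<in> C" for c
  proof -
    have "card (M c) \<le> opt" using map_order_le_iff[of M opt] M(2) that by simp
    then show ?thesis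
      using M_props(1,2)[OF cls M(1) that] assms(1) by (simp add: admissible_def)
  qed
  have "inj_on (code_set \<circ> M) D"
  proof (rule inj_onI)
    fix c c' assume c: "c \<in> D" "c' \<in> D" "(code_set \<circ> M) c = (code_set \<circ> M) c'"
    have "entries xs (M c) = entries xs (M c')"
      using arg_cong[OF c(3), of dec_list] by (simp add: code_set_def)
    moreover have CC: "c \<in> C" "c' \<in> C" using c(1,2) D(1) by blast+
    then have "M c \<subseteq> consistent (set xs) c" "M c' \<subseteq> consistent (set xs) c'"
      using adm xs(2) by (simp_all add: admissible_def)
    ultimately have "M c = M c'" by (intro inj_entries[of _ xs c _ c'])
    then show "c = c'" using M(1) CC unfolding saturating_matching_def by (blast dest: inj_onD)
  qed
  then have "card D = card ((code_set \<circ> M) ` D)" by (rule card_image[symmetric])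
  also have "\<dots> \<le> card (\<Union>v\<in>V. set (neighbours d v))"
  proof (rule card_mono)
    have "finite V" using assms(2) fin(2) finite_surj by blast
    then show "finite (\<Union>v\<in>V. set (neighbours d v))" by simp
    show "(code_set \<circ> M) ` D \<subseteq> (\<Union>v\<in>V. set (neighbours d v))"
    proof
      fix w assume "w \<in> (code_set \<circ> M) ` D"
      then obtain c where c: "c \<in> D" "w = code_set (M c)" by auto
      have "length (neighbours d (code c)) < card C" using False c(1) D(2) by (auto simp: not_le)
      then have "w \<in> set (neighbours d (code c))"
        unfolding c(2) by (rule neighbours_complete) (use adm c(1) D(1) in blast)
      then show "w \<in> (\<Union>v\<in>V. set (neighbours d v))" using c(1) D(2) by blast
    qed
  qed
  finally have "card D \<le> card (\<Union>v\<in>V. set (neighbours d v))" .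
  moreover have "card V = card D"
    unfolding D(2) using inj_code D(1) by (intro card_image) (rule inj_on_subset)
  ultimately show ?thesis by simp
qed

lemma run_solve_correct:
  obtains W T where "run_solve (length xs) (map code cs) = (opt, W)"
    "saturating_matching C (graph_Gplus X C) T" "map_order C T = opt"
    "\<And>c. c \<in> C \<Longrightarrow> map_of W (code c) = Some (code_set (T c))"
proof -
  obtain d W where r: "run_solve (length xs) (map code cs) = (d, W)" by fastforce
  interpret solving neighbours edge "code ` C" "Suc (card C)" opt
  proof
    show "finite (code ` C)" using fin by simp
    show "card (code ` C) \<le> Suc (card C)" using card_image_le[OF fin(2), of code] by simp
    show "edge d v w" if "v \<in> code ` C" "w \<in> set (neighbours d v)" for v w d
      using that neighbours_sound by auto
    show "edge (Suc d) v w" if "edge d v w" for d v w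
      using that by (auto simp: edge_def admissible_def intro: le_SucI)
    show "card V \<le> card (\<Union>x\<in>V. set (neighbours d x))" if "opt \<le> d" "V \<subseteq> code ` C" "V \<noteq> {}" for d V
      using hall that by blast
  qed
  have "partial_matching edge 1 {} []" by (simp add: partial_matching_def)
  then have dW: "d \<le> opt" "partial_matching edge d (code ` C) W"
  proof -
    have "solve neighbours (Suc (card C)) (length xs) (map code cs) 1 [] = (d, W)"
      using r by (simp add: run_solve_def length_cs)
    moreover have "distinct (map code cs)" using cs inj_code by (simp add: distinct_map)
    ultimately have "d \<le> opt \<and> partial_matching edge d (code ` C) W"
      using opt_bounds cs(2) \<open>partial_matching edge 1 {} []\<close>
      by (intro solve_correct[of 1 "{}" "[]" "map code cs" "length xs"]) (simp_all add: length_xs)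
    then show "d \<le> opt" "partial_matching edge d (code ` C) W" by simp_all
  qed
  have fstW: "distinct (map fst W)" "distinct (map snd W)" "fst ` set W = code ` C"
    "\<And>v w. (v, w) \<in> set W \<Longrightarrow> edge d v w"
    using dW(2) by (auto simp: partial_matching_def)
  have "\<exists>A. (code c, code_set A) \<in> set W \<and> admissible d c A" if c: "c \<in> C" for c
  proof -
    have "code c \<in> fst ` set W" using fstW(3) c by simp
    then obtain w where w: "(code c, w) \<in> set W" by auto
    then obtain c' A where "c' \<in> C" "code c = code c'" "w = code_set A" "admissible d c' A"
      using fstW(4) unfolding edge_def by blast
    then show ?thesis using inj_onD[OF inj_code] c w by blast
  qed
  then obtain T where T: "\<And>c. c \<in> C \<Longrightarrow> (code c, code_set (T c)) \<in> set W \<and> admissible d c (T c)"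
    by metis
  have "inj_on T C"
  proof (rule inj_onI)
    fix c c' assume c: "c \<in> C" "c' \<in> C" "T c = T c'"
    have "inj_on snd (set W)" using fstW(2) by (simp add: distinct_map)
    then have "(code c, code_set (T c)) = (code c', code_set (T c'))"
      using T[OF c(1)] T[OF c(2)] c(3) by (intro inj_onD[of snd "set W"]) simp_all
    then show "c = c'" using inj_onD[OF inj_code] c by simp
  qed
  then have sat: "saturating_matching C (graph_Gplus X C) T"
    using T by (auto simp: saturating_matching_def graph_Gplus_iff admissible_def)
  \<comment> \<open>The sets have at most \<open>d\<close> elements and \<open>d\<close> is at most
    \<open>opt\<close>; minimality of \<open>opt\<close> forces equality.\<close>
  have "map_order C T \<le> d" using T by (simp add: map_order_le_iff admissible_def)
  then have "d = opt" "map_order C T = opt" using opt_le[OF sat] dW(1) by simp_all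
  moreover have "map_of W (code c) = Some (code_set (T c))" if "c \<in> C" for c
    using T[OF that] fstW(1) by simp
  ultimately show ?thesis using that r sat by blast
qed

end

section \<open>Polynomial bounds\<close>

definition poly_bounded :: "(nat \<Rightarrow> nat \<Rightarrow> nat) \<Rightarrow> bool" where
  "poly_bounded F \<longleftrightarrow> (\<exists>p :: nat poly. \<forall>m n. F m n \<le> poly p (m + n))"

lemma poly_bounded_const: "poly_bounded (\<lambda>m n. c)"
  unfolding poly_bounded_def by (rule exI[of _ "[:c:]"]) simp

lemma poly_bounded_fst: "poly_bounded (\<lambda>m n. m)"
  and poly_bounded_snd: "poly_bounded (\<lambda>m n. n)"
  unfolding poly_bounded_def by (rule exI[of _ "[:0, 1:]"]; simp)+

lemma poly_bounded_add:
  assumes "poly_bounded F" "poly_bounded G"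
  shows "poly_bounded (\<lambda>m n. F m n + G m n)"
proof -
  obtain p r where "\<forall>m n. F m n \<le> poly p (m + n)" "\<forall>m n. G m n \<le> poly r (m + n)"
    using assms by (auto simp: poly_bounded_def)
  then show ?thesis unfolding poly_bounded_def by (intro exI[of _ "p + r"]) (auto intro: add_mono)
qed

lemma poly_bounded_mult:
  assumes "poly_bounded F" "poly_bounded G"
  shows "poly_bounded (\<lambda>m n. F m n * G m n)"
proof -
  obtain p r where "\<forall>m n. F m n \<le> poly p (m + n)" "\<forall>m n. G m n \<le> poly r (m + n)"
    using assms by (auto simp: poly_bounded_def)
  then show ?thesis unfolding poly_bounded_def by (intro exI[of _ "p * r"]) (auto intro:
    mult_le_mono)
qed

lemma computable_in_polytimeI:
  assumes "poly_bounded F" "poly_bounded G"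
    and "\<And>X C xs cs. listing X C xs cs \<Longrightarrow>
      \<exists>v. computes (prog e) 0 [enc_input xs cs] v (F (card C) (card X)) \<and>
        size v \<le> G (card C) (card X) \<and> out X C xs cs v"
  shows "computable_in_polytime out"
proof -
  have "poly_bounded (\<lambda>m n. F m n + 3 + G m n)" by (intro poly_bounded_add poly_bounded_const assms)
  then obtain p where p: "F m n + 3 + G m n \<le> poly p (m + n)" for m n
    unfolding poly_bounded_def by blast
  have "\<exists>v t. runs (prog e) (enc_input xs cs) v t \<and> t \<le> poly p (card C + card X) \<and> out X C xs cs v"
    if "concept_class X C \<and> distinct xs \<and> set xs = X \<and> distinct cs \<and> set cs = C" for X C xs cs
  proof -
    have "listing X C xs cs" using that by unfold_locales auto
    then obtain v where v: "computes (prog e) 0 [enc_input xs cs] v (F (card C) (card X))"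
      "size v \<le> G (card C) (card X)" "out X C xs cs v" using assms(3) by blast
    let ?t = "cost (prog e) [enc_input xs cs] (Call 0 [Var 0]) + size v"
    have "runs (prog e) (enc_input xs cs) v ?t" "?t \<le> poly p (card C + card X)"
      using runs_if_computes[OF v(1)] p[of "card C" "card X"] v(2) by linarith+
    then show ?thesis using v(3) by blast
  qed
  then show ?thesis unfolding computable_in_polytime_def by blast
qed

section \<open>Sizes and representations of the outputs\<close>

lemma size_enc_list_le:
  "(\<And>v. v \<in> set vs \<Longrightarrow> size v \<le> B) \<Longrightarrow> size (enc_list vs) \<le> length vs * (B + 1)"
proof (induction vs)
  case (Cons v vs)
  then have "size (enc_list vs) \<le> length vs * (B + 1)" "size v \<le> B" by auto
  then show ?case by simp
qed simp

lemma size_enc_bool: "size (enc_bool b) \<le> 1"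
  by (cases b) auto

text \<open>Each digit takes one list cell and at most one more pair for itself.\<close>

lemma size_enc_nat_less: "a < 2 ^ l \<Longrightarrow> size (enc_nat a) \<le> 2 * l"
proof (induction l arbitrary: a)
  case (Suc l)
  show ?case
  proof (cases "a = 0")
    case False
    have "size (enc_nat (a div 2)) \<le> 2 * l" using Suc by (intro Suc.IH) auto
    then show ?thesis using False size_enc_bool[of "odd a"] by (simp add: enc_nat_pos)
  qed simp
qed simp

lemma size_enc_nat: "size (enc_nat a) \<le> 2 * a"
  by (rule size_enc_nat_less) (rule less_exp)

lemma position_le: "position ys y \<le> length ys"
  unfolding position_def by (rule length_takeWhile_le)

lemma size_enc_example: "size (enc_example xs z) \<le> 2 * length xs + 2"
proof -
  obtain x b where z: "z = (x, b)" by fastforce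
  show ?thesis
    using size_enc_nat[of "position xs x"] position_le[of xs x] size_enc_bool[of b] by (simp add: z)
qed

text \<open>The prefix \<open>zs\<close> is carried along because the names of points are positions
  in the full list.\<close>

lemma exs_entries:
  assumes "distinct (zs @ ys)" "A \<subseteq> consistent X c"
  shows "exs (length zs) (entries ys A) =
    map (enc_example (zs @ ys)) (map (\<lambda>y. (y, y \<in> c)) (filter (\<lambda>y. (y, y \<in> c) \<in> A) ys))"
  using assms(1)
proof (induction ys arbitrary: zs)
  case Nil
  then show ?case by (simp add: entries_def)
next
  case (Cons y ys)
  have "position (zs @ y # ys) y = length zs" using Cons.prems by (intro position_append) simp
  then show ?case
    using Cons.IH[of "zs @ [y]"] Cons.prems
    by (simp add: entries_def entry_consistent[OF assms(2), of y])
qed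

lemma repr_set_exs:
  assumes "distinct xs" "A \<subseteq> consistent (set xs) c"
  shows "repr_set (enc_example xs) A (enc_list (exs 0 (entries xs A)))"
    and "size (enc_list (exs 0 (entries xs A))) \<le> length xs * (2 * length xs + 3)"
proof -
  let ?l = "map (\<lambda>y. (y, y \<in> c)) (filter (\<lambda>y. (y, y \<in> c) \<in> A) xs)"
  have e: "exs 0 (entries xs A) = map (enc_example xs) ?l"
    using exs_entries[of "[]" xs A "set xs" c] assms by simp
  have "distinct ?l" using assms(1) by (auto simp: distinct_map inj_on_def)
  moreover have "set ?l = A" using assms(2) by (auto simp: consistent_eq)
  ultimately show "repr_set (enc_example xs) A (enc_list (exs 0 (entries xs A)))"
    unfolding repr_set_def e by blast
  have "size (enc_list (map (enc_example xs) ?l)) \<le> length ?l * (2 * length xs + 2 + 1)"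
    using size_enc_example[of xs] by (intro order_trans[OF size_enc_list_le[of _ "2 * length xs +
      2"]]) auto
  also have "\<dots> \<le> length xs * (2 * length xs + 3)" by (intro mult_le_mono) auto
  finally show "size (enc_list (exs 0 (entries xs A))) \<le> length xs * (2 * length xs + 3)"
    unfolding e .
qed

lemma repr_map_map:
  "(\<And>d. d \<in> set ds \<Longrightarrow> R (f d) (g d)) \<Longrightarrow> repr_map ds R f (enc_list (map g ds))"
  unfolding repr_map_def by (intro exI[of _ "map g ds"]) (auto simp: list_all2_map2 list_all2_same)

lemma lrow_list_all2:
  assumes "A \<subseteq> consistent X c"
    and "\<And>x. x \<in> set ys \<Longrightarrow> P (x, x \<in> c) (if (x, x \<in> c) \<in> A then w1 else w0)"
    and "\<And>x. x \<in> set ys \<Longrightarrow> P (x, x \<notin> c) (Pair (enc_nat 0) (enc_nat (Suc 0)))"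
  shows "list_all2 P (List.product ys [False, True]) (lrow (row ys c) (entries ys A) w1 w0)"
  using assms(2,3)
proof (induction ys)
  case Nil
  then show ?case by (simp add: row_def entries_def)
next
  case (Cons y ys)
  have IH: "list_all2 P (List.product ys [False, True]) (lrow (row ys c) (entries ys A) w1 w0)"
    using Cons by simp
  show ?case
    using IH Cons.prems(1)[of y] Cons.prems(2)[of y]
    by (cases "y \<in> c"; cases "(y, y \<in> c) \<in> A")
      (simp_all add: row_def entries_def entry_consistent[OF assms(1)])
qed

lemma length_lrow: "length (lrow r A w1 w0) \<le> 2 * length r"
  by (induction r A w1 w0 rule: lrow.induct) (auto simp: Let_def)

lemma set_lrow: "set (lrow r A w1 w0) \<subseteq> {w1, w0, Pair (enc_nat 0) (enc_nat (Suc 0))}"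
  by (induction r A w1 w0 rule: lrow.induct) (auto simp: Let_def split: if_splits)

definition weights_size :: "nat \<Rightarrow> nat \<Rightarrow> nat" where
  "weights_size e n = 2 * n * (4 * e + 2 * n + 4)"

text \<open>The common denominator is at most \<open>2 ^ e * n\<close>, below
  \<open>2 ^ (e + n)\<close>, so it has at most \<open>e + n\<close> digits: the weights are
  exponential, their encodings are not.\<close>

lemma size_weights:
  assumes "length r = n" "length A = n" "n > 0"
  shows "size (enc_list (weights e r A)) \<le> weights_size e n"
proof -
  let ?s = "atoms A + 2 ^ e * nonatoms A"
  have "atoms A + nonatoms A = n" using sum_length_filter_compl[of "\<lambda>v. v = Atom" A] assms(2) by
    simp
  moreover have "?s \<le> 2 ^ e * atoms A + 2 ^ e * nonatoms A" by simp
  ultimately have "?s \<le> 2 ^ e * n" by (metis distrib_left)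
  also have "\<dots> < 2 ^ (e + n)" by (simp add: power_add less_exp)
  finally have s: "size (enc_nat ?s) \<le> 2 * (e + n)" by (rule size_enc_nat_less)
  have e: "size (enc_nat (2 ^ e)) \<le> 2 * (e + 1)" by (rule size_enc_nat_less) simp
  have "size v \<le> 4 * e + 2 * n + 3" if "v \<in> set (weights e r A)" for v
  proof -
    have "v \<in> {Pair (enc_nat (2 ^ e)) (enc_nat ?s), Pair (enc_nat (Suc 0)) (enc_nat ?s),
        Pair (enc_nat 0) (enc_nat (Suc 0))}"
      using that set_lrow unfolding weights_def Let_def by blast
    then show ?thesis using s e by (auto simp: enc_nat_1)
  qed
  then have "size (enc_list (weights e r A)) \<le> length (weights e r A) * (4 * e + 2 * n + 3 + 1)"
    by (rule size_enc_list_le)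
  also have "\<dots> \<le> weights_size e n"
    unfolding weights_size_def weights_def Let_def
    using length_lrow[of r A] assms(1) by (intro mult_le_mono) auto
  finally show ?thesis .
qed

text \<open>The encoded row of a concept has size at most \<open>2 * n\<close>: per point, one list
  cell and at most one pair for the bit.\<close>

definition run_time :: "nat \<Rightarrow> nat \<Rightarrow> nat" where
  "run_time m n = solve_time m (2 * n)"

definition graph_time :: "nat \<Rightarrow> nat \<Rightarrow> nat" where
  "graph_time m n = (m + 1) * (30 * m + 80) + (n + 1) * (30 * n + 80) +
     (m + 1) * (30 * m + (n + 1) * (30 * n + 80) + 80) + 60"

definition graph_size :: "nat \<Rightarrow> nat \<Rightarrow> nat" where
  "graph_size m n = m * (2 * m + 1) + n * 2 * (2 * n + 3) + m * n * (2 * m + 2 * n + 4) + 3"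

definition smn_time :: "nat \<Rightarrow> nat \<Rightarrow> nat" where
  "smn_time m n = run_time m n + (n + 1) * (30 * n + 60) + 30"

definition match_time :: "nat \<Rightarrow> nat \<Rightarrow> nat" where
  "match_time m n = run_time m n + outm_time m (2 * n) + 30"

definition match_size :: "nat \<Rightarrow> nat \<Rightarrow> nat" where
  "match_size m n = m * (n * (2 * n + 3) + 1)"

definition learn_time :: "nat \<Rightarrow> nat \<Rightarrow> nat" where
  "learn_time m n = run_time m n + learner_time m (2 * n) + outm_time m (2 * n) + 40"

definition learn_size :: "nat \<Rightarrow> nat \<Rightarrow> nat" where
  "learn_size m n = m * (weights_size (n * (n + 2)) n + 1) + match_size m n + 1"

lemmas time_defs = graph_time_def graph_size_def smn_time_def match_time_def match_size_def
  learn_time_def learn_size_def run_time_def solve_time_def grow_time_def search_time_def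
    subs_time_def
  scan_time_def outm_time_def learner_time_def weights_size_def

section \<open>Correctness and cost of the main programs\<close>

context listing
begin

lemma input: "enc_input xs cs = enc_list (map code cs)"
  by (simp add: enc_input_eq code_def[abs_def])

lemma dec_code [simp]: "dec_list (code c) = row xs c"
  by (simp add: code_def)

lemma code_bounds: "\<forall>v\<in>set (map code cs). size v \<le> 2 * card X \<and> length (dec_list v) = length xs"
  using size_row[of xs] length_xs by (auto simp: code_def length_row_entries)

lemma run_computes:
  assumes "run_solve (length xs) (map code cs) = (opt, W)"
  shows "computes (prog E) run_ix [enc_list (map code cs)] (Pair (unary opt) (enc_pairs W))
    (run_time (card C) (card X))"
    and "bounded (2 * card X) (card C) W"
  using run_ok[OF _ code_bounds assms] length_xs length_cs by (simp_all add: run_time_def)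

lemma smn_main:
  "computes (prog smn_main) 0 [enc_input xs cs] (enc_nat opt) (smn_time (card C) (card X))"
proof -
  obtain W T where W: "run_solve (length xs) (map code cs) = (opt, W)" by (rule run_solve_correct)
  have "(opt + 1) * (30 * opt + 60) \<le> (card X + 1) * (30 * card X + 60)"
    using opt_bounds(2) by (intro mult_le_mono) auto
  then have t: "computes (prog smn_main) tobin_ix [unary opt] (enc_nat opt) ((card X + 1) * (30 *
    card X + 60))"
    using computes_mono[OF tobin_ok[of smn_main "replicate opt Atom"]] by simp
  show ?thesis
    unfolding input
    using computesD[OF run_computes(1)[OF W, of smn_main]] computesD[OF t]
    by - (rule computesI[OF prog_nth(1)]; simp add: smn_main_def smn_time_def)
qed

lemma out_sets_eq:
  assumes "\<And>c. c \<in> C \<Longrightarrow> map_of W (code c) = Some (code_set (T c))"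
  shows "out_sets (map code cs) W = map (\<lambda>c. enc_list (exs 0 (entries xs (T c)))) cs"
  using assms cs(2) by (simp add: out_sets_def code_set_def)

lemma outm_computes:
  assumes W: "run_solve (length xs) (map code cs) = (opt, W)"
    and "\<And>c. c \<in> C \<Longrightarrow> map_of W (code c) = Some (code_set (T c))"
  shows "computes (prog E) outm_ix [enc_list (map code cs), enc_pairs W]
    (enc_list (map (\<lambda>c. enc_list (exs 0 (entries xs (T c)))) cs)) (outm_time (card C) (2 * card X))"
proof -
  have "\<forall>c\<in>set (map code cs). size c \<le> 2 * card X \<and>
      (\<exists>A. map_of W c = Some (enc_list A) \<and> length A \<le> 2 * card X)"
    using code_bounds assms(2) cs(2) length_xs by (auto simp: code_set_def length_row_entries)
  then show ?thesis
    using outm_ok[OF run_computes(2)[OF W], of "map code cs" E] length_cs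
    by (simp add: out_sets_eq[OF assms(2)])
qed

lemma repr_sets:
  assumes "saturating_matching C (graph_Gplus X C) T"
  shows "repr_set_map xs cs T (enc_list (map (\<lambda>c. enc_list (exs 0 (entries xs (T c)))) cs))"
    and "size (enc_list (map (\<lambda>c. enc_list (exs 0 (entries xs (T c)))) cs)) \<le>
      match_size (card C) (card X)"
proof -
  have T: "T c \<subseteq> consistent (set xs) c" if "c \<in> set cs" for c
    using M_props(1)[OF cls assms] that cs xs by simp
  show "repr_set_map xs cs T (enc_list (map (\<lambda>c. enc_list (exs 0 (entries xs (T c)))) cs))"
    unfolding repr_set_map_def using repr_set_exs(1)[OF xs(1) T] by (intro repr_map_map)
  show "size (enc_list (map (\<lambda>c. enc_list (exs 0 (entries xs (T c)))) cs)) \<le>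
      match_size (card C) (card X)"
    unfolding match_size_def using repr_set_exs(2)[OF xs(1) T] length_xs length_cs
    by (intro order_trans[OF size_enc_list_le[of _ "card X * (2 * card X + 3)"]]) auto
qed

lemma match_main:
  "\<exists>v. computes (prog match_main) 0 [enc_input xs cs] v
     (match_time (card C) (card X)) \<and>
   size v \<le> match_size (card C) (card X) \<and>
   (\<exists>M. saturating_matching C (graph_Gplus X C) M \<and> map_order C M = opt \<and> repr_set_map xs cs M v)"
proof -
  obtain W T where W: "run_solve (length xs) (map code cs) = (opt, W)"
    "saturating_matching C (graph_Gplus X C) T" "map_order C T = opt"
    "\<And>c. c \<in> C \<Longrightarrow> map_of W (code c) = Some (code_set (T c))"
    using run_solve_correct by metis
  let ?v = "enc_list (map (\<lambda>c. enc_list (exs 0 (entries xs (T c)))) cs)"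
  have "computes (prog match_main) 0 [enc_input xs cs] ?v
     (match_time (card C) (card X))"
    unfolding input
    using computesD[OF run_computes(1)[OF W(1), of match_main]]
      computesD[OF outm_computes[OF W(1,4), of match_main]]
    by - (rule computesI[OF prog_nth(1)]; simp add: match_main_def match_time_def)
  then show ?thesis using repr_sets[OF W(2)] W(2,3) by blast
qed

text \<open>\<open>repr_rat\<close> accepts any numerator and denominator, so the unreduced weights
  represent the likelihoods; their shared denominator is \<open>mass\<close>.\<close>

lemma repr_weights:
  assumes T: "saturating_matching C (graph_Gplus X C) T" and c: "c \<in> C"
  shows "repr_map (List.product xs [False, True]) repr_rat (learner_of X T c)
    (enc_list (weights (length xs * (length xs + 2)) (row xs c) (entries xs (T c))))"
proof -
  have sub: "T c \<subseteq> consistent (set xs) c" using M_props(1)[OF cls T c] xs by simp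
  let ?e = "length xs * (length xs + 2)"
  have h: "2 ^ ?e = heavy (card X)" using length_xs by (simp add: heavy_def)
  have s: "atoms (entries xs (T c)) + 2 ^ ?e * nonatoms (entries xs (T c)) = mass X T c"
    unfolding h nonatoms_entries[OF xs(1) sub] atoms_entries[OF xs(1) sub] mass_def xs(2) ..
  have pos: "mass X T c > 0" by (rule mass_pos[OF cls T c])
  have "list_all2 (\<lambda>z. repr_rat (learner_of X T c z)) (List.product xs [False, True])
      (weights ?e (row xs c) (entries xs (T c)))"
    unfolding weights_def Let_def s
  proof (rule lrow_list_all2[OF sub])
    fix x assume "x \<in> set xs"
    then have x: "(x, x \<in> c) \<in> consistent X c" using xs by (simp add: consistent_eq)
    show "repr_rat (learner_of X T c (x, x \<in> c)) (if (x, x \<in> c) \<in> T c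
        then Pair (enc_nat (2 ^ ?e)) (enc_nat (mass X T c))
        else Pair (enc_nat (Suc 0)) (enc_nat (mass X T c)))"
      unfolding repr_rat_def h learner_of_def using x pos
      by (intro exI[of _ "if (x, x \<in> c) \<in> T c then heavy (card X) else 1"] exI[of _ "mass X T c"])
        auto
    have "(x, x \<notin> c) \<notin> consistent X c" by (auto simp: consistent_eq)
    then show "repr_rat (learner_of X T c (x, x \<notin> c)) (Pair (enc_nat 0) (enc_nat (Suc 0)))"
      unfolding repr_rat_def learner_of_def by (intro exI[of _ 0] exI[of _ "Suc 0"]) auto
  qed
  then show ?thesis unfolding repr_map_def by blast
qed

lemma learn_main:
  "\<exists>v. computes (prog learn_main) 0 [enc_input xs cs] v
     (learn_time (card C) (card X)) \<and>
   size v \<le> learn_size (card C) (card X) \<and>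
   (\<exists>L T vL vT. MLE_learner X C L \<and> MLE_teacher X C L T \<and> map_order C T = MLE_TD X C
      \<and> v = Pair vL vT \<and> repr_learner xs cs L vL \<and> repr_set_map xs cs T vT)"
proof -
  obtain W T where W: "run_solve (length xs) (map code cs) = (opt, W)"
    "saturating_matching C (graph_Gplus X C) T" "map_order C T = opt"
    "\<And>c. c \<in> C \<Longrightarrow> map_of W (code c) = Some (code_set (T c))"
    using run_solve_correct by metis
  let ?vT = "enc_list (map (\<lambda>c. enc_list (exs 0 (entries xs (T c)))) cs)"
  let ?w = "\<lambda>c. enc_list (weights (length xs * (length xs + 2)) (row xs c) (entries xs (T c)))"
  let ?vL = "enc_list (map ?w cs)"
  have T: "T c \<subseteq> consistent X c" "card (T c) > 0" if "c \<in> C" for c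
    using M_props(1,4)[OF cls W(2) that] by simp_all
  have "code c \<noteq> Atom" for c
  proof -
    have "length (row xs c) > 0" using length_xs fin(4) by (simp add: length_row_entries)
    then have "dec_list (code c) \<noteq> []" unfolding dec_code by auto
    then show ?thesis by (metis dec_list.simps(1))
  qed
  moreover have "nonatoms (entries xs (T c)) > 0" if "c \<in> C" for c
    using nonatoms_code(1)[OF T(1)] T(2) that by simp
  ultimately have "\<forall>v\<in>set (map code cs). size v \<le> 2 * card X \<and> v \<noteq> Atom \<and>
      (\<exists>A. map_of W v = Some (enc_list A) \<and> length A = length (dec_list v) \<and> nonatoms A > 0)"
    using code_bounds W(4) cs(2)
    by (auto simp: code_set_def length_row_entries simp del: length_greater_0_conv
        intro!: exI[of _ "entries xs (T _)"])
  moreover have "out_learner (map code cs) W = map ?w cs"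
    using W(4) cs(2) by (simp add: out_learner_def code_set_def length_row_entries)
  ultimately have l: "computes (prog learn_main) learner_ix [enc_list (map code cs), enc_pairs W]
    ?vL
      (learner_time (card C) (2 * card X))"
    using learner_ok[OF run_computes(2)[OF W(1)], of "map code cs" learn_main] length_cs by simp
  have "computes (prog learn_main) 0 [enc_input xs cs] (Pair ?vL ?vT)
     (learn_time (card C) (card X))"
    unfolding input
    using computesD[OF run_computes(1)[OF W(1), of learn_main]] computesD[OF l]
      computesD[OF outm_computes[OF W(1,4), of learn_main]]
    by - (rule computesI[OF prog_nth(1)]; simp add: learn_main_def learn_time_def)
  moreover have "size ?vL \<le> card C * (weights_size (card X * (card X + 2)) (card X) + 1)"
    using size_weights[of "row xs _" "length xs" "entries xs (T _)"] length_xs length_cs fin(4)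
    by (intro order_trans[OF size_enc_list_le[of _ "weights_size (card X * (card X + 2)) (card
      X)"]])
      (auto simp: length_row_entries)
  then have "size (Pair ?vL ?vT) \<le>
      learn_size (card C) (card X)"
    unfolding learn_size_def using repr_sets(2)[OF W(2)] by simp
  moreover have "repr_learner xs cs (learner_of X T) ?vL"
    unfolding repr_learner_def using repr_weights[OF W(2)] cs(2) by (intro repr_map_map) simp
  moreover have "map_order C T = MLE_TD X C" using W(3) SMN_eq_MLE_TD[OF cls] by simp
  ultimately show ?thesis
    using learner_of_learner[OF cls W(2)] learner_of_teacher[OF cls W(2)] repr_sets(1)[OF W(2)] by
      blast
qed

lemma map_product: "map f (List.product as bs) = concat (map (\<lambda>a. map (\<lambda>b. f (a, b)) bs) as)"
  by (induction as) auto

lemma graph_main: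
  "\<exists>v. computes (prog graph_main) 0 [enc_input xs cs] v
     (graph_time (card C) (card X)) \<and>
   size v \<le> graph_size (card C) (card X) \<and>
   repr_graph_G X C xs cs v"
proof -
  let ?edge = "\<lambda>(c, z). Pair (enc_concept cs c) (enc_example xs z)"
  \<comment> \<open>For each concept and point exactly one of the two examples is consistent, so the
    pairs \<open>(c, x)\<close> enumerate the edges without repetition.\<close>
  let ?l3 = "map (\<lambda>(c, x). (c, x, x \<in> c)) (List.product cs xs)"
  let ?v1 = "enc_list (map (enc_concept cs) cs)"
  let ?v2 = "enc_list (map (enc_example xs) (List.product xs [False, True]))"
  let ?v3 = "enc_list (map ?edge ?l3)"
  have v1: "map enc_nat [0..<length cs] = map (enc_concept cs) cs"
    unfolding map_position[OF cs(1), symmetric] by (simp add: enc_concept_def)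
  have v2: "concat (map (\<lambda>j. [Pair (enc_nat j) (enc_bool False), Pair (enc_nat j) (enc_bool
    True)]) [0..<length xs]) =
      map (enc_example xs) (List.product xs [False, True])"
    unfolding map_position[OF xs(1), symmetric] map_product by (simp add: o_def)
  have v3: "concat (map (\<lambda>(j, r). map (\<lambda>(i, b). Pair (enc_nat j) (Pair (enc_nat i) b))
    (List.enumerate 0 r))
      (List.enumerate 0 (map (row xs) cs))) = map ?edge ?l3"
    unfolding enumerate_map[OF cs(1)] map_product map_map row_def
    by (simp add: o_def enumerate_map[OF xs(1)] map_concat enc_concept_def)
  \<comment> \<open>The program reads the number of points off the first row, which exists as
    \<open>C\<close> is not empty.\<close>
  obtain c0 cs' where cs': "cs = c0 # cs'" using fin(3) cs(2) by (cases cs) auto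
  have n: "computes (prog graph_main) nums_ix [Atom, enc_list (map code cs)] ?v1 ((card C + 1) *
    (30 * card C + 80))"
    using nums_ok[of 0 "map code cs" "card C" graph_main] length_cs v1 by simp
  have a: "computes (prog graph_main) allex_ix [Atom, code c0] ?v2 ((card X + 1) * (30 * card X +
    80))"
    using allex_ok[of 0 "row xs c0" "card X" graph_main] length_xs v2
    by (simp add: code_def length_row_entries)
  have e: "computes (prog graph_main) edges_ix [Atom, enc_list (map code cs)] ?v3
      ((card C + 1) * (30 * card C + (card X + 1) * (30 * card X + 80) + 80))"
    using edges_ok[of 0 "map (row xs) cs" "card C" "card X" graph_main] length_xs length_cs v3
    by (simp add: code_def[abs_def] length_row_entries o_def)
  have cin: "enc_list (map code cs) = Pair (code c0) (enc_list (map code cs'))" by (simp add: cs')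
  have comp: "computes (prog graph_main) 0 [enc_input xs cs] (enc_list [?v1, ?v2, ?v3])
     (graph_time (card C) (card X))"
    unfolding input
    using computesD[OF n, unfolded cin] computesD[OF a] computesD[OF e, unfolded cin] unfolding cin
    by - (rule computesI[OF prog_nth(1)]; simp only: graph_main_def; simp add: graph_time_def)
  have sc: "size (enc_concept cs c) \<le> 2 * card C" for c
    using size_enc_nat[of "position cs c"] position_le[of cs c] length_cs by (simp add:
      enc_concept_def)
  have se: "size (enc_example xs z) \<le> 2 * card X + 2" for z
    using size_enc_example[of xs z] length_xs by simp
  have "size ?v1 \<le> card C * (2 * card C + 1)"
    using sc length_cs by (intro order_trans[OF size_enc_list_le[of _ "2 * card C"]]) auto
  moreover have "size ?v2 \<le> card X * 2 * (2 * card X + 2 + 1)"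
    using se length_xs by (intro order_trans[OF size_enc_list_le[of _ "2 * card X + 2"]]) auto
  ultimately have "size ?v1 + size ?v2 \<le> card C * (2 * card C + 1) + card X * 2 * (2 * card X + 3)"
    by (simp add: algebra_simps)
  moreover have "size ?v3 \<le> card C * card X * (2 * card C + 2 * card X + 4)"
  proof -
    have "size v \<le> 2 * card C + 2 * card X + 3" if "v \<in> set (map ?edge ?l3)" for v
      using that add_mono[OF sc se] by fastforce
    then have "size ?v3 \<le> length (map ?edge ?l3) * (2 * card C + 2 * card X + 3 + 1)"
      by (rule size_enc_list_le)
    also have "length (map ?edge ?l3) = card C * card X" using length_xs length_cs by simp
    also have "2 * card C + 2 * card X + 3 + 1 = 2 * card C + 2 * card X + 4" by simp
    finally show ?thesis .
  qed
  ultimately have "size (enc_list [?v1, ?v2, ?v3]) \<le> graph_size (card C) (card X)"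
    unfolding enc_list.simps val.size graph_size_def by linarith
  moreover have "repr_graph_G X C xs cs (enc_list [?v1, ?v2, ?v3])"
    unfolding repr_graph_G_def
  proof (intro exI conjI)
    show "repr_set (enc_concept cs) C ?v1" unfolding repr_set_def using cs by blast
    show "repr_set (enc_example xs) (examples X) ?v2" unfolding repr_set_def
      using xs by (intro exI[of _ "List.product xs [False, True]"]) (auto simp: distinct_product
        examples_def)
    show "repr_set ?edge (graph_G X C) ?v3" unfolding repr_set_def
    proof (intro exI conjI)
      show "distinct ?l3" using xs cs by (auto simp: distinct_map distinct_product inj_on_def)
      show "set ?l3 = graph_G X C" using xs cs by (auto simp: graph_G_def examples_def image_iff)
    qed simp
  qed simp
  ultimately show ?thesis using comp by blast
qed

end

lemma poly_bounded_times:
  "poly_bounded graph_time" "poly_bounded graph_size"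
  "poly_bounded smn_time" "poly_bounded (\<lambda>m n. 2 * n)"
  "poly_bounded match_time" "poly_bounded match_size"
  "poly_bounded learn_time" "poly_bounded learn_size"
  unfolding time_defs[abs_def]
  by (intro poly_bounded_add poly_bounded_mult poly_bounded_const poly_bounded_fst
    poly_bounded_snd)+

theorem corollary5p14:
  shows "computable_in_polytime (\<lambda>(X :: 'a set) C xs cs v. repr_graph_G X C xs cs v)
    \<and> (\<forall>(X :: 'a set) C. concept_class X C \<longrightarrow> SMN C (graph_Gplus X C) = MLE_TD X C)
    \<and> computable_in_polytime (\<lambda>(X :: 'a set) C xs cs v. v = enc_nat (SMN C (graph_Gplus X C)))
    \<and> computable_in_polytime (\<lambda>(X :: 'a set) C xs cs v. v = enc_nat (MLE_TD X C))
    \<and> computable_in_polytime (\<lambda>(X :: 'a set) C xs cs v.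
        \<exists>M. saturating_matching C (graph_Gplus X C) M
          \<and> map_order C M = SMN C (graph_Gplus X C)
          \<and> repr_set_map xs cs M v)
    \<and> computable_in_polytime (\<lambda>(X :: 'a set) C xs cs v.
        \<exists>L T vL vT. MLE_learner X C L \<and> MLE_teacher X C L T
          \<and> map_order C T = MLE_TD X C
          \<and> v = Pair vL vT \<and> repr_learner xs cs L vL \<and> repr_set_map xs cs T vT)"
proof (intro conjI allI impI)
  show "SMN C (graph_Gplus X C) = MLE_TD X C" if "concept_class X C" for X :: "'a set" and C
    using that by (rule SMN_eq_MLE_TD)
  show "computable_in_polytime (\<lambda>(X :: 'a set) C xs cs v. repr_graph_G X C xs cs v)"
    by (rule computable_in_polytimeI[OF poly_bounded_times(1,2)]) (rule listing.graph_main)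
  have smn: "\<exists>v. computes (prog smn_main) 0 [enc_input xs cs] v
       (smn_time (card C) (card X)) \<and>
     size v \<le> 2 * card X \<and> v = enc_nat (SMN C (graph_Gplus X C))"
    if "listing X C xs cs" for X :: "'a set" and C xs cs
    using listing.smn_main[OF that] listing.opt_bounds(2)[OF that]
      size_enc_nat[of "SMN C (graph_Gplus X C)"] by auto
  show "computable_in_polytime (\<lambda>(X :: 'a set) C xs cs v. v = enc_nat (SMN C (graph_Gplus X C)))"
    by (rule computable_in_polytimeI[OF poly_bounded_times(3,4) smn])
  \<comment> \<open>The program for the saturating matching number is reused, as both parameters
    agree.\<close>
  have "\<exists>v. computes (prog smn_main) 0 [enc_input xs cs] v
       (smn_time (card C) (card X)) \<and>
     size v \<le> 2 * card X \<and> v = enc_nat (MLE_TD X C)"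
    if "listing X C xs cs" for X :: "'a set" and C xs cs
    using smn[OF that] SMN_eq_MLE_TD[OF listing.cls[OF that]] by simp
  then show "computable_in_polytime (\<lambda>(X :: 'a set) C xs cs v. v = enc_nat (MLE_TD X C))"
    by (rule computable_in_polytimeI[OF poly_bounded_times(3,4)])
  show "computable_in_polytime (\<lambda>(X :: 'a set) C xs cs v.
        \<exists>M. saturating_matching C (graph_Gplus X C) M
          \<and> map_order C M = SMN C (graph_Gplus X C)
          \<and> repr_set_map xs cs M v)"
    by (rule computable_in_polytimeI[OF poly_bounded_times(5,6)]) (rule listing.match_main)
  show "computable_in_polytime (\<lambda>(X :: 'a set) C xs cs v.
        \<exists>L T vL vT. MLE_learner X C L \<and> MLE_teacher X C L T
          \<and> map_order C T = MLE_TD X C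
          \<and> v = Pair vL vT \<and> repr_learner xs cs L vL \<and> repr_set_map xs cs T vT)"
    by (rule computable_in_polytimeI[OF poly_bounded_times(7,8)]) (rule listing.learn_main)
qed

end
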